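(* Let $(M,g)$ be an oriented four-dimensional Riemannian manifold, let $t_1,t_2>0$, ${\bf t}=(t_1,t_2)$, and consider the Riemannian almost product manifolds $(\mathscr{P},G_{\bf t},\mathcal{K}_\nu)$, $\nu=1,\dots,4$, and the distributions $\mathcal{D}_\nu^\perp$ (the $(-1)$-eigendistribution of $\mathcal{K}_\nu$) defined in the context. For every $\nu=1,\dots,4$, the distribution $\mathcal{D}_\nu^\perp$ has the property $D_3$ if and only if it has the property $D_1$.
   Context: Setting. $(M,g)$ is an oriented Riemannian manifold of dimension four with Levi-Civita connection $\nabla$; $\Lambda^2TM$ carries the induced connection (also $\nabla$) and the metric $g(v_1\wedge v_2,v_3\wedge v_4)=\frac12\det[g(v_i,v_j)]$. $\Lambda^2_\pm TM$ are the $(\pm1)$-eigenbundles of the Hodge star operator; both are preserved by $\nabla$. For $a\in\Lambda^2T_pM$, $K_a$ is the skew-symmetric endomorphism of $T_pM$ with $g(K_aX,Y)=2g(a,X\wedge Y)$. The twistor spaces $\mathcal{Z}_\pm$ are the unit sphere subbundles of $\Lambda^2_\pm TM$. $\mathscr{P}=\{(\sigma^+,\sigma^-):\sigma^\pm\in\mathcal{Z}_\pm$ over the same point of $M\}$, with projection $\pi:\mathscr{P}\to M$; it is a submanifold of $\Lambda^2_+TM\oplus\Lambda^2_-TM$. The horizontal space of $\nabla$ on $\Lambda^2_+TM\oplus\Lambda^2_-TM$ at $\varkappa=(\sigma^+,\sigma^-)\in\mathscr{P}$ is tangent to $\mathscr{P}$, so $T_\varkappa\mathscr{P}=\mathcal{H}_\varkappa\oplus\mathcal{V}_\varkappa$,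 where $\mathcal{H}_\varkappa$ is this horizontal space and $\mathcal{V}_\varkappa=\{(V^+,V^-):V^\pm\in\Lambda^2_\pm T_{\pi(\varkappa)}M,\ V^\pm\perp\sigma^\pm\}$. $X^h_\varkappa\in\mathcal{H}_\varkappa$ is the horizontal lift of $X\in T_{\pi(\varkappa)}M$. Almost product structures: $\mathcal{K}_\nu X^h_\varkappa=(K_{\sigma^+}K_{\sigma^-}X)^h_\varkappa$ for all $\nu$, and on $\mathcal{V}_\varkappa$: $\mathcal{K}_1(V^+,V^-)=(V^+,V^-)$, $\mathcal{K}_2(V^+,V^-)=(V^+,-V^-)$, $\mathcal{K}_3(V^+,V^-)=-(V^+,V^-)$, $\mathcal{K}_4(V^+,V^-)=(-V^+,V^-)$. Metrics: $G_{\bf t}(X^h+V,Y^h+W)_\varkappa=g(X,Y)+t_1g(V^+,W^+)+t_2g(V^-,W^-)$; each $\mathcal{K}_\nu$ is a $G_{\bf t}$-orthogonal involution. $\mathcal{D}_\nu=\ker(\mathcal{K}_\nu-\mathrm{Id})$, and $\mathcal{D}_\nu^\perp=\ker(\mathcal{K}_\nu+\mathrm{Id})$ is its $G_{\bf t}$-orthogonal complement, $\nu=1,\dots,4$. Properties $D_1$, $D_3$. Let $(N,h)$ be a Riemannian manifold with Levi-Civita connection $\nabla$ and almost product structure $P$ (orthogonal, $P^2=\mathrm{Id}$, with eigendistributions of constant positive rank), and let $\mathfrak{D}$ be one of its $(\pm1)$-eigendistributions, of rank $m$. Put $\alpha(X)=\sum_{l=1}^m h((\nabla_{E_l}P)(E_l),X)$,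 $X\in T_pN$, where $\{E_l\}$ is an orthonormal basis of $\mathfrak{D}_p$. $\mathfrak{D}$ has the property $D_1$ if $(\nabla_AP)(B)=-(\nabla_BP)(A)$ for all $A,B\in\mathfrak{D}$; it has the property $D_3$ if $h((\nabla_AP)(B),X)+h((\nabla_BP)(A),X)=\frac{2}{m}h(A,B)\alpha(X)$ for all $A,B\in\mathfrak{D}$, $X\in\mathfrak{D}^\perp$. Here these are applied to $N=\mathscr{P}$, $h=G_{\bf t}$, $P=\mathcal{K}_\nu$. *)

theory Defs
  imports "HOL-Analysis.Analysis"
begin

section \<open>Smooth maps and smooth manifolds\<close>

text \<open>Class C^k on an open set of a Euclidean space, by iterated directional derivatives.\<close>

fun Ck_on :: "nat \<Rightarrow> 'a::euclidean_space set \<Rightarrow> ('a \<Rightarrow> 'b::euclidean_space) \<Rightarrow> bool" where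
  "Ck_on 0 S f \<longleftrightarrow> continuous_on S f"
| "Ck_on (Suc k) S f \<longleftrightarrow>
     (\<forall>x\<in>S. f differentiable (at x)) \<and> (\<forall>v. Ck_on k S (\<lambda>x. frechet_derivative f (at x) v))"

definition smooth_on :: "'a::euclidean_space set \<Rightarrow> ('a \<Rightarrow> 'b::euclidean_space) \<Rightarrow> bool" where
  "smooth_on S f \<longleftrightarrow> (\<forall>k. Ck_on k S f)"

text \<open>A chart is a domain together with a coordinate map; the map is relevant on the domain only.
  The points of a manifold are the points covered by its atlas.\<close>

type_synonym ('n, 'e) chart = "'n set \<times> ('n \<Rightarrow> 'e)"

abbreviation cdom :: "('n, 'e) chart \<Rightarrow> 'n set" where "cdom \<equiv> fst"
abbreviation cmap :: "('n, 'e) chart \<Rightarrow> 'n \<Rightarrow> 'e" where "cmap \<equiv> snd"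

definition cinv :: "('n, 'e) chart \<Rightarrow> 'e \<Rightarrow> 'n" where
  "cinv c = inv_into (cdom c) (cmap c)"

definition points :: "('n, 'e) chart set \<Rightarrow> 'n set" where
  "points A = (\<Union>c\<in>A. cdom c)"

definition smooth_atlas :: "('n, 'e::euclidean_space) chart set \<Rightarrow> bool" where
  "smooth_atlas A \<longleftrightarrow>
     (\<forall>c\<in>A. inj_on (cmap c) (cdom c) \<and> open (cmap c ` cdom c)) \<and>
     (\<forall>c\<in>A. \<forall>d\<in>A. open (cmap c ` (cdom c \<inter> cdom d)) \<and>
        smooth_on (cmap c ` (cdom c \<inter> cdom d)) (cmap d \<circ> cinv c))"

definition atlas_open :: "('n, 'e::euclidean_space) chart set \<Rightarrow> 'n set \<Rightarrow> bool" where
  "atlas_open A W \<longleftrightarrow> W \<subseteq> points A \<and> (\<forall>c\<in>A. open (cmap c ` (W \<inter> cdom c)))"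

definition atlas_topology :: "('n, 'e::euclidean_space) chart set \<Rightarrow> 'n topology" where
  "atlas_topology A = topology (atlas_open A)"

lemma openin_atlas_topology:
  assumes "smooth_atlas A"
  shows "openin (atlas_topology A) = atlas_open A"
proof -
  have inj: "inj_on (cmap c) (cdom c)" if "c \<in> A" for c
    using assms that by (auto simp: smooth_atlas_def)
  have "istopology (atlas_open A)"
    unfolding istopology_def
  proof (intro conjI allI impI)
    fix S T assume S: "atlas_open A S" and T: "atlas_open A T"
    have "cmap c ` (S \<inter> T \<inter> cdom c) = cmap c ` (S \<inter> cdom c) \<inter> cmap c ` (T \<inter> cdom c)"
      if "c \<in> A" for c
      using inj_on_image_Int[OF inj[OF that], of "S \<inter> cdom c" "T \<inter> cdom c"]
      by (simp add: Int_ac)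
    then show "atlas_open A (S \<inter> T)"
      using S T by (auto simp: atlas_open_def)
  next
    fix \<K> assume K: "\<forall>S\<in>\<K>. atlas_open A S"
    have "cmap c ` (\<Union>\<K> \<inter> cdom c) = (\<Union>S\<in>\<K>. cmap c ` (S \<inter> cdom c))" for c
      by blast
    moreover have "open (\<Union>S\<in>\<K>. cmap c ` (S \<inter> cdom c))" if "c \<in> A" for c
      using K that by (intro open_UN) (auto simp: atlas_open_def)
    ultimately show "atlas_open A (\<Union>\<K>)"
      using K unfolding atlas_open_def by (metis Union_least)
  qed
  then show ?thesis
    by (simp add: atlas_topology_def topology_inverse')
qed

definition smooth_manifold :: "('n, 'e::euclidean_space) chart set \<Rightarrow> bool" where
  "smooth_manifold A \<longleftrightarrow>
     smooth_atlas A \<and> Hausdorff_space (atlas_topology A) \<and> second_countable (atlas_topology A)"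

text \<open>An orientation is given by an atlas whose coordinate changes preserve the orientation
  of \<open>\<real>\<^sup>n\<close>.\<close>

definition oriented_atlas :: "('n, real ^ 'd) chart set \<Rightarrow> bool" where
  "oriented_atlas A \<longleftrightarrow>
     (\<forall>c\<in>A. \<forall>d\<in>A. \<forall>x \<in> cmap c ` (cdom c \<inter> cdom d).
        det (matrix (frechet_derivative (cmap d \<circ> cinv c) (at x))) > 0)"

text \<open>The tangent space at \<open>p\<close> is identified with the coordinate space of one fixed
  chart around \<open>p\<close>.\<close>

definition chart_at :: "('n, 'e) chart set \<Rightarrow> 'n \<Rightarrow> ('n, 'e) chart" where
  "chart_at A p = (SOME c. c \<in> A \<and> p \<in> cdom c)"

text \<open>Let \<open>B p\<close> be the chart by which tangent vectors at \<open>p\<close> are written down (it may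
  be a chart of an ambient manifold). Then \<open>tframe B c p\<close> sends the coordinates, with respect to
  \<open>c\<close>, of a tangent vector at \<open>p\<close> to that vector: it is the inverse of the differential of
  \<open>c\<close> at \<open>p\<close>.\<close>

definition tframe ::
  "('n \<Rightarrow> ('n, 'v::euclidean_space) chart) \<Rightarrow> ('n, 'f::euclidean_space) chart \<Rightarrow> 'n \<Rightarrow> 'f \<Rightarrow> 'v"
  where
  "tframe B c p = frechet_derivative (cmap (B p) \<circ> cinv c) (at (cmap c p))"

text \<open>The charts of an embedded submanifold \<open>S\<close>, modelled on \<open>'f\<close>, of the manifold with
  atlas \<open>A\<close>: all smooth diffeomorphisms of relatively open subsets of \<open>S\<close> onto open subsets
  of \<open>'f\<close>.\<close>

definition submanifold_atlas ::
  "('n, 'v::euclidean_space) chart set \<Rightarrow> 'n set \<Rightarrow> ('n, 'f::euclidean_space) chart set" where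
  "submanifold_atlas A S =
     {c. cdom c \<subseteq> S \<and> inj_on (cmap c) (cdom c) \<and> open (cmap c ` cdom c) \<and>
         (\<forall>b\<in>A.
            openin (top_of_set (cmap b ` (S \<inter> cdom b))) (cmap b ` (cdom c \<inter> cdom b)) \<and>
            open (cmap c ` (cdom c \<inter> cdom b)) \<and>
            smooth_on (cmap c ` (cdom c \<inter> cdom b)) (cmap b \<circ> cinv c) \<and>
            (\<forall>x \<in> cmap c ` (cdom c \<inter> cdom b).
               inj (frechet_derivative (cmap b \<circ> cinv c) (at x))))}"


section \<open>Riemannian metrics and the Levi-Civita connection\<close>

definition is_inner_product :: "('e::real_vector \<Rightarrow> 'e \<Rightarrow> real) \<Rightarrow> bool" where
  "is_inner_product B \<longleftrightarrow>
     bilinear B \<and> (\<forall>v w. B v w = B w v) \<and> (\<forall>v. v \<noteq> 0 \<longrightarrow> B v v > 0)"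

text \<open>Coordinate expressions, in the chart \<open>c\<close>, of a field \<open>h\<close> of bilinear forms and of a
  field \<open>P\<close> of endomorphisms; \<open>F c p\<close> maps coordinates with respect to \<open>c\<close> to
  tangent vectors at \<open>p\<close>.\<close>

definition local_form ::
  "(('n, 'f) chart \<Rightarrow> 'n \<Rightarrow> 'f \<Rightarrow> 'v) \<Rightarrow> ('n \<Rightarrow> 'v \<Rightarrow> 'v \<Rightarrow> real) \<Rightarrow> ('n, 'f) chart
     \<Rightarrow> 'f \<Rightarrow> 'f \<Rightarrow> 'f \<Rightarrow> real" where
  "local_form F h c x u v = h (cinv c x) (F c (cinv c x) u) (F c (cinv c x) v)"

definition local_endo ::
  "(('n, 'f) chart \<Rightarrow> 'n \<Rightarrow> 'f \<Rightarrow> 'v) \<Rightarrow> ('n \<Rightarrow> 'v \<Rightarrow> 'v) \<Rightarrow> ('n, 'f) chart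
     \<Rightarrow> 'f \<Rightarrow> 'f \<Rightarrow> 'f" where
  "local_endo F P c x u = inv (F c (cinv c x)) (P (cinv c x) (F c (cinv c x) u))"

definition riemannian_metric ::
  "('n, 'e::euclidean_space) chart set \<Rightarrow> ('n \<Rightarrow> 'e \<Rightarrow> 'e \<Rightarrow> real) \<Rightarrow> bool" where
  "riemannian_metric A g \<longleftrightarrow>
     (\<forall>p\<in>points A. is_inner_product (g p)) \<and>
     (\<forall>c\<in>A. \<forall>u v. smooth_on (cmap c ` cdom c)
        (\<lambda>x. local_form (tframe (chart_at A)) g c x u v))"

text \<open>On an open subset of a Euclidean space a connection has the form
  \<open>\<nabla>\<^bsub>u\<^esub> Y = D Y u + \<Gamma> u Y\<close>. The Levi-Civita connection of \<open>h\<close> is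
  the torsion-free one (\<open>\<Gamma>\<close> symmetric) for which \<open>h\<close> is parallel.\<close>

definition is_levi_civita ::
  "('e::euclidean_space \<Rightarrow> 'e \<Rightarrow> 'e \<Rightarrow> real) \<Rightarrow> 'e \<Rightarrow> ('e \<Rightarrow> 'e \<Rightarrow> 'e) \<Rightarrow> bool" where
  "is_levi_civita h x \<Gamma> \<longleftrightarrow>
     bilinear \<Gamma> \<and> (\<forall>u v. \<Gamma> u v = \<Gamma> v u) \<and>
     (\<forall>u v w. frechet_derivative (\<lambda>y. h y v w) (at x) u = h x (\<Gamma> u v) w + h x v (\<Gamma> u w))"

definition christoffel ::
  "('e::euclidean_space \<Rightarrow> 'e \<Rightarrow> 'e \<Rightarrow> real) \<Rightarrow> 'e \<Rightarrow> 'e \<Rightarrow> 'e \<Rightarrow> 'e" where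
  "christoffel h x = (THE \<Gamma>. is_levi_civita h x \<Gamma>)"

lemma inner_product_represents:
  fixes B :: "'e::euclidean_space \<Rightarrow> 'e \<Rightarrow> real"
  assumes B: "is_inner_product B" and f: "linear f"
  shows "\<exists>c. \<forall>d. B c d = f d"
proof -
  have bil: "bilinear B"
    using B by (simp add: is_inner_product_def)
  have lin: "linear (\<lambda>c. B c d)" "linear (B c)" for c d
    using bil by (auto simp: bilinear_def)
  define L where "L = (\<lambda>c. \<Sum>b\<in>Basis. B c b *\<^sub>R b)"
  have L: "L c \<bullet> b = B c b" if "b \<in> Basis" for c b
    using that by (simp add: L_def)
  have "linear L"
    unfolding L_def
    by (intro linear_compose_sum ballI) (simp add: linear_iff bilinear_ladd[OF bil]
        bilinear_lmul[OF bil] scaleR_add_left)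
  moreover have "inj L"
  proof (rule linear_injective_0[OF \<open>linear L\<close>, THEN iffD2], intro allI impI)
    fix c assume "L c = 0"
    then have "B c b = 0" if "b \<in> Basis" for b
      using L[OF that, of c] by simp
    then have "B c = (\<lambda>_. 0)"
      by (intro linear_eq_stdbasis[OF lin(2)]) (auto simp: linear_zero)
    then have "B c c = 0"
      by (rule fun_cong)
    then show "c = 0"
      using B by (metis is_inner_product_def less_irrefl)
  qed
  ultimately have "surj L"
    by (metis linear_injective_imp_surjective)
  then obtain c where c: "L c = (\<Sum>b\<in>Basis. f b *\<^sub>R b)"
    by (metis surjD)
  have "B c b = f b" if "b \<in> Basis" for b
    using L[OF that, of c] that by (simp add: c)
  then have "B c = f"
    by (rule linear_eq_stdbasis[OF lin(2) f])
  then show ?thesis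
    by auto
qed

lemma levi_civita_ex1:
  fixes h :: "'e::euclidean_space \<Rightarrow> 'e \<Rightarrow> 'e \<Rightarrow> real"
  assumes S: "open S" "x \<in> S" and ip: "\<And>y. y \<in> S \<Longrightarrow> is_inner_product (h y)"
    and diff: "\<And>v w. (\<lambda>y. h y v w) differentiable (at x)"
  shows "\<exists>!\<Gamma>. is_levi_civita h x \<Gamma>"
proof -
  define D where "D = (\<lambda>u v w. frechet_derivative (\<lambda>y. h y v w) (at x) u)"
  have has: "((\<lambda>y. h y v w) has_derivative (\<lambda>u. D u v w)) (at x)" for v w
    using diff[of v w] by (simp add: D_def frechet_derivative_works)
  have bil: "bilinear (h y)" and sym: "h y v w = h y w v" if "y \<in> S" for y v w
    using ip[OF that] by (auto simp: is_inner_product_def)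
  have D_eqI: "D u v w = E u"
    if "((\<lambda>y. k y) has_derivative E) (at x)" "\<And>y. y \<in> S \<Longrightarrow> k y = h y v w" for u v w k E
    using has_derivative_unique[OF has has_derivative_transform_within_open[OF that(1) S that(2)]]
    by metis
  have Dsym: "D u v w = D u w v" for u v w
    by (rule D_eqI[OF has]) (rule sym)
  have Dadd1: "D (u + u') v w = D u v w + D u' v w" and Dscale1: "D (r *\<^sub>R u) v w = r * D u v w"
    for u u' v w r
    using has_derivative_linear[OF has[of v w]] by (auto simp: linear_iff)
  have Dadd2: "D u (v + v') w = D u v w + D u v' w" for u v v' w
    by (rule D_eqI[OF has_derivative_add[OF has has]]) (simp add: bilinear_ladd[OF bil])
  have Dscale2: "D u (r *\<^sub>R v) w = r * D u v w" for u v w r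
    by (rule D_eqI[OF has_derivative_mult_right[OF has]]) (simp add: bilinear_lmul[OF bil])
  have Dadd3: "D u v (w + w') = D u v w + D u v w'"
    and Dscale3: "D u v (r *\<^sub>R w) = r * D u v w" for u v w w' r
    by (simp_all only: Dsym[of u v] Dadd2 Dscale2)
  note Dlin = Dadd1 Dscale1 Dadd2 Dscale2 Dadd3 Dscale3
  define k where "k = (\<lambda>u v w. (D u v w + D v u w - D w u v) / 2)"
  have "linear (k u v)" for u v
    by (auto simp: linear_iff k_def Dlin field_simps)
  then have "\<exists>c. \<forall>w. h x c w = k u v w" for u v
    by (rule inner_product_represents[OF ip[OF S(2)]])
  then obtain \<Gamma> where \<Gamma>: "h x (\<Gamma> u v) w = k u v w" for u v w
    by metis
  have eqI: "a = b" if "\<And>w. h x a w = h x b w" for a b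
  proof -
    have "h x (a - b) (a - b) = 0"
      using that by (simp add: bilinear_lsub[OF bil[OF S(2)]])
    then show ?thesis
      using ip[OF S(2)] by (metis is_inner_product_def less_irrefl right_minus_eq)
  qed
  have ladd: "h x (a + b) w = h x a w + h x b w" and lmul: "h x (r *\<^sub>R a) w = r * h x a w"
    for a b w r
    using bilinear_ladd[OF bil[OF S(2)]] bilinear_lmul[OF bil[OF S(2)]] by auto
  have "bilinear \<Gamma>"
    unfolding bilinear_def linear_iff
    by (intro conjI allI; rule eqI) (simp_all add: ladd lmul \<Gamma> k_def Dlin field_simps)
  moreover have "\<Gamma> u v = \<Gamma> v u" for u v
    by (rule eqI) (simp add: \<Gamma> k_def Dsym[of _ u v])
  moreover have "D u v w = h x (\<Gamma> u v) w + h x v (\<Gamma> u w)" for u v w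
    by (simp add: \<Gamma> sym[OF S(2), of v "\<Gamma> u w"] k_def Dsym[of _ w v] Dsym[of _ w u] Dsym[of _ v u] field_simps)
  ultimately have ex: "is_levi_civita h x \<Gamma>"
    unfolding is_levi_civita_def D_def by blast
  have "h x (\<Gamma>' u v) w = k u v w" if "is_levi_civita h x \<Gamma>'" for \<Gamma>' u v w
  proof -
    have s: "\<Gamma>' a b = \<Gamma>' b a" and c: "D a b d = h x (\<Gamma>' a b) d + h x b (\<Gamma>' a d)" for a b d
      using that unfolding is_levi_civita_def D_def by blast+
    show ?thesis
      unfolding k_def c s[of v u] s[of w u] s[of w v]
      by (simp add: sym[OF S(2), of v "\<Gamma>' u w"] sym[OF S(2), of u "\<Gamma>' v w"])
  qed
  then have "\<Gamma>' = \<Gamma>" if "is_levi_civita h x \<Gamma>'" for \<Gamma>'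
    using that \<Gamma> by (intro ext eqI) metis
  with ex show ?thesis
    by blast
qed

text \<open>The vector \<open>(\<nabla>\<^bsub>X\<^esub> P) Y\<close> at \<open>p\<close>, for the Levi-Civita connection of
  \<open>h\<close>, computed in the chart \<open>c\<close>.\<close>

definition nabla_endo ::
  "(('n, 'f::euclidean_space) chart \<Rightarrow> 'n \<Rightarrow> 'f \<Rightarrow> 'v) \<Rightarrow> ('n \<Rightarrow> 'v \<Rightarrow> 'v \<Rightarrow> real)
     \<Rightarrow> ('n \<Rightarrow> 'v \<Rightarrow> 'v) \<Rightarrow> ('n, 'f) chart \<Rightarrow> 'n \<Rightarrow> 'v \<Rightarrow> 'v \<Rightarrow> 'v" where
  "nabla_endo F h P c p X Y =
     (let x = cmap c p; u = inv (F c p) X; v = inv (F c p) Y;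
          \<Gamma> = christoffel (local_form F h c) x; Q = local_endo F P c
      in F c p (frechet_derivative (\<lambda>y. Q y v) (at x) u + \<Gamma> u (Q x v) - Q x (\<Gamma> u v)))"


section \<open>The properties \<open>D\<^sub>1\<close> and \<open>D\<^sub>3\<close>\<close>

text \<open>Here \<open>A\<close> is an atlas, \<open>F\<close> as above, and \<open>T p\<close> the tangent space at \<open>p\<close>. The
  vector \<open>nabla_endo F h P c p X Y\<close> does not depend on the chart \<open>c\<close> around \<open>p\<close>, so
  the quantification over charts is only a way of covering all points. Likewise \<open>alpha\<close> does
  not depend on the chosen orthonormal basis.\<close>

definition minus_eigen :: "('n \<Rightarrow> 'v set) \<Rightarrow> ('n \<Rightarrow> 'v \<Rightarrow> 'v::real_vector) \<Rightarrow> 'n \<Rightarrow> 'v set" where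
  "minus_eigen T P p = {X \<in> T p. P p X = - X}"

definition orth_compl ::
  "('n \<Rightarrow> 'v set) \<Rightarrow> ('n \<Rightarrow> 'v \<Rightarrow> 'v \<Rightarrow> real) \<Rightarrow> ('n \<Rightarrow> 'v set) \<Rightarrow> 'n \<Rightarrow> 'v set" where
  "orth_compl T h D p = {X \<in> T p. \<forall>Y \<in> D p. h p Y X = 0}"

definition is_onb :: "('v \<Rightarrow> 'v \<Rightarrow> real) \<Rightarrow> 'v::real_vector set \<Rightarrow> 'v set \<Rightarrow> bool" where
  "is_onb B V E \<longleftrightarrow>
     finite E \<and> E \<subseteq> V \<and> span E = V \<and> (\<forall>e\<in>E. \<forall>f\<in>E. B e f = (if e = f then 1 else 0))"

definition alpha ::
  "(('n, 'f::euclidean_space) chart \<Rightarrow> 'n \<Rightarrow> 'f \<Rightarrow> 'v::real_vector) \<Rightarrow> ('n \<Rightarrow> 'v \<Rightarrow> 'v \<Rightarrow> real)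
     \<Rightarrow> ('n \<Rightarrow> 'v \<Rightarrow> 'v) \<Rightarrow> ('n \<Rightarrow> 'v set) \<Rightarrow> ('n, 'f) chart \<Rightarrow> 'n \<Rightarrow> 'v \<Rightarrow> real" where
  "alpha F h P D c p X =
     (\<Sum>e \<in> (SOME E. is_onb (h p) (D p) E). h p (nabla_endo F h P c p e e) X)"

definition property_D1 ::
  "('n, 'f::euclidean_space) chart set \<Rightarrow> (('n, 'f) chart \<Rightarrow> 'n \<Rightarrow> 'f \<Rightarrow> 'v::real_vector)
     \<Rightarrow> ('n \<Rightarrow> 'v \<Rightarrow> 'v \<Rightarrow> real) \<Rightarrow> ('n \<Rightarrow> 'v \<Rightarrow> 'v) \<Rightarrow> ('n \<Rightarrow> 'v set) \<Rightarrow> bool" where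
  "property_D1 A F h P D \<longleftrightarrow>
     (\<forall>c\<in>A. \<forall>p\<in>cdom c. \<forall>X\<in>D p. \<forall>Y\<in>D p.
        nabla_endo F h P c p X Y = - nabla_endo F h P c p Y X)"

definition property_D3 ::
  "('n, 'f::euclidean_space) chart set \<Rightarrow> (('n, 'f) chart \<Rightarrow> 'n \<Rightarrow> 'f \<Rightarrow> 'v::euclidean_space)
     \<Rightarrow> ('n \<Rightarrow> 'v set) \<Rightarrow> ('n \<Rightarrow> 'v \<Rightarrow> 'v \<Rightarrow> real) \<Rightarrow> ('n \<Rightarrow> 'v \<Rightarrow> 'v) \<Rightarrow> ('n \<Rightarrow> 'v set) \<Rightarrow> bool" where
  "property_D3 A F T h P D \<longleftrightarrow>
     (\<forall>c\<in>A. \<forall>p\<in>cdom c. \<forall>X\<in>D p. \<forall>Y\<in>D p. \<forall>Z\<in>orth_compl T h D p.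
        h p (nabla_endo F h P c p X Y) Z + h p (nabla_endo F h P c p Y X) Z
          = 2 / real (dim (D p)) * h p X Y * alpha F h P D c p Z)"


section \<open>Bivectors in dimension four\<close>

text \<open>Bivectors are skew-symmetric contravariant 2-tensors, written as matrices.\<close>

definition wedge :: "real ^ 4 \<Rightarrow> real ^ 4 \<Rightarrow> real ^ 4 ^ 4" where
  "wedge v w = (\<chi> i j. v $ i * w $ j - w $ i * v $ j)"

definition bivectors :: "(real ^ 4 ^ 4) set" where
  "bivectors = {a. transpose a = - a}"

definition biv_inner :: "(real ^ 4 \<Rightarrow> real ^ 4 \<Rightarrow> real) \<Rightarrow> real ^ 4 ^ 4 \<Rightarrow> real ^ 4 ^ 4 \<Rightarrow> real" where
  "biv_inner B a b =
     (\<Sum>i\<in>UNIV. \<Sum>j\<in>UNIV. \<Sum>k\<in>UNIV. \<Sum>l\<in>UNIV.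
        a $ i $ j * b $ k $ l * B (axis i 1) (axis k 1) * B (axis j 1) (axis l 1)) / 4"

text \<open>\<open>K\<^sub>a\<close> is determined by \<open>B (K\<^sub>a X) Y = 2 B (a, X \<and> Y)\<close>.\<close>

definition Kend :: "(real ^ 4 \<Rightarrow> real ^ 4 \<Rightarrow> real) \<Rightarrow> real ^ 4 ^ 4 \<Rightarrow> real ^ 4 \<Rightarrow> real ^ 4" where
  "Kend B a X = (THE Z. \<forall>Y. B Z Y = 2 * biv_inner B a (wedge X Y))"

definition oriented_onb :: "(real ^ 4 \<Rightarrow> real ^ 4 \<Rightarrow> real) \<Rightarrow> (4 \<Rightarrow> real ^ 4) \<Rightarrow> bool" where
  "oriented_onb B e \<longleftrightarrow>
     (\<forall>i j. B (e i) (e j) = (if i = j then 1 else 0)) \<and> det (\<chi> i. e i) > 0"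

text \<open>Since the oriented orthonormal basis is arbitrary, the last condition prescribes the
  operator on every \<open>e i \<and> e j\<close>. The condition on symmetric matrices fixes the values outside
  the space of bivectors, which are of no interest.\<close>

definition hodge :: "(real ^ 4 \<Rightarrow> real ^ 4 \<Rightarrow> real) \<Rightarrow> real ^ 4 ^ 4 \<Rightarrow> real ^ 4 ^ 4" where
  "hodge B = (THE S. linear S \<and> (\<forall>a. transpose a = a \<longrightarrow> S a = 0) \<and>
     (\<forall>e. oriented_onb B e \<longrightarrow> S (wedge (e 1) (e 2)) = wedge (e 3) (e 4)))"

definition Lambda2 :: "real \<Rightarrow> (real ^ 4 \<Rightarrow> real ^ 4 \<Rightarrow> real) \<Rightarrow> (real ^ 4 ^ 4) set" where
  "Lambda2 s B = {a \<in> bivectors. hodge B a = s *\<^sub>R a}"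

definition twistor_fibre :: "real \<Rightarrow> (real ^ 4 \<Rightarrow> real ^ 4 \<Rightarrow> real) \<Rightarrow> (real ^ 4 ^ 4) set" where
  "twistor_fibre s B = {a \<in> Lambda2 s B. biv_inner B a a = 1}"

lemma biv_inner_wedge:
  assumes "bilinear B"
  shows "biv_inner B (wedge v1 v2) (wedge v3 v4) = (B v1 v3 * B v2 v4 - B v1 v4 * B v2 v3) / 2"
proof -
  have B: "B v w = (\<Sum>i\<in>UNIV. \<Sum>k\<in>UNIV. v $ i * w $ k * B (axis i 1) (axis k 1))" for v w
  proof -
    have "B v w = B (\<Sum>i\<in>UNIV. v $ i *\<^sub>R axis i 1) (\<Sum>k\<in>UNIV. w $ k *\<^sub>R axis k 1)"
      using basis_expansion[of v] basis_expansion[of w] by (simp add: scalar_mult_eq_scaleR)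
    also have "\<dots> = (\<Sum>i\<in>UNIV. \<Sum>k\<in>UNIV. B (v $ i *\<^sub>R axis i 1) (w $ k *\<^sub>R axis k 1))"
      using bilinear_sum[OF assms, of "\<lambda>i. v $ i *\<^sub>R axis i 1" UNIV
          "\<lambda>k. w $ k *\<^sub>R axis k 1" UNIV]
      by (simp only: sum.cartesian_product)
    finally show ?thesis
      by (simp add: bilinear_lmul[OF assms] bilinear_rmul[OF assms] mult_ac)
  qed
  have prod: "(\<Sum>i\<in>UNIV. \<Sum>j\<in>UNIV. \<Sum>k\<in>UNIV. \<Sum>l\<in>UNIV.
       v $ i * w $ j * (x $ k * y $ l) * B (axis i 1) (axis k 1) * B (axis j 1) (axis l 1))
     = B v x * B w y" for v w x y
    unfolding B[of v x] B[of w y] sum_product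
    by (intro sum.cong refl) (simp add: mult_ac)
  show ?thesis
    unfolding biv_inner_def wedge_def vec_lambda_beta left_diff_distrib right_diff_distrib
      sum_subtractf prod
    by simp
qed


section \<open>The twistor product bundle\<close>

type_synonym 'm bundle_point = "'m \<times> (real ^ 4 ^ 4) \<times> (real ^ 4 ^ 4)"
type_synonym bundle_vector = "(real ^ 4) \<times> (real ^ 4 ^ 4) \<times> (real ^ 4 ^ 4)"

text \<open>A point of the bundle consists of \<open>p\<close> and two tensors at \<open>p\<close>, written in
  \<open>chart_at A p\<close>. A chart \<open>c\<close> of the base induces a bundle chart, which rewrites the tensors
  in the coordinates of \<open>c\<close>.\<close>

definition jacobian_at :: "('m, real ^ 4) chart set \<Rightarrow> ('m, real ^ 4) chart \<Rightarrow> 'm \<Rightarrow> real ^ 4 ^ 4" where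
  "jacobian_at A c p =
     matrix (frechet_derivative (cmap c \<circ> cinv (chart_at A p)) (at (cmap (chart_at A p) p)))"

definition bundle_chart ::
  "('m, real ^ 4) chart set \<Rightarrow> ('m, real ^ 4) chart \<Rightarrow> ('m bundle_point, bundle_vector) chart" where
  "bundle_chart A c =
     ({\<kappa>. fst \<kappa> \<in> cdom c},
      \<lambda>(p, a, b). let J = jacobian_at A c p
        in (cmap c p, J ** a ** transpose J, J ** b ** transpose J))"

definition twistor_product ::
  "('m, real ^ 4) chart set \<Rightarrow> ('m \<Rightarrow> real ^ 4 \<Rightarrow> real ^ 4 \<Rightarrow> real) \<Rightarrow> 'm bundle_point set" where
  "twistor_product A g =
     {(p, a, b). p \<in> points A \<and> a \<in> twistor_fibre 1 (g p) \<and> b \<in> twistor_fibre (-1) (g p)}"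

text \<open>The total dimension is 4 + 2 + 2.\<close>

definition twistor_atlas ::
  "('m, real ^ 4) chart set \<Rightarrow> ('m \<Rightarrow> real ^ 4 \<Rightarrow> real ^ 4 \<Rightarrow> real)
     \<Rightarrow> ('m bundle_point, real ^ 8) chart set" where
  "twistor_atlas A g = submanifold_atlas (bundle_chart A ` A) (twistor_product A g)"

text \<open>Tangent vectors at \<open>\<kappa>\<close> over \<open>p\<close> are written in the bundle chart induced by
  \<open>chart_at A p\<close>.\<close>

definition twistor_frame ::
  "('m, real ^ 4) chart set \<Rightarrow> ('m bundle_point, real ^ 8) chart \<Rightarrow> 'm bundle_point
     \<Rightarrow> real ^ 8 \<Rightarrow> bundle_vector" where
  "twistor_frame A = tframe (\<lambda>\<kappa>. bundle_chart A (chart_at A (fst \<kappa>)))"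

text \<open>The connection form of the base at \<open>p\<close>, and the one it induces on contravariant
  2-tensors by the Leibniz rule.\<close>

definition base_gamma ::
  "('m, real ^ 4) chart set \<Rightarrow> ('m \<Rightarrow> real ^ 4 \<Rightarrow> real ^ 4 \<Rightarrow> real) \<Rightarrow> 'm
     \<Rightarrow> real ^ 4 \<Rightarrow> real ^ 4 \<Rightarrow> real ^ 4" where
  "base_gamma A g p =
     christoffel (local_form (tframe (chart_at A)) g (chart_at A p)) (cmap (chart_at A p) p)"

definition tensor_gamma ::
  "('m, real ^ 4) chart set \<Rightarrow> ('m \<Rightarrow> real ^ 4 \<Rightarrow> real ^ 4 \<Rightarrow> real) \<Rightarrow> 'm
     \<Rightarrow> real ^ 4 \<Rightarrow> real ^ 4 ^ 4 \<Rightarrow> real ^ 4 ^ 4" where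
  "tensor_gamma A g p X a =
     (let G = matrix (base_gamma A g p X) in G ** a + a ** transpose G)"

definition hlift ::
  "('m, real ^ 4) chart set \<Rightarrow> ('m \<Rightarrow> real ^ 4 \<Rightarrow> real ^ 4 \<Rightarrow> real) \<Rightarrow> 'm bundle_point
     \<Rightarrow> real ^ 4 \<Rightarrow> bundle_vector" where
  "hlift A g = (\<lambda>(p, a, b) X. (X, - tensor_gamma A g p X a, - tensor_gamma A g p X b))"

definition vert_space ::
  "('m \<Rightarrow> real ^ 4 \<Rightarrow> real ^ 4 \<Rightarrow> real) \<Rightarrow> 'm bundle_point \<Rightarrow> ((real ^ 4 ^ 4) \<times> (real ^ 4 ^ 4)) set"
  where
  "vert_space g = (\<lambda>(p, a, b).
     {(V, W). V \<in> Lambda2 1 (g p) \<and> W \<in> Lambda2 (-1) (g p) \<and>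
        biv_inner (g p) V a = 0 \<and> biv_inner (g p) W b = 0})"

definition twistor_tangent ::
  "('m, real ^ 4) chart set \<Rightarrow> ('m \<Rightarrow> real ^ 4 \<Rightarrow> real ^ 4 \<Rightarrow> real) \<Rightarrow> 'm bundle_point
     \<Rightarrow> bundle_vector set" where
  "twistor_tangent A g \<kappa> = {hlift A g \<kappa> X + (0, V) |X V. V \<in> vert_space g \<kappa>}"

text \<open>The vertical component of a tangent vector; the horizontal one is the horizontal lift of
  the first entry.\<close>

definition vpart ::
  "('m, real ^ 4) chart set \<Rightarrow> ('m \<Rightarrow> real ^ 4 \<Rightarrow> real ^ 4 \<Rightarrow> real) \<Rightarrow> 'm bundle_point
     \<Rightarrow> bundle_vector \<Rightarrow> (real ^ 4 ^ 4) \<times> (real ^ 4 ^ 4)" where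
  "vpart A g \<kappa> \<xi> = snd (\<xi> - hlift A g \<kappa> (fst \<xi>))"

definition Gmetric ::
  "('m, real ^ 4) chart set \<Rightarrow> ('m \<Rightarrow> real ^ 4 \<Rightarrow> real ^ 4 \<Rightarrow> real) \<Rightarrow> real \<Rightarrow> real
     \<Rightarrow> 'm bundle_point \<Rightarrow> bundle_vector \<Rightarrow> bundle_vector \<Rightarrow> real" where
  "Gmetric A g t1 t2 \<kappa> \<xi> \<eta> =
     g (fst \<kappa>) (fst \<xi>) (fst \<eta>)
     + t1 * biv_inner (g (fst \<kappa>)) (fst (vpart A g \<kappa> \<xi>)) (fst (vpart A g \<kappa> \<eta>))
     + t2 * biv_inner (g (fst \<kappa>)) (snd (vpart A g \<kappa> \<xi>)) (snd (vpart A g \<kappa> \<eta>))"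

definition vert_K :: "nat \<Rightarrow> (real ^ 4 ^ 4) \<times> (real ^ 4 ^ 4) \<Rightarrow> (real ^ 4 ^ 4) \<times> (real ^ 4 ^ 4)" where
  "vert_K \<nu> = (\<lambda>(V, W).
     if \<nu> = 1 then (V, W)
     else if \<nu> = 2 then (V, - W)
     else if \<nu> = 3 then (- V, - W)
     else (- V, W))"

definition almost_product ::
  "('m, real ^ 4) chart set \<Rightarrow> ('m \<Rightarrow> real ^ 4 \<Rightarrow> real ^ 4 \<Rightarrow> real) \<Rightarrow> nat
     \<Rightarrow> 'm bundle_point \<Rightarrow> bundle_vector \<Rightarrow> bundle_vector" where
  "almost_product A g \<nu> = (\<lambda>(p, a, b) \<xi>.
     hlift A g (p, a, b) (Kend (g p) a (Kend (g p) b (fst \<xi>)))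
     + (0, vert_K \<nu> (vpart A g (p, a, b) \<xi>)))"

definition D_perp ::
  "('m, real ^ 4) chart set \<Rightarrow> ('m \<Rightarrow> real ^ 4 \<Rightarrow> real ^ 4 \<Rightarrow> real) \<Rightarrow> nat
     \<Rightarrow> 'm bundle_point \<Rightarrow> bundle_vector set" where
  "D_perp A g \<nu> = minus_eigen (twistor_tangent A g) (almost_product A g \<nu>)"

end

theory Submission
  imports Defs
begin

text \<open>Let \<open>P\<close> be an orthogonal almost product structure and \<open>D\<close> its \<open>-1\<close>-eigendistribution. For
  \<open>v \<in> D\<close> the vector \<open>(\<nabla>\<^bsub>v\<^esub> P) v\<close> lies in \<open>D\<^sup>\<bottom>\<close>, so \<open>D\<^sub>1\<close> says that its product with every
  \<open>w \<in> D\<^sup>\<bottom>\<close> vanishes, and this product is \<open>(\<partial>\<^sub>w k)(v, v) - 2 (\<partial>\<^sub>v k)(v, w)\<close>, where \<open>k\<close> is the metric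
  restricted to \<open>D\<close> and extended by zero. On the twistor product, for \<open>\<nu> = 1\<close> the distribution is
  horizontal, and the product always vanishes because the connection is metric and torsion-free
  and the horizontal part of \<open>P\<close> is parallel along horizontal vectors; so \<open>D\<^sub>1\<close> holds. For
  \<open>\<nu> = 2, 3, 4\<close> the distribution contains a vertical vector \<open>v \<noteq> 0\<close>, for which the product
  vanishes because the fibres are totally geodesic; then \<open>D\<^sub>3\<close> at \<open>(v, v)\<close> gives \<open>\<alpha> = 0\<close>, and
  \<open>D\<^sub>3\<close> becomes \<open>D\<^sub>1\<close>.\<close>

section \<open>Derivatives\<close>

text \<open>The obstacle is that vectors at a point over \<open>p\<close> are written in
  \<open>chart_at A p\<close>, which is chosen separately for each \<open>p\<close> and need not
  vary continuously. Everything is therefore differentiated in the bundle chart of one fixed base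
  chart \<open>b0\<close>; \<open>frame_components\<close> translates, the transformation law of the
  Christoffel symbols absorbing the second derivatives of the coordinate change. In this chart the
  fibre coordinates \<alpha>, \<beta> are tautological unit sections of the pulled back bundles of
  (anti-)self-dual bivectors, and the vertical part of a tangent vector is the covariant derivative
  of \<alpha> and \<beta> along it. Metric and product structure thus become explicit expressions in
  pulled back data, and the Christoffel symbols of the twistor product are never written out.
  Vertical vectors work because a pulled back connection has no curvature in vertical directions.
  For the horizontal distribution the test vector may still have a vertical part, along which
  \<open>K_a K_b\<close> is not parallel; the resulting terms have the form
  \<open>g(K_V K_a X, X)\<close> with V orthogonal to the unit bivector a, and vanish because
  \<open>K_V\<close> and \<open>K_a\<close> anticommute.\<close>

lemma second_difference:
  fixes f :: "'a::real_normed_vector \<Rightarrow> real"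
  assumes S: "open S" "ball x (t * (norm u + norm v) + e) \<subseteq> S" and "t > 0" "e > 0"
    and f: "\<And>y. y \<in> S \<Longrightarrow> (f has_derivative f' y) (at y)"
    and f'': "\<And>y. y \<in> S \<Longrightarrow> ((\<lambda>z. f' z u) has_derivative f'' y) (at y)"
  shows "\<exists>a b. 0 < a \<and> a < t \<and> 0 < b \<and> b < t \<and>
    f (x + t *\<^sub>R u + t *\<^sub>R v) - f (x + t *\<^sub>R u) - f (x + t *\<^sub>R v) + f x
      = t\<^sup>2 * f'' (x + a *\<^sub>R u + b *\<^sub>R v) v"
proof -
  have in_S: "x + a *\<^sub>R u + b *\<^sub>R v \<in> S" if "0 \<le> a" "a \<le> t" "0 \<le> b" "b \<le> t" for a b
  proof -
    have "norm (a *\<^sub>R u + b *\<^sub>R v) \<le> a * norm u + b * norm v"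
      using norm_triangle_ineq[of "a *\<^sub>R u" "b *\<^sub>R v"] that by simp
    also have "\<dots> \<le> t * norm u + t * norm v"
      using that by (intro add_mono mult_right_mono) auto
    finally have "norm (a *\<^sub>R u + b *\<^sub>R v) < t * (norm u + norm v) + e"
      using \<open>e > 0\<close> by (simp add: algebra_simps)
    then show ?thesis
      using S(2) by (auto simp: dist_norm norm_minus_commute add.assoc subset_iff)
  qed
  have lin: "linear (f' y)" "linear (f'' y)" if "y \<in> S" for y
    using f[OF that] f''[OF that] has_derivative_linear by blast+
  \<comment> \<open>The first difference along \<open>v\<close>, as a function of the step along
    \<open>u\<close>. The mean value theorem is applied to it along \<open>u\<close> and then to the
    resulting derivative along \<open>v\<close>, which fixes the order of differentiation in
    \<open>f''\<close>.\<close>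
  define G where "G s = f (x + s *\<^sub>R u + t *\<^sub>R v) - f (x + s *\<^sub>R u)" for s
  have "\<exists>a>0. a < t \<and> G t - G 0 = (t - 0) * (f' (x + a *\<^sub>R u + t *\<^sub>R v) u - f' (x + a *\<^sub>R u) u)"
  proof (rule MVT2[OF \<open>t > 0\<close>])
    fix s assume s: "0 \<le> s" "s \<le> t"
    have 1: "x + s *\<^sub>R u + t *\<^sub>R v \<in> S" "x + s *\<^sub>R u \<in> S"
      using in_S[of s t] in_S[of s 0] s \<open>t > 0\<close> by auto
    have d: "((\<lambda>s. x + s *\<^sub>R u + t *\<^sub>R v) has_derivative (\<lambda>r. r *\<^sub>R u)) (at s)"
         "((\<lambda>s. x + s *\<^sub>R u) has_derivative (\<lambda>r. r *\<^sub>R u)) (at s)"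
      by (auto intro!: derivative_eq_intros)
    show "(G has_real_derivative f' (x + s *\<^sub>R u + t *\<^sub>R v) u - f' (x + s *\<^sub>R u) u) (at s)"
      unfolding G_def has_field_derivative_def
      by (rule has_derivative_eq_rhs,
          rule has_derivative_diff[OF has_derivative_compose[OF d(1) f[OF 1(1)]]
            has_derivative_compose[OF d(2) f[OF 1(2)]]])
        (auto simp: fun_eq_iff linear_cmul[OF lin(1)[OF 1(1)]] linear_cmul[OF lin(1)[OF 1(2)]]
          left_diff_distrib right_diff_distrib mult.commute)
  qed
  then obtain a where a: "0 < a" "a < t"
    "G t - G 0 = t * (f' (x + a *\<^sub>R u + t *\<^sub>R v) u - f' (x + a *\<^sub>R u) u)"
    by auto
  have "\<exists>b>0. b < t \<and> f' (x + a *\<^sub>R u + t *\<^sub>R v) u - f' (x + a *\<^sub>R u + 0 *\<^sub>R v) u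
      = (t - 0) * f'' (x + a *\<^sub>R u + b *\<^sub>R v) v"
  proof (rule MVT2[OF \<open>t > 0\<close>])
    fix s assume s: "0 \<le> s" "s \<le> t"
    have 1: "x + a *\<^sub>R u + s *\<^sub>R v \<in> S"
      using in_S[of a s] s a by auto
    have d: "((\<lambda>s. x + a *\<^sub>R u + s *\<^sub>R v) has_derivative (\<lambda>r. r *\<^sub>R v)) (at s)"
      by (auto intro!: derivative_eq_intros)
    show "((\<lambda>s. f' (x + a *\<^sub>R u + s *\<^sub>R v) u) has_real_derivative f'' (x + a *\<^sub>R u + s *\<^sub>R v) v) (at s)"
      unfolding has_field_derivative_def
      by (rule has_derivative_eq_rhs, rule has_derivative_compose[OF d f''[OF 1]])
        (auto simp: fun_eq_iff linear_cmul[OF lin(2)[OF 1]])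
  qed
  then obtain b where b: "0 < b" "b < t"
    "f' (x + a *\<^sub>R u + t *\<^sub>R v) u - f' (x + a *\<^sub>R u) u = t * f'' (x + a *\<^sub>R u + b *\<^sub>R v) v"
    by auto
  have "f (x + t *\<^sub>R u + t *\<^sub>R v) - f (x + t *\<^sub>R u) - f (x + t *\<^sub>R v) + f x = G t - G 0"
    by (simp add: G_def)
  also have "\<dots> = t\<^sup>2 * f'' (x + a *\<^sub>R u + b *\<^sub>R v) v"
    unfolding a(3) b(3) by (simp add: power2_eq_square)
  finally show ?thesis
    using a b by blast
qed

text \<open>The second difference is symmetric in \<open>u\<close> and \<open>v\<close>, so the two
  mixed derivatives take a common value at points arbitrarily close to \<open>x\<close>; continuity
  carries the equality to \<open>x\<close>. Were they different at \<open>x\<close>, staying within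
  half the gap would exclude a common value.\<close>

lemma mixed_derivatives_commute_real:
  fixes f :: "'a::real_normed_vector \<Rightarrow> real"
  assumes S: "open S" "x \<in> S"
    and f: "\<And>y. y \<in> S \<Longrightarrow> (f has_derivative f' y) (at y)"
    and f'': "\<And>w y. y \<in> S \<Longrightarrow> ((\<lambda>z. f' z w) has_derivative f'' w y) (at y)"
    and cont: "\<And>v w. continuous_on S (\<lambda>y. f'' v y w)"
  shows "f'' u x v = f'' v x u"
proof (rule ccontr)
  assume "f'' u x v \<noteq> f'' v x u"
  then have pos: "\<bar>f'' u x v - f'' v x u\<bar> / 2 > 0" (is "?e > 0")
    by simp
  have "\<exists>d>0. \<forall>y. dist y x < d \<longrightarrow> y \<in> S \<and> dist (f'' u y v) (f'' u x v) < ?e \<and> dist (f'' v y u) (f'' v x u) < ?e"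
  proof -
    have tn: "((\<lambda>y. f'' u y v) \<longlongrightarrow> f'' u x v) (nhds x)" "((\<lambda>y. f'' v y u) \<longlongrightarrow> f'' v x u) (nhds x)"
      using cont[of u v] cont[of v u] S
        tendsto_at_iff_tendsto_nhds[of "\<lambda>y. f'' u y v" x] tendsto_at_iff_tendsto_nhds[of "\<lambda>y. f'' v y u" x]
      by (simp_all add: continuous_on_eq_continuous_at isCont_def)
    have "eventually (\<lambda>y. dist (f'' u y v) (f'' u x v) < ?e) (nhds x)"
      "eventually (\<lambda>y. dist (f'' v y u) (f'' v x u) < ?e) (nhds x)"
      using tendstoD[OF tn(1) pos] tendstoD[OF tn(2) pos] .
    moreover have "eventually (\<lambda>y. y \<in> S) (nhds x)"
      using S by (rule eventually_nhds_in_open)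
    ultimately have "eventually (\<lambda>y. y \<in> S \<and> dist (f'' u y v) (f'' u x v) < ?e
        \<and> dist (f'' v y u) (f'' v x u) < ?e) (nhds x)"
      by eventually_elim auto
    then show ?thesis
      by (auto simp: eventually_nhds_metric)
  qed
  then obtain d where d: "d > 0" "\<And>y. dist y x < d \<Longrightarrow> y \<in> S"
    "\<And>y. dist y x < d \<Longrightarrow> dist (f'' u y v) (f'' u x v) < ?e"
    "\<And>y. dist y x < d \<Longrightarrow> dist (f'' v y u) (f'' v x u) < ?e"
    by blast
  \<comment> \<open>The summand 1 keeps the denominator positive when both directions are zero. The
    bound \<open>t * (norm u + norm v) < d / 2\<close> leaves \<open>d / 2\<close> as the slack that
    \<open>second_difference\<close> asks for.\<close>
  define t where "t = d / (2 * (norm u + norm v + 1))"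
  have n: "norm u + norm v + 1 > 0"
    using norm_ge_zero[of u] norm_ge_zero[of v] by linarith
  have t: "t > 0" "t * (norm u + norm v) < d / 2"
    using d(1) n by (auto simp: t_def field_simps)
  have sub: "ball x (t * (norm u + norm v) + d/2) \<subseteq> S" "ball x (t * (norm v + norm u) + d/2) \<subseteq> S"
    using t d by (auto simp: dist_commute add.commute)
  obtain a b where ab: "0 < a" "a < t" "0 < b" "b < t"
    "f (x + t *\<^sub>R u + t *\<^sub>R v) - f (x + t *\<^sub>R u) - f (x + t *\<^sub>R v) + f x
      = t\<^sup>2 * f'' u (x + a *\<^sub>R u + b *\<^sub>R v) v"
    using second_difference[of S x t u v "d/2" f f' "f'' u"] S sub t d f f'' by auto
  obtain a' b' where ab': "0 < a'" "a' < t" "0 < b'" "b' < t"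
    "f (x + t *\<^sub>R v + t *\<^sub>R u) - f (x + t *\<^sub>R v) - f (x + t *\<^sub>R u) + f x
      = t\<^sup>2 * f'' v (x + a' *\<^sub>R v + b' *\<^sub>R u) u"
    using second_difference[of S x t v u "d/2" f f' "f'' v"] S sub t d f f'' by auto
  have eq: "f'' u (x + a *\<^sub>R u + b *\<^sub>R v) v = f'' v (x + a' *\<^sub>R v + b' *\<^sub>R u) u"
    using ab(5) ab'(5) t by (auto simp: algebra_simps)
  have near: "dist (x + r *\<^sub>R y + s *\<^sub>R z) x < d"
    if "0 < r" "r < t" "0 < s" "s < t" "norm y + norm z = norm u + norm v" for r s y z
  proof -
    have "dist (x + r *\<^sub>R y + s *\<^sub>R z) x \<le> r * norm y + s * norm z"
      using norm_triangle_ineq[of "r *\<^sub>R y" "s *\<^sub>R z"] that by (simp add: dist_norm add.assoc)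
    also have "\<dots> \<le> t * norm y + t * norm z"
      using that by (intro add_mono mult_right_mono) auto
    also have "\<dots> < d"
      using t that d(1) by (simp flip: distrib_left)
    finally show ?thesis .
  qed
  show False
    using d(3)[OF near[of a b u v]] d(4)[OF near[of a' b' v u]] ab(1-4) ab'(1-4) eq
      dist_triangle3[of "f'' u x v" "f'' v x u" "f'' u (x + a *\<^sub>R u + b *\<^sub>R v) v"]
    by (simp add: dist_real_def[of "f'' u x v"])
qed

lemma Ck_on_SucD:
  "Ck_on (Suc k) S f \<Longrightarrow> x \<in> S \<Longrightarrow> (f has_derivative frechet_derivative f (at x)) (at x)"
  "Ck_on (Suc k) S f \<Longrightarrow> Ck_on k S (\<lambda>x. frechet_derivative f (at x) v)"
  by (auto simp: frechet_derivative_works)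

lemma mixed_derivatives_commute:
  fixes f :: "'a::euclidean_space \<Rightarrow> 'b::euclidean_space"
  assumes S: "open S" "x \<in> S" and f: "Ck_on 2 S f"
  shows "frechet_derivative (\<lambda>y. frechet_derivative f (at y) u) (at x) v
       = frechet_derivative (\<lambda>y. frechet_derivative f (at y) v) (at x) u"
proof (rule euclidean_eqI)
  fix b :: 'b assume "b \<in> Basis"
  have f2: "Ck_on (Suc (Suc 0)) S f"
    using f by (simp only: numeral_2_eq_2)
  note D1 = Ck_on_SucD(1)[OF f2] and D2 = Ck_on_SucD(1)[OF Ck_on_SucD(2)[OF f2]]
  have c: "continuous_on S (\<lambda>y. frechet_derivative (\<lambda>y. frechet_derivative f (at y) v) (at y) w)" for v w
    using Ck_on_SucD(2)[OF Ck_on_SucD(2)[OF f2]] by simp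
  show "frechet_derivative (\<lambda>y. frechet_derivative f (at y) u) (at x) v \<bullet> b
       = frechet_derivative (\<lambda>y. frechet_derivative f (at y) v) (at x) u \<bullet> b"
    by (rule mixed_derivatives_commute_real[OF S, of "\<lambda>y. f y \<bullet> b" "\<lambda>y w. frechet_derivative f (at y) w \<bullet> b"
      "\<lambda>u x v. frechet_derivative (\<lambda>y. frechet_derivative f (at y) u) (at x) v \<bullet> b"])
      (auto intro!: has_derivative_inner_left D1 D2 continuous_intros c)
qed

section \<open>Differentiability of solutions of linear systems\<close>

lemma differentiable_prod:
  fixes f :: "'i \<Rightarrow> 'a::real_normed_vector \<Rightarrow> real"
  assumes "\<And>i. i \<in> I \<Longrightarrow> f i differentiable (at x)"
  shows "(\<lambda>y. \<Prod>i\<in>I. f i y) differentiable (at x)"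
  using has_derivative_prod[of I f _ x UNIV] assms unfolding differentiable_def by metis

lemma differentiable_det:
  fixes M :: "'a::real_normed_vector \<Rightarrow> real ^ 'n ^ 'n"
  assumes "\<And>i j. (\<lambda>y. M y $ i $ j) differentiable (at x)"
  shows "(\<lambda>y. det (M y)) differentiable (at x)"
  unfolding det_def
  by (intro differentiable_sum differentiable_mult differentiable_const differentiable_prod assms ballI)
    (auto simp: finite_permutations)

lemma differentiable_transform_open:
  assumes "f differentiable (at x)" "open S" "x \<in> S" "\<And>y. y \<in> S \<Longrightarrow> f y = g y"
  shows "g differentiable (at x)"
  using assms unfolding differentiable_def by (metis has_derivative_transform_within_open)

text \<open>Both functions have the same set of derivatives at \<open>x\<close>, and
  \<open>frechet_derivative\<close> is a choice from that set.\<close>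

lemma frechet_derivative_cong_open:
  assumes "open S" "x \<in> S" "\<And>y. y \<in> S \<Longrightarrow> f y = g y"
  shows "frechet_derivative f (at x) = frechet_derivative g (at x)"
proof -
  have "(f has_derivative D) (at x) \<longleftrightarrow> (g has_derivative D) (at x)" for D
    using assms has_derivative_transform_within_open[of f D x UNIV S g]
      has_derivative_transform_within_open[of g D x UNIV S f] by auto
  then show ?thesis
    by (simp add: frechet_derivative_def)
qed

text \<open>Cramer's rule, because it exhibits the solution of a linear system as a differentiable
  function of the coefficients.\<close>

lemma differentiable_represented:
  fixes B :: "'a::real_normed_vector \<Rightarrow> real ^ 'n \<Rightarrow> real ^ 'n \<Rightarrow> real"
  assumes S: "open S" "x \<in> S" and B: "\<And>y. y \<in> S \<Longrightarrow> is_inner_product (B y)"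
    and dB: "\<And>v w. (\<lambda>y. B y v w) differentiable (at x)"
    and k: "\<And>y w. y \<in> S \<Longrightarrow> B y (f y) w = k w y" and dk: "\<And>w. k w differentiable (at x)"
  shows "f differentiable (at x)"
proof -
  define M where "M y = (\<chi> i j. B y (axis j 1) (axis i 1))" for y
  define K where "K y = (\<chi> i. k (axis i 1) y)" for y
  have bil: "bilinear (B y)" if "y \<in> S" for y
    using B[OF that] by (simp add: is_inner_product_def)
  have expand: "(M y *v v) $ i = B y v (axis i 1)" if "y \<in> S" for y v i
  proof -
    have "B y v (axis i 1) = B y (\<Sum>j\<in>UNIV. v $ j *\<^sub>R axis j 1) (axis i 1)"
      using basis_expansion[of v] by (simp add: scalar_mult_eq_scaleR)
    also have "\<dots> = (\<Sum>j\<in>UNIV. v $ j * B y (axis j 1) (axis i 1))"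
      using linear_sum[of "\<lambda>a. B y a (axis i 1)" "\<lambda>j. v $ j *\<^sub>R axis j 1" UNIV] bil[OF that]
      by (simp add: bilinear_def bilinear_lmul[OF bil[OF that]])
    finally show ?thesis
      by (simp add: M_def matrix_vector_mult_def mult.commute)
  qed
  \<comment> \<open>A kernel vector of \<open>M y\<close> would be orthogonal to every vector,
    itself included.\<close>
  have det: "det (M y) \<noteq> 0" if "y \<in> S" for y
  proof -
    have "v = 0" if "M y *v v = 0" for v
    proof (rule ccontr)
      assume "v \<noteq> 0"
      then have "B y v v > 0"
        using B[OF \<open>y \<in> S\<close>] by (simp add: is_inner_product_def)
      moreover have "B y v = (\<lambda>_. 0)"
      proof (rule linear_eq_stdbasis)
        show "linear (B y v)"
          using bil[OF \<open>y \<in> S\<close>] by (simp add: bilinear_def)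
        show "B y v b = 0" if "b \<in> Basis" for b
          using expand[OF \<open>y \<in> S\<close>, of v] \<open>M y *v v = 0\<close> that by (auto simp: Basis_vec_def)
      qed (simp add: linear_zero)
      ultimately show False
        by simp
    qed
    then show ?thesis
      by (simp add: invertible_left_inverse matrix_left_invertible_ker flip: invertible_det_nz)
  qed
  have sol: "M y *v f y = K y" if "y \<in> S" for y
    using expand[OF that] k[OF that] by (simp add: vec_eq_iff K_def)
  have "f y $ i = det (\<chi> a b. if b = i then K y $ a else M y $ a $ b) / det (M y)" if "y \<in> S" for y i
    using cramer[OF det[OF that], of "f y" "K y"] sol[OF that] by (simp add: vec_eq_iff)
  moreover have "(\<lambda>y. det (\<chi> a b. if b = i then K y $ a else M y $ a $ b) / det (M y)) differentiable (at x)" for i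
  proof (intro differentiable_divide differentiable_det det S)
    show "(\<lambda>y. (\<chi> a b. if b = i then K y $ a else M y $ a $ b) $ r $ s) differentiable (at x)" for r s
      by (cases "s = i") (use dB dk in \<open>simp_all add: K_def M_def\<close>)
  qed (simp add: M_def dB)
  ultimately have "(\<lambda>y. f y $ i) differentiable (at x)" for i
    using S by (metis (no_types, lifting) differentiable_transform_open)
  then show ?thesis
    by (subst differentiable_componentwise_within) (auto simp: Basis_vec_def inner_axis)
qed

section \<open>Bivectors and the Hodge operator\<close>

lemma det_4:
  "det (A::'a::comm_ring_1^4^4) =
    A$1$1 * (A$2$2 * (A$3$3 * A$4$4 - A$3$4 * A$4$3) - A$2$3 * (A$3$2 * A$4$4 - A$3$4 * A$4$2)
      + A$2$4 * (A$3$2 * A$4$3 - A$3$3 * A$4$2))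
  - A$1$2 * (A$2$1 * (A$3$3 * A$4$4 - A$3$4 * A$4$3) - A$2$3 * (A$3$1 * A$4$4 - A$3$4 * A$4$1)
      + A$2$4 * (A$3$1 * A$4$3 - A$3$3 * A$4$1))
  + A$1$3 * (A$2$1 * (A$3$2 * A$4$4 - A$3$4 * A$4$2) - A$2$2 * (A$3$1 * A$4$4 - A$3$4 * A$4$1)
      + A$2$4 * (A$3$1 * A$4$2 - A$3$2 * A$4$1))
  - A$1$4 * (A$2$1 * (A$3$2 * A$4$3 - A$3$3 * A$4$2) - A$2$2 * (A$3$1 * A$4$3 - A$3$3 * A$4$1)
      + A$2$3 * (A$3$1 * A$4$2 - A$3$2 * A$4$1))"
proof -
  have f: "finite {2::4, 3, 4}" "1 \<notin> {2::4, 3, 4}" "finite {3::4, 4}" "2 \<notin> {3::4, 4}"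
    "finite {4::4}" "3 \<notin> {4::4}"
    by auto
  show ?thesis
    unfolding det_def UNIV_4
    unfolding sum_over_permutations_insert[OF f(1,2)]
    unfolding sum_over_permutations_insert[OF f(3,4)]
    unfolding sum_over_permutations_insert[OF f(5,6)]
    unfolding permutes_sing
    by (simp add: sign_swap_id permutation_swap_id sign_compose sign_id swap_id_eq permutation_compose algebra_simps)
qed

text \<open>Half the contraction with the Levi-Civita symbol.\<close>

definition bdual :: "real ^ 4 ^ 4 \<Rightarrow> real ^ 4 ^ 4" where
  "bdual N = vector [vector [0, N$3$4, - N$2$4, N$2$3], vector [- N$3$4, 0, N$1$4, - N$1$3],
     vector [N$2$4, - N$1$4, 0, N$1$2], vector [- N$2$3, N$1$3, - N$1$2, 0]]"

lemma vector_4: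
  "(vector [x, y, z, w] :: 'a::zero ^ 4) $ 1 = x"
  "(vector [x, y, z, w] :: 'a::zero ^ 4) $ 2 = y"
  "(vector [x, y, z, w] :: 'a::zero ^ 4) $ 3 = z"
  "(vector [x, y, z, w] :: 'a::zero ^ 4) $ 4 = w"
  unfolding vector_def by simp_all

lemma linear_bdual: "linear bdual"
  by (rule linearI) (simp_all add: vec_eq_iff forall_4 bdual_def vector_4)

text \<open>Expresses \<open>bdual\<close> through the volume form, so that its behaviour under a
  change of basis can be read off from the multiplicativity of the determinant.\<close>

lemma bdual_wedge:
  "x \<bullet> (bdual (wedge u v) *v y) = det (vector [x, y, u, v] :: real ^ 4 ^ 4)"
  by (simp add: inner_vec_def matrix_vector_mult_def sum_4 det_4 bdual_def wedge_def vector_4 algebra_simps)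

lemma transpose_simps:
  "transpose (A + B) = transpose A + transpose B"
  "transpose (A - B) = transpose A - transpose B"
  "transpose (- A) = - transpose A"
  "transpose (c *\<^sub>R A) = c *\<^sub>R transpose A"
  for A B :: "real ^ 'n ^ 'm"
  by (simp_all add: transpose_def vec_eq_iff)

lemma skew_component:
  assumes "transpose N = - N"
  shows "N $ i $ j = - (N $ j $ i :: real)"
  using arg_cong[OF assms, of "\<lambda>M. M $ j $ i"] by (simp add: transpose_def)

text \<open>The Pfaffian: for skew matrices its square is the determinant.\<close>

definition pfaff :: "real ^ 4 ^ 4 \<Rightarrow> real" where
  "pfaff N = N$1$2 * N$3$4 - N$1$3 * N$2$4 + N$1$4 * N$2$3"

lemma skew_diag: "transpose N = - N \<Longrightarrow> N $ i $ i = (0::real)"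
  using skew_component[of N i i] by simp

lemma mult_bdual:
  assumes "transpose N = - N"
  shows "N ** bdual N = - pfaff N *\<^sub>R mat 1" "bdual N ** N = - pfaff N *\<^sub>R mat 1"
  using skew_component[OF assms, of 2 1] skew_component[OF assms, of 3 1] skew_component[OF assms, of 4 1]
    skew_component[OF assms, of 3 2] skew_component[OF assms, of 4 2] skew_component[OF assms, of 4 3]
  by (simp_all add: vec_eq_iff forall_4 bdual_def vector_4 matrix_matrix_mult_def sum_4 mat_def pfaff_def
    skew_diag[OF assms])


lemma bounded_bilinear_matrix_mult: "bounded_bilinear ((**) :: real ^ 'n ^ 'm \<Rightarrow> real ^ 'k ^ 'n \<Rightarrow> _)"
  unfolding bilinear_conv_bounded_bilinear[symmetric] bilinear_def
  by (auto intro!: linearI simp: matrix_add_ldistrib matrix_matrix_mult_def vec_eq_iff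
      sum.distrib sum_distrib_left algebra_simps)

lemmas matrix_mult_simps =
  bounded_bilinear.add_left[OF bounded_bilinear_matrix_mult]
  bounded_bilinear.add_right[OF bounded_bilinear_matrix_mult]
  bounded_bilinear.diff_left[OF bounded_bilinear_matrix_mult]
  bounded_bilinear.diff_right[OF bounded_bilinear_matrix_mult]
  bounded_bilinear.minus_left[OF bounded_bilinear_matrix_mult]
  bounded_bilinear.minus_right[OF bounded_bilinear_matrix_mult]
  bounded_bilinear.scaleR_left[OF bounded_bilinear_matrix_mult]
  bounded_bilinear.scaleR_right[OF bounded_bilinear_matrix_mult]
  bounded_bilinear.zero_left[OF bounded_bilinear_matrix_mult]
  bounded_bilinear.zero_right[OF bounded_bilinear_matrix_mult]

text \<open>Polarisation of the quadratic identity \<open>mult_bdual\<close>. In the application the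
  constant is found by taking traces.\<close>

lemma mult_bdual_polarized:
  assumes "transpose M = - M" "transpose N = - N"
  shows "\<exists>c. M ** bdual N + N ** bdual M = c *\<^sub>R mat 1"
proof -
  have "transpose (M + N) = - (M + N)"
    using assms by (simp add: transpose_simps)
  from mult_bdual(1)[OF this]
  have 1: "(M + N) ** (bdual M + bdual N) = - pfaff (M + N) *\<^sub>R mat 1"
    by (simp add: linear_add[OF linear_bdual])
  have "M ** bdual N + N ** bdual M = (M + N) ** (bdual M + bdual N) - M ** bdual M - N ** bdual N"
    by (simp add: matrix_mult_simps)
  also have "\<dots> = (- pfaff (M + N) + pfaff M + pfaff N) *\<^sub>R mat 1"
    unfolding 1 mult_bdual(1)[OF assms(1)] mult_bdual(1)[OF assms(2)]
    by (simp only: scaleR_add_left scaleR_minus_left diff_minus_eq_add)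
  finally have "M ** bdual N + N ** bdual M = (- pfaff (M + N) + pfaff M + pfaff N) *\<^sub>R mat 1" .
  then show ?thesis
    by blast
qed

text \<open>The infinitesimal form of \<open>bdual_congruence\<close>: its derivative at the
  identity in the direction \<open>M\<close>, with the trace as the derivative of the
  determinant.\<close>

lemma bdual_derivation:
  assumes "transpose N = - N"
  shows "bdual (transpose M ** N + N ** M) = trace M *\<^sub>R bdual N - M ** bdual N - bdual N ** transpose M"
  using skew_component[OF assms, of 2 1] skew_component[OF assms, of 3 1] skew_component[OF assms, of 4 1]
    skew_component[OF assms, of 3 2] skew_component[OF assms, of 4 2] skew_component[OF assms, of 4 3]
  by (simp add: vec_eq_iff forall_4 bdual_def vector_4 matrix_matrix_mult_def sum_4 transpose_def
    trace_def skew_diag[OF assms] algebra_simps)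

lemma matrix_eqI_inner:
  fixes M N :: "real ^ 'n ^ 'n"
  assumes "\<And>x y. x \<bullet> (M *v y) = x \<bullet> (N *v y)"
  shows "M = N"
  using assms by (metis matrix_eq vector_eq_ldot)

lemma inner_matrix_mult_left: "x \<bullet> ((M ** N) *v y) = (transpose M *v x) \<bullet> (N *v y)"
  for M N :: "real ^ 'n ^ 'n"
  by (metis dot_lmul_matrix matrix_vector_mul_assoc transpose_matrix_vector)

lemma inner_transpose_mult: "(transpose M *v x) \<bullet> y = x \<bullet> (M *v y)"
  for M :: "real ^ 'n ^ 'n"
  by (metis dot_lmul_matrix transpose_matrix_vector)

lemma wedge_congruence: "transpose A ** wedge u v ** A = wedge (transpose A *v u) (transpose A *v v)"
  by (simp add: vec_eq_iff wedge_def matrix_matrix_mult_def matrix_vector_mult_def transpose_def sum_4 algebra_simps)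

lemma skew_eq_sum_wedge:
  assumes "transpose N = - N"
  shows "N = (\<Sum>k\<in>UNIV. \<Sum>l\<in>UNIV. (N $ k $ l / 2) *\<^sub>R wedge (axis k 1) (axis l 1))"
  using skew_component[OF assms, of 2 1] skew_component[OF assms, of 3 1] skew_component[OF assms, of 4 1]
    skew_component[OF assms, of 3 2] skew_component[OF assms, of 4 2] skew_component[OF assms, of 4 3]
  by (simp add: vec_eq_iff forall_4 sum_4 wedge_def axis_def skew_diag[OF assms])

text \<open>By \<open>bdual_wedge\<close> both sides, paired with \<open>x\<close> and
  \<open>y\<close>, are determinants of matrices of four rows that differ by the factor
  \<open>A\<close>.\<close>

lemma bdual_congruence_wedge:
  "A ** bdual (transpose A ** wedge u v ** A) ** transpose A = det A *\<^sub>R bdual (wedge u v)"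
proof (rule matrix_eqI_inner)
  fix x y
  have rows: "vector [transpose A *v x, transpose A *v y, transpose A *v u, transpose A *v v]
      = (vector [x, y, u, v] :: real ^ 4 ^ 4) ** A"
  proof -
    have "vector [transpose A *v x, transpose A *v y, transpose A *v u, transpose A *v v] $ r $ i
      = (vector [x, y, u, v] ** A) $ r $ i" for r :: 4 and i
      using exhaust_4[of r] by (auto simp: vector_4 matrix_matrix_mult_def matrix_vector_mult_def
        transpose_def mult.commute)
    then show ?thesis
      by (simp add: vec_eq_iff)
  qed
  have "x \<bullet> ((A ** bdual (transpose A ** wedge u v ** A) ** transpose A) *v y)
      = (transpose A *v x) \<bullet> (bdual (transpose A ** wedge u v ** A) *v (transpose A *v y))"
    by (simp add: dot_lmul_matrix flip: matrix_mul_assoc matrix_vector_mul_assoc)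
  also have "\<dots> = det A * (x \<bullet> (bdual (wedge u v) *v y))"
    by (simp add: wedge_congruence bdual_wedge rows det_mul del: transpose_matrix_vector)
  finally show "x \<bullet> ((A ** bdual (transpose A ** wedge u v ** A) ** transpose A) *v y)
      = x \<bullet> ((det A *\<^sub>R bdual (wedge u v)) *v y)"
    by (simp add: scaleR_matrix_vector_assoc[symmetric])
qed

lemma bounded_bilinear_matrix_vector: "bounded_bilinear ((*v) :: real ^ 'n ^ 'm \<Rightarrow> real ^ 'n \<Rightarrow> _)"
  unfolding bilinear_conv_bounded_bilinear[symmetric] bilinear_def
  by (auto intro!: linearI simp: matrix_vector_mult_def vec_eq_iff
      sum.distrib sum_distrib_left algebra_simps)

lemma bounded_linear_transpose: "bounded_linear (transpose :: real ^ 'n ^ 'm \<Rightarrow> _)"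
  by (auto intro!: linear_conv_bounded_linear[THEN iffD1] linearI simp: transpose_def vec_eq_iff)

lemma bdual_congruence:
  assumes N: "transpose N = - N"
  shows "A ** bdual (transpose A ** N ** A) ** transpose A = det A *\<^sub>R bdual N"
proof -
  let ?L = "\<lambda>N. A ** bdual (transpose A ** N ** A) ** transpose A"
  have lin: "linear ?L"
    by (rule linearI) (simp_all add: matrix_mult_simps linear_add[OF linear_bdual] linear_cmul[OF linear_bdual])
  have lin': "linear (\<lambda>N. det A *\<^sub>R bdual N)"
    by (intro linear_compose_scale_right linear_bdual)
  show ?thesis
    by (subst (1 2) skew_eq_sum_wedge[OF N])
      (simp only: linear_sum[OF lin] linear_sum[OF lin'] linear_cmul[OF lin] linear_cmul[OF lin']
        bdual_congruence_wedge)
qed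

section \<open>Inner products and orthonormal frames\<close>

lemma inner_product_pos: "is_inner_product B \<Longrightarrow> v \<noteq> 0 \<Longrightarrow> B v v > 0"
  and inner_product_sym: "is_inner_product B \<Longrightarrow> B v w = B w v"
  and inner_product_bilinear: "is_inner_product B \<Longrightarrow> bilinear B"
  by (auto simp: is_inner_product_def)

lemma orthonormal_independent:
  fixes E :: "'v::euclidean_space set" and B :: "'v \<Rightarrow> 'v \<Rightarrow> real"
  assumes B: "bilinear B" and E: "\<And>e f. e \<in> E \<Longrightarrow> f \<in> E \<Longrightarrow> B e f = (if e = f then 1 else 0)"
  shows "independent E"
  unfolding dependent_def
proof clarify
  fix e assume e: "e \<in> E" "e \<in> span (E - {e})"
  have "subspace {x. B e x = 0}"
    by (auto simp: subspace_def bilinear_radd[OF B] bilinear_rmul[OF B] bilinear_rzero[OF B])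
  then have "span (E - {e}) \<subseteq> {x. B e x = 0}"
    using E e(1) by (intro span_minimal) auto
  then have "B e e = 0"
    using e by blast
  then show False
    using e E[of e e] by simp
qed

text \<open>An orthonormal system of largest cardinality spans: otherwise a Gram-Schmidt step
  enlarges it.\<close>

lemma onb_exists:
  fixes V :: "'v::euclidean_space set" and B :: "'v \<Rightarrow> 'v \<Rightarrow> real"
  assumes B: "bilinear B" and sym: "\<And>v w. v \<in> V \<Longrightarrow> w \<in> V \<Longrightarrow> B v w = B w v"
    and pos: "\<And>v. v \<in> V \<Longrightarrow> v \<noteq> 0 \<Longrightarrow> B v v > 0" and V: "subspace V"
  shows "\<exists>E. is_onb B V E"
proof -
  define P where "P E \<longleftrightarrow> finite E \<and> E \<subseteq> V \<and> (\<forall>e\<in>E. \<forall>f\<in>E. B e f = (if e = f then 1 else 0))" for E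
  note bil = bilinear_ladd[OF B] bilinear_radd[OF B] bilinear_lmul[OF B] bilinear_rmul[OF B]
    bilinear_lsub[OF B] bilinear_rsub[OF B] bilinear_lzero[OF B] bilinear_rzero[OF B]
  have indep: "independent E" if "P E" for E
    by (rule orthonormal_independent[OF B]) (use that in \<open>auto simp: P_def\<close>)
  \<comment> \<open>Orthonormal systems are independent, so their cardinalities are bounded by
    \<open>dim V\<close> and a largest one exists.\<close>
  have "\<exists>E. P E \<and> (\<forall>E'. P E' \<longrightarrow> card E' \<le> card E)"
  proof (rule ex_has_greatest_nat[of P "{}" card "Suc (dim V)"])
    show "\<forall>E. P E \<longrightarrow> card E < Suc (dim V)"
    proof clarify
      fix E assume E: "P E"
      then have "E \<subseteq> V"
        by (simp add: P_def)
      from independent_card_le_dim[OF this indep[OF E]] show "card E < Suc (dim V)"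
        by simp
    qed
  qed (simp add: P_def)
  then obtain E where E: "P E" and max: "\<And>E'. P E' \<Longrightarrow> card E' \<le> card E"
    by blast
  have "span E = V"
  proof (rule ccontr)
    assume "span E \<noteq> V"
    moreover have "span E \<subseteq> V"
      using E V span_minimal[of E V] by (simp add: P_def)
    ultimately obtain v where v: "v \<in> V" "v \<notin> span E"
      by blast
    define s where "s = (\<Sum>e\<in>E. B v e *\<^sub>R e)"
    have s: "s \<in> span E"
      unfolding s_def by (intro span_sum span_scale span_base)
    define u where "u = v - s"
    have u: "u \<in> V" "u \<noteq> 0"
      using v s \<open>span E \<subseteq> V\<close> V by (auto simp: u_def intro: subspace_diff)
    have orth: "B u f = 0" if "f \<in> E" for f
    proof -
      have "B s f = (\<Sum>e\<in>E. B v e * B e f)"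
        unfolding s_def using linear_sum[of "\<lambda>x. B x f" "\<lambda>e. B v e *\<^sub>R e" E] B
        by (simp add: bilinear_def bil)
      also have "\<dots> = (\<Sum>e\<in>E. if e = f then B v e else 0)"
        using E that by (intro sum.cong) (auto simp: P_def)
      also have "\<dots> = B v f"
        using E that by (simp add: P_def)
      finally show ?thesis
        by (simp add: u_def bil)
    qed
    define w where "w = (1 / sqrt (B u u)) *\<^sub>R u"
    have p: "B u u > 0"
      using pos u by blast
    have w: "w \<in> V" "B w w = 1" "\<And>f. f \<in> E \<Longrightarrow> B w f = 0"
      using u V orth p by (auto simp: w_def bilinear_lmul[OF B] bilinear_rmul[OF B] subspace_scale)
    then have "w \<notin> E"
      by force
    have "P (insert w E)"
      using E w sym \<open>w \<notin> E\<close> unfolding P_def by (auto 4 4 simp: subset_iff)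
    then have "card (insert w E) \<le> card E"
      by (rule max)
    then show False
      using \<open>w \<notin> E\<close> E by (simp add: P_def)
  qed
  then show ?thesis
    using E unfolding is_onb_def P_def by blast
qed

definition gram :: "(real ^ 'n \<Rightarrow> real ^ 'n \<Rightarrow> real) \<Rightarrow> real ^ 'n ^ 'n" where
  "gram B = (\<chi> i j. B (axis i 1) (axis j 1))"

lemma matrix_entry: "axis i 1 \<bullet> (M *v axis j 1) = M $ i $ j" for M :: "real ^ 'n ^ 'n"
  by (simp add: inner_axis' matrix_vector_mult_basis column_def)

lemma bilinear_gram:
  assumes "bilinear B"
  shows "B u v = u \<bullet> (gram B *v v)"
proof -
  have B: "B v w = (\<Sum>i\<in>UNIV. \<Sum>k\<in>UNIV. v $ i * w $ k * B (axis i 1) (axis k 1))" for v w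
  proof -
    have "B v w = B (\<Sum>i\<in>UNIV. v $ i *\<^sub>R axis i 1) (\<Sum>k\<in>UNIV. w $ k *\<^sub>R axis k 1)"
      using basis_expansion[of v] basis_expansion[of w] by (simp add: scalar_mult_eq_scaleR)
    also have "\<dots> = (\<Sum>i\<in>UNIV. \<Sum>k\<in>UNIV. B (v $ i *\<^sub>R axis i 1) (w $ k *\<^sub>R axis k 1))"
      using bilinear_sum[OF assms, of "\<lambda>i. v $ i *\<^sub>R axis i 1" UNIV
          "\<lambda>k. w $ k *\<^sub>R axis k 1" UNIV]
      by (simp only: sum.cartesian_product)
    finally show ?thesis
      by (simp add: bilinear_lmul[OF assms] bilinear_rmul[OF assms] mult_ac)
  qed
  show ?thesis
    unfolding B[of u v]
    by (simp add: inner_vec_def matrix_vector_mult_def gram_def sum_distrib_left mult_ac)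
qed

lemma gram_sym: "is_inner_product B \<Longrightarrow> transpose (gram B) = gram B"
  by (simp add: gram_def transpose_def vec_eq_iff inner_product_sym)

lemma orthonormal_frame_matrix:
  fixes e :: "4 \<Rightarrow> real ^ 4"
  assumes "bilinear B" "\<And>i j. B (e i) (e j) = (if i = j then 1 else 0)"
  shows "(\<chi> i. e i) ** gram B ** transpose (\<chi> i. e i) = mat 1"
proof -
  have e: "transpose (\<chi> i. e i) *v axis i 1 = e i" for i
    by (simp add: matrix_vector_mult_basis column_def transpose_def)
  have "((\<chi> i. e i) ** gram B ** transpose (\<chi> i. e i)) $ i $ j = B (e i) (e j)" for i j
  proof -
    have "((\<chi> i. e i) ** gram B ** transpose (\<chi> i. e i)) $ i $ j
        = axis i 1 \<bullet> ((\<chi> i. e i) *v (gram B *v (transpose (\<chi> i. e i) *v axis j 1)))"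
      by (simp only: matrix_entry matrix_vector_mul_assoc matrix_mul_assoc)
    also have "\<dots> = (transpose (\<chi> i. e i) *v axis i 1) \<bullet> (gram B *v (transpose (\<chi> i. e i) *v axis j 1))"
      by (simp only: inner_transpose_mult)
    finally show ?thesis
      by (simp only: e bilinear_gram[OF assms(1)])
  qed
  then show ?thesis
    by (simp add: vec_eq_iff assms(2) mat_def)
qed

lemma orthonormal_frame_det:
  fixes e :: "4 \<Rightarrow> real ^ 4"
  assumes "bilinear B" "\<And>i j. B (e i) (e j) = (if i = j then 1 else 0)"
  shows "(det (\<chi> i. e i))\<^sup>2 * det (gram B) = 1"
  using arg_cong[OF orthonormal_frame_matrix[OF assms], of det]
  by (simp add: det_mul det_transpose power2_eq_square mult_ac)

text \<open>Negating the third vector changes the orientation and keeps the first two, which alone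
  enter the argument in the condition that defines \<open>hodge\<close>.\<close>

lemma orthonormal_frame_reorient:
  fixes e :: "4 \<Rightarrow> real ^ 4"
  assumes B: "bilinear B" and e: "\<And>i j. B (e i) (e j) = (if i = j then 1 else 0)"
  shows "\<exists>f. oriented_onb B f \<and> f 1 = e 1 \<and> f 2 = e 2"
proof (cases "det (\<chi> i. e i) > 0")
  case True
  then show ?thesis
    using e by (intro exI[of _ e]) (auto simp: oriented_onb_def)
next
  case False
  have "det (\<chi> i. e i) \<noteq> 0"
    using orthonormal_frame_det[OF B e] by auto
  define f where "f = e(3 := - e 3)"
  have "det (\<chi> i. f i) = det (\<chi> i. if i = 3 then (- 1) *s e 3 else e i)"
    by (rule arg_cong[of _ _ det]) (simp add: vec_eq_iff f_def)
  also have "\<dots> = - det (\<chi> i. if i = 3 then e 3 else e i)"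
    by (subst det_row_mul) simp
  also have "(\<chi> i. if i = 3 then e 3 else e i) = (\<chi> i. e i)"
    by (simp add: vec_eq_iff)
  finally have "det (\<chi> i. f i) > 0"
    using False \<open>det (\<chi> i. e i) \<noteq> 0\<close> by simp
  moreover have "B (f i) (f j) = (if i = j then 1 else 0)" for i j
    using e by (auto simp: f_def bilinear_lneg[OF B] bilinear_rneg[OF B])
  ultimately show ?thesis
    by (intro exI[of _ f]) (auto simp: oriented_onb_def f_def)
qed

lemma orthonormal_frame_exists:
  assumes "is_inner_product B"
  shows "\<exists>e :: 4 \<Rightarrow> real ^ 4. \<forall>i j. B (e i) (e j) = (if i = j then 1 else 0)"
proof -
  obtain E where E: "is_onb B (UNIV :: (real ^ 4) set) E"
    using onb_exists[of B UNIV] assms by (auto simp: is_inner_product_def)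
  have "card E = 4"
  proof -
    have "independent E"
      by (rule orthonormal_independent[OF inner_product_bilinear[OF assms]])
        (use E in \<open>auto simp: is_onb_def\<close>)
    then show ?thesis
      using basis_card_eq_dim[of E UNIV] E by (simp add: is_onb_def)
  qed
  then obtain f :: "4 \<Rightarrow> real ^ 4" where "bij_betw f UNIV E"
    using E finite_same_card_bij[of "UNIV :: 4 set" E] by (auto simp: is_onb_def)
  then show ?thesis
    using E by (intro exI[of _ f]) (auto simp: is_onb_def bij_betw_def inj_on_def)
qed

lemma det_gram_pos:
  fixes B :: "real ^ 4 \<Rightarrow> real ^ 4 \<Rightarrow> real"
  assumes "is_inner_product B"
  shows "det (gram B) > 0"
proof -
  obtain e :: "4 \<Rightarrow> real ^ 4" where "\<forall>i j. B (e i) (e j) = (if i = j then 1 else 0)"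
    using orthonormal_frame_exists[OF assms] by blast
  then have "(det (\<chi> i. e i))\<^sup>2 * det (gram B) = 1"
    using assms by (intro orthonormal_frame_det) (auto simp: is_inner_product_def)
  then show ?thesis
    using zero_less_mult_iff[of "(det (\<chi> i. e i))\<^sup>2" "det (gram B)"] by auto
qed

text \<open>The Hodge operator in coordinates: \<open>G\<close> lowers both indices, and the
  contravariant volume tensor, with its density \<open>1 / sqrt (det G)\<close>, raises them again.
  Taking the skew part first sends symmetric matrices to 0, as \<open>hodge\<close>
  prescribes.\<close>

definition hodge_matrix :: "real ^ 4 ^ 4 \<Rightarrow> real ^ 4 ^ 4 \<Rightarrow> real ^ 4 ^ 4" where
  "hodge_matrix G a = (1 / sqrt (det G)) *\<^sub>R bdual (G ** ((1/2) *\<^sub>R (a - transpose a)) ** G)"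

lemma linear_hodge_matrix: "linear (hodge_matrix G)"
proof -
  have t: "transpose (a + b) = transpose a + transpose b" "transpose (r *\<^sub>R a) = r *\<^sub>R transpose a"
    for a b :: "real ^ 4 ^ 4" and r
    by (simp_all add: transpose_def vec_eq_iff)
  show ?thesis
    by (rule linearI) (simp_all add: hodge_matrix_def matrix_mult_simps t
        linear_add[OF linear_bdual] linear_diff[OF linear_bdual] linear_cmul[OF linear_bdual] algebra_simps)
qed

lemma transpose_wedge: "transpose (wedge u v) = - wedge u v"
  by (simp add: vec_eq_iff wedge_def transpose_def)

text \<open>In frame components the claim is the one for the standard basis. The factor
  \<open>det C\<close> from \<open>bdual_congruence\<close> equals
  \<open>sqrt (det (gram B))\<close> because the frame is positively oriented, and cancels the
  density.\<close>

lemma hodge_matrix_frame: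
  assumes B: "is_inner_product B" and e: "oriented_onb B e"
  shows "hodge_matrix (gram B) (wedge (e 1) (e 2)) = wedge (e 3) (e 4)"
proof -
  define E where "E = (\<chi> i. e i)"
  \<comment> \<open>The inverse of \<open>transpose E\<close>; its rows are the dual
    coframe.\<close>
  define C where "C = E ** gram B"
  have onb: "\<And>i j. B (e i) (e j) = (if i = j then 1 else 0)" and pos: "det E > 0"
    using e by (auto simp: oriented_onb_def E_def)
  have bil: "bilinear B"
    using B by (simp add: is_inner_product_def)
  have CE: "C ** transpose E = mat 1"
    using orthonormal_frame_matrix[OF bil onb] by (simp add: E_def C_def)
  have Ct: "transpose C = gram B ** transpose E"
    by (simp add: C_def matrix_transpose_mul gram_sym[OF B])
  have EC: "transpose E ** C = mat 1"
    using CE matrix_left_right_inverse by blast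
  have CE': "transpose C ** E = mat 1"
    using arg_cong[OF EC, of transpose] by (simp add: matrix_transpose_mul transpose_mat)
  have s: "sqrt (det (gram B)) = 1 / det E" and dC: "det C = 1 / det E"
  proof -
    have "(det E)\<^sup>2 * det (gram B) = 1"
      using orthonormal_frame_det[OF bil onb] by (simp add: E_def)
    then have "det (gram B) = (1 / det E)\<^sup>2"
      using pos by (simp add: field_simps power2_eq_square)
    then show "sqrt (det (gram B)) = 1 / det E"
      using pos by simp
    show "det C = 1 / det E"
      using arg_cong[OF CE, of det] pos by (simp add: det_mul det_transpose field_simps)
  qed
  have ei: "transpose E *v axis i 1 = e i" for i
    by (simp add: E_def matrix_vector_mult_basis column_def transpose_def)
  have w: "wedge (e i) (e j) = transpose E ** wedge (axis i 1) (axis j 1) ** E" for i j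
    by (simp only: wedge_congruence ei)
  have "bdual (wedge (axis 1 1) (axis 2 1)) = wedge (axis 3 1) (axis 4 1)"
    by (simp add: vec_eq_iff forall_4 bdual_def vector_4 wedge_def axis_def)
  then have "C ** bdual (transpose C ** wedge (axis 1 1) (axis 2 1) ** C) ** transpose C
    = det C *\<^sub>R wedge (axis 3 1) (axis 4 1)"
    by (simp add: bdual_congruence transpose_wedge)
  then have "transpose E ** (C ** bdual (transpose C ** wedge (axis 1 1) (axis 2 1) ** C) ** transpose C) ** E
    = det C *\<^sub>R wedge (e 3) (e 4)"
    by (simp add: w matrix_mult_simps)
  moreover have "transpose E ** (C ** X ** transpose C) ** E = X" for X
  proof -
    have "transpose E ** (C ** X ** transpose C) ** E = (transpose E ** C) ** X ** (transpose C ** E)"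
      by (simp only: matrix_mul_assoc)
    then show ?thesis
      by (simp add: EC CE')
  qed
  ultimately have "bdual (transpose C ** wedge (axis 1 1) (axis 2 1) ** C) = det C *\<^sub>R wedge (e 3) (e 4)"
    by simp
  moreover have "transpose C ** wedge (axis 1 1) (axis 2 1) ** C = gram B ** wedge (e 1) (e 2) ** gram B"
    unfolding Ct w by (simp only: C_def matrix_mul_assoc)
  moreover have "(1/2) *\<^sub>R (wedge (e 1) (e 2) - transpose (wedge (e 1) (e 2))) = wedge (e 1) (e 2)"
    by (simp add: transpose_wedge flip: scaleR_2)
  ultimately show ?thesis
    using pos by (simp add: hodge_matrix_def s dC)
qed

text \<open>For uniqueness, the difference \<open>R\<close> of two candidates vanishes on symmetric
  matrices and on \<open>wedge (e 1) (e 2)\<close> for oriented frames. Permuting and reorienting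
  one orthonormal frame gives all \<open>wedge (e i) (e j)\<close>, and these span the
  bivectors.\<close>

lemma hodge_eq:
  assumes B: "is_inner_product B"
  shows "hodge B = hodge_matrix (gram B)"
  unfolding hodge_def
proof (rule the_equality)
  show "linear (hodge_matrix (gram B)) \<and> (\<forall>a. transpose a = a \<longrightarrow> hodge_matrix (gram B) a = 0) \<and>
    (\<forall>e. oriented_onb B e \<longrightarrow> hodge_matrix (gram B) (wedge (e 1) (e 2)) = wedge (e 3) (e 4))"
    using linear_hodge_matrix hodge_matrix_frame[OF B]
    by (auto simp: hodge_matrix_def matrix_mult_simps linear_0[OF linear_bdual])
next
  fix S assume S: "linear S \<and> (\<forall>a. transpose a = a \<longrightarrow> S a = 0) \<and>
    (\<forall>e. oriented_onb B e \<longrightarrow> S (wedge (e 1) (e 2)) = wedge (e 3) (e 4))"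
  define R where "R a = S a - hodge_matrix (gram B) a" for a
  have bil: "bilinear B"
    using B by (simp add: is_inner_product_def)
  have lin: "linear R"
    unfolding R_def using S linear_hodge_matrix by (intro linear_compose_sub) auto
  have R_sym: "R a = 0" if "transpose a = a" for a
    using S that by (simp add: R_def hodge_matrix_def matrix_mult_simps linear_0[OF linear_bdual])
  have R_frame: "R (wedge (e 1) (e 2)) = 0" if "oriented_onb B e" for e
    using S that hodge_matrix_frame[OF B that] by (simp add: R_def)
  obtain e :: "4 \<Rightarrow> real ^ 4" where e: "\<And>i j. B (e i) (e j) = (if i = j then 1 else 0)"
    using orthonormal_frame_exists[OF B] by blast
  have R_e: "R (wedge (e i) (e j)) = 0" for i j
  proof (cases "i = j")
    case True
    then show ?thesis
      by (simp add: wedge_def linear_0[OF lin] flip: zero_vec_def)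
  next
    case False
    \<comment> \<open>A permutation taking 1 to \<open>i\<close> and 2 to \<open>j\<close>: the
      inner transposition fixes 1 and sends 2 to the preimage of \<open>j\<close> under the outer
      one.\<close>
    define \<pi> where "\<pi> = Transposition.transpose 1 i \<circ> Transposition.transpose 2 (Transposition.transpose 1 i j)"
    have \<pi>: "\<pi> 1 = i" "\<pi> 2 = j" "inj \<pi>"
    proof -
      have "Transposition.transpose 1 i j \<noteq> 1"
        using False by (auto simp: Transposition.transpose_def)
      then show "\<pi> 1 = i" "\<pi> 2 = j"
        by (simp_all add: \<pi>_def)
      show "inj \<pi>"
        by (auto simp: \<pi>_def intro: inj_compose)
    qed
    have "B ((e \<circ> \<pi>) a) ((e \<circ> \<pi>) b) = (if a = b then 1 else 0)" for a b
      using e \<pi>(3) by (auto simp: inj_eq)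
    from orthonormal_frame_reorient[OF bil this] obtain f
      where "oriented_onb B f" "f 1 = e i" "f 2 = e j"
      using \<pi> by auto
    then show ?thesis
      using R_frame[of f] by simp
  qed
  define E where "E = (\<chi> i. e i)"
  have ei: "transpose E *v axis i 1 = e i" for i
    by (simp add: E_def matrix_vector_mult_basis column_def transpose_def)
  have R_skew: "R a = 0" if a: "transpose a = - a" for a
  proof -
    define C where "C = E ** gram B"
    have CE: "C ** transpose E = mat 1"
      using orthonormal_frame_matrix[OF bil e] by (simp add: E_def C_def)
    have EC: "transpose E ** C = mat 1"
      using CE matrix_left_right_inverse by blast
    have CE': "transpose C ** E = mat 1"
      using arg_cong[OF EC, of transpose] by (simp add: matrix_transpose_mul transpose_mat)
    \<comment> \<open>The components of \<open>a\<close> in the frame \<open>e\<close>.\<close>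
    define c where "c = C ** a ** transpose C"
    have c: "transpose c = - c"
      by (simp add: c_def matrix_transpose_mul a matrix_mult_simps matrix_mul_assoc)
    have "a = (transpose E ** C) ** a ** (transpose C ** E)"
      by (simp add: EC CE')
    also have "\<dots> = transpose E ** c ** E"
      by (simp only: c_def matrix_mul_assoc)
    finally have a_eq: "a = transpose E ** c ** E" .
    have l: "linear (\<lambda>N. R (transpose E ** N ** E))"
      by (rule linearI) (simp_all add: matrix_mult_simps linear_add[OF lin] linear_cmul[OF lin])
    show ?thesis
      unfolding a_eq by (subst skew_eq_sum_wedge[OF c])
        (simp add: linear_sum[OF l] linear_cmul[OF l] wedge_congruence ei R_e del: transpose_matrix_vector)
  qed
  have "R a = 0" for a
  proof -
    have "transpose (a - transpose a) = - (a - transpose a)" "transpose (a + transpose a) = a + transpose a"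
      by (simp_all add: vec_eq_iff transpose_def)
    then have "R (a - transpose a) + R (a + transpose a) = 0"
      using R_skew R_sym by simp
    then have "R (2 *\<^sub>R a) = 0"
      by (simp add: scaleR_2 flip: linear_add[OF lin])
    then show ?thesis
      by (simp add: linear_cmul[OF lin])
  qed
  then show "S = hodge_matrix (gram B)"
    by (auto simp: R_def fun_eq_iff)
qed

section \<open>Self-dual and anti-self-dual bivectors\<close>

lemma inner_matrix_trace: "M \<bullet> N = trace (transpose M ** N)" for M N :: "real ^ 'n ^ 'n"
  by (simp add: inner_vec_def trace_def matrix_matrix_mult_def transpose_def) (rule sum.swap)

lemma inner_mult_left: "M \<bullet> (A ** N) = (transpose A ** M) \<bullet> N" for M N :: "real ^ 'n ^ 'n"
  by (simp add: inner_matrix_trace matrix_transpose_mul matrix_mul_assoc)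

lemma inner_mult_right: "M \<bullet> (N ** A) = (M ** transpose A) \<bullet> N" for M N :: "real ^ 'n ^ 'n"
  unfolding inner_matrix_trace
  by (metis matrix_mul_assoc matrix_transpose_mul trace_mul_sym transpose_transpose)

lemma trace_simps:
  "trace (A + B) = trace A + trace B" "trace (- A) = - trace A" "trace (c *\<^sub>R A) = c * trace A"
  for A B :: "real ^ 'n ^ 'n"
  by (simp_all add: trace_def sum.distrib sum_negf sum_distrib_left)

text \<open>The coordinate form of \<open>biv_inner\<close>. The factor 1/4 makes
  \<open>a ** G\<close> a complex structure for a unit (anti-)self-dual \<open>a\<close>, see
  \<open>selfdual_square\<close>.\<close>

definition ip :: "real ^ 4 ^ 4 \<Rightarrow> real ^ 4 ^ 4 \<Rightarrow> real ^ 4 ^ 4 \<Rightarrow> real" where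
  "ip G a b = (a \<bullet> (G ** b ** G)) / 4"

text \<open>With \<open>r\<close> equal to plus or minus \<open>sqrt (det G)\<close> these are the
  self-dual and the anti-self-dual bivectors (\<open>Lambda2_iff\<close>). Leaving \<open>r\<close>
  free treats both signs at once and keeps the square root out of the algebra and out of all
  derivatives.\<close>

definition selfdual :: "real ^ 4 ^ 4 \<Rightarrow> real \<Rightarrow> real ^ 4 ^ 4 \<Rightarrow> bool" where
  "selfdual G r a \<longleftrightarrow> transpose a = - a \<and> bdual (G ** a ** G) = r *\<^sub>R a"

lemma selfdual_skew: "selfdual G r a \<Longrightarrow> transpose a = - a"
  by (simp add: selfdual_def)

lemma subspace_selfdual: "subspace {a. selfdual G r a}"
  by (auto simp: subspace_def selfdual_def transpose_simps matrix_mult_simps linear_add[OF linear_bdual]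
      linear_cmul[OF linear_bdual] linear_0[OF linear_bdual] scaleR_add_right)
    (simp add: transpose_def zero_vec_def)

lemma selfdual_add: "selfdual G r a \<Longrightarrow> selfdual G r b \<Longrightarrow> selfdual G r (a + b)"
  using subspace_add[OF subspace_selfdual, of a G r b] by simp

lemma ip_linear:
  "ip G (a + b) c = ip G a c + ip G b c" "ip G a (b + c) = ip G a b + ip G a c"
  "ip G (s *\<^sub>R a) b = s * ip G a b" "ip G a (s *\<^sub>R b) = s * ip G a b"
  "ip G (- a) b = - ip G a b" "ip G a (- b) = - ip G a b"
  "ip G 0 b = 0" "ip G a 0 = 0"
  by (simp_all add: ip_def matrix_mult_simps inner_add_left inner_add_right add_divide_distrib)

lemma bdual_self_adjoint:
  assumes "transpose M = - M" "transpose N = - N"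
  shows "bdual M \<bullet> N = M \<bullet> bdual N"
  using skew_component[OF assms(1), of 2 1] skew_component[OF assms(1), of 3 1] skew_component[OF assms(1), of 4 1]
    skew_component[OF assms(1), of 3 2] skew_component[OF assms(1), of 4 2] skew_component[OF assms(1), of 4 3]
    skew_component[OF assms(2), of 2 1] skew_component[OF assms(2), of 3 1] skew_component[OF assms(2), of 4 1]
    skew_component[OF assms(2), of 3 2] skew_component[OF assms(2), of 4 2] skew_component[OF assms(2), of 4 3]
  by (simp add: inner_vec_def sum_4 bdual_def vector_4 skew_diag[OF assms(1)] skew_diag[OF assms(2)])

lemma mat_scaleR_mult: "(c *\<^sub>R mat 1) ** M = c *\<^sub>R M" "M ** (c *\<^sub>R mat 1) = c *\<^sub>R M"
  for M :: "real ^ 4 ^ 4"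
  by (simp_all add: matrix_mult_simps)

text \<open>The algebra is done for a bare Gram matrix, so that it serves the metric in the chart
  attached to a point as well as the metric pulled back to a chart of the twistor product.\<close>

locale metric_matrix =
  fixes G :: "real ^ 4 ^ 4"
  assumes sym: "transpose G = G" and pos: "\<And>X. X \<noteq> 0 \<Longrightarrow> X \<bullet> (G *v X) > 0"
begin

lemma ip_sym: "ip G a b = ip G b a"
proof -
  have "a \<bullet> (G ** b ** G) = (G ** (a ** G)) \<bullet> b"
    by (subst inner_mult_right, subst inner_mult_left) (simp only: sym)
  then show ?thesis
    by (simp add: ip_def inner_commute matrix_mul_assoc)
qed

lemma skew_congruence: "transpose a = - a \<Longrightarrow> transpose (G ** a ** G) = - (G ** a ** G)"
  by (simp add: matrix_transpose_mul sym matrix_mult_simps matrix_mul_assoc)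

text \<open>For \<open>N = G ** a ** G\<close> the matrix \<open>bdual N\<close> is
  \<open>r *\<^sub>R a\<close>, so \<open>mult_bdual\<close> says that the square is a multiple of
  the identity.\<close>

lemma selfdual_square:
  assumes a: "selfdual G r a" and r: "r \<noteq> 0"
  shows "a ** G ** a ** G = - ip G a a *\<^sub>R mat 1" "G ** a ** G ** a = - ip G a a *\<^sub>R mat 1"
proof -
  have skew: "transpose a = - a" and dual: "bdual (G ** a ** G) = r *\<^sub>R a"
    using a by (auto simp: selfdual_def)
  define k where "k = - pfaff (G ** a ** G) / r"
  have "(G ** a ** G) ** (r *\<^sub>R a) = - pfaff (G ** a ** G) *\<^sub>R mat 1"
    using mult_bdual(1)[OF skew_congruence[OF skew]] dual by simp
  then have "(1 / r) *\<^sub>R ((G ** a ** G) ** (r *\<^sub>R a)) = k *\<^sub>R mat 1"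
    by (simp add: k_def)
  then have 1: "G ** a ** G ** a = k *\<^sub>R mat 1"
    using r by (simp add: matrix_mult_simps)
  then have 2: "a ** G ** a ** G = k *\<^sub>R mat 1"
  proof -
    have "a ** G ** a ** G = transpose (G ** a ** G ** a)"
      by (simp add: matrix_transpose_mul sym skew matrix_mult_simps matrix_mul_assoc)
    then show ?thesis
      by (simp add: 1 transpose_simps transpose_mat)
  qed
  \<comment> \<open>The trace identifies the multiple.\<close>
  have "a \<bullet> (G ** a ** G) = - trace (a ** G ** a ** G)"
    by (simp add: inner_matrix_trace skew matrix_mult_simps trace_simps matrix_mul_assoc)
  also have "\<dots> = - 4 * k"
    by (simp add: 2 trace_simps) (simp add: trace_def mat_def)
  finally have "k = - ip G a a"
    by (simp add: ip_def)
  with 1 2 show "a ** G ** a ** G = - ip G a a *\<^sub>R mat 1" "G ** a ** G ** a = - ip G a a *\<^sub>R mat 1"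
    by simp_all
qed

text \<open>Polarisation of \<open>selfdual_square\<close>; these are the quaternion relations
  within one of the two eigenbundles.\<close>

lemma selfdual_anticommute:
  assumes a: "selfdual G r a" and b: "selfdual G r b" and r: "r \<noteq> 0"
  shows "a ** G ** b ** G + b ** G ** a ** G = (- 2 * ip G a b) *\<^sub>R mat 1"
proof -
  have "(a + b) ** G ** (a + b) ** G = - ip G (a + b) (a + b) *\<^sub>R mat 1"
    by (rule selfdual_square[OF selfdual_add[OF a b] r])
  then have "a ** G ** b ** G + (b ** G ** a ** G + (2 * ip G a b) *\<^sub>R mat 1) = 0"
    using selfdual_square(1)[OF a r] selfdual_square(1)[OF b r] ip_sym[of a b]
    by (simp add: matrix_mult_simps ip_linear algebra_simps)
  then show ?thesis
    by (simp add: eq_neg_iff_add_eq_0 add.assoc)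
qed

text \<open>The opposite signs of the eigenvalues turn the polarised identity for
  \<open>bdual\<close> into a statement on a commutator. It is a multiple of the identity and has
  trace zero, so it vanishes.\<close>

lemma selfdual_commute:
  assumes a: "selfdual G r a" and b: "selfdual G (- r) b" and r: "r \<noteq> 0"
  shows "a ** G ** b ** G = b ** G ** a ** G"
proof -
  have skew: "transpose a = - a" "transpose b = - b"
    and dual: "bdual (G ** a ** G) = r *\<^sub>R a" "bdual (G ** b ** G) = - r *\<^sub>R b"
    using a b by (auto simp: selfdual_def)
  obtain c where "(G ** a ** G) ** bdual (G ** b ** G) + (G ** b ** G) ** bdual (G ** a ** G) = c *\<^sub>R mat 1"
    using mult_bdual_polarized[OF skew_congruence[OF skew(1)] skew_congruence[OF skew(2)]] by blast
  then have eq: "r *\<^sub>R (G ** b ** G ** a - G ** a ** G ** b) = c *\<^sub>R mat 1"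
    by (simp add: matrix_mult_simps dual algebra_simps)
  moreover have "trace (G ** b ** G ** a) = trace (G ** a ** G ** b)"
    by (metis matrix_mul_assoc trace_mul_sym)
  ultimately have "trace (c *\<^sub>R mat 1 :: real ^ 4 ^ 4) = 0"
    by (simp add: trace_simps trace_sub flip: eq)
  then have "c = 0"
    by (simp add: trace_simps) (simp add: trace_def mat_def)
  then have "G ** b ** G ** a = G ** a ** G ** b"
    using eq r by simp
  moreover have "a ** G ** b ** G = transpose (G ** b ** G ** a)" "b ** G ** a ** G = transpose (G ** a ** G ** b)"
    by (simp_all add: matrix_transpose_mul sym skew matrix_mult_simps matrix_mul_assoc)
  ultimately show ?thesis
    by simp
qed

lemma nonneg: "X \<bullet> (G *v X) \<ge> 0"
  using pos[of X] by (cases "X = 0") auto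

text \<open>Up to sign \<open>a ** G\<close> is the endomorphism \<open>K_a\<close>
  (\<open>Kend_eq\<close>); here it is moved across the inner product \<open>G\<close>.\<close>

lemma skew_shift: "transpose a = - a \<Longrightarrow> ((a ** G) *v X) \<bullet> (G *v Y) = - (X \<bullet> (G *v ((a ** G) *v Y)))"
proof -
  assume a: "transpose a = - a"
  have "((a ** G) *v X) \<bullet> (G *v Y) = X \<bullet> (transpose (a ** G) *v (G *v Y))"
    by (metis inner_transpose_mult transpose_transpose)
  also have "transpose (a ** G) = - (G ** a)"
    by (simp add: matrix_transpose_mul sym a matrix_mult_simps)
  also have "- (G ** a) *v (G *v Y) = - (G *v ((a ** G) *v Y))"
    by (simp only: bounded_bilinear.minus_left[OF bounded_bilinear_matrix_vector] matrix_mult_simps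
        matrix_vector_mul_assoc matrix_mul_assoc)
  finally show ?thesis
    by simp
qed

lemma scaleR_mat_vector: "(c *\<^sub>R mat 1 :: real ^ 4 ^ 4) *v X = c *\<^sub>R X"
  by (simp add: scaleR_matrix_vector_assoc[symmetric])

lemma selfdual_norm:
  assumes a: "selfdual G r a" and r: "r \<noteq> 0"
  shows "((a ** G) *v X) \<bullet> (G *v ((a ** G) *v X)) = ip G a a * (X \<bullet> (G *v X))"
proof -
  have "((a ** G) *v X) \<bullet> (G *v ((a ** G) *v X)) = - (X \<bullet> (G *v ((a ** G) *v ((a ** G) *v X))))"
    using a by (intro skew_shift) (simp add: selfdual_def)
  also have "(a ** G) *v ((a ** G) *v X) = - ip G a a *\<^sub>R X"
    using selfdual_square(1)[OF a r] by (simp add: matrix_vector_mul_assoc matrix_mul_assoc scaleR_mat_vector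
        bounded_bilinear.minus_left[OF bounded_bilinear_matrix_vector])
  finally show ?thesis
    by (simp add: matrix_vector_mult_scaleR bounded_bilinear.minus_right[OF bounded_bilinear_matrix_vector])
qed

text \<open>Positivity of \<open>G\<close> passes to bivectors through \<open>selfdual_norm\<close>:
  a nonzero \<open>a\<close> gives a nonzero endomorphism \<open>a ** G\<close>, and a vector
  outside its kernel decides the sign.\<close>

lemma selfdual_pos:
  assumes a: "selfdual G r a" and r: "r \<noteq> 0" and "a \<noteq> 0"
  shows "ip G a a > 0"
proof -
  have "a ** G \<noteq> 0"
  proof
    assume "a ** G = 0"
    then have "r *\<^sub>R a = 0"
      using a by (metis selfdual_def linear_0[OF linear_bdual] matrix_mul_assoc matrix_mult_simps(10))
    then show False
      using assms by simp
  qed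
  then obtain X where X: "(a ** G) *v X \<noteq> 0"
    by (metis matrix_eq matrix_vector_mult_0)
  then have "X \<noteq> 0"
    by (auto simp: matrix_vector_mult_0_right)
  have "ip G a a * (X \<bullet> (G *v X)) > 0"
    unfolding selfdual_norm[OF a r, symmetric] by (rule pos[OF X])
  then show ?thesis
    using pos[OF \<open>X \<noteq> 0\<close>] by (simp add: zero_less_mult_iff)
qed

context
  fixes a b r
  assumes a: "selfdual G r a" "ip G a a = 1" and b: "selfdual G (- r) b" "ip G b b = 1" and r: "r \<noteq> 0"
begin

lemma product_involution: "(a ** G ** b ** G) ** (a ** G ** b ** G) = mat 1"
proof -
  have "(a ** G ** b ** G) ** (a ** G ** b ** G) = (a ** G ** b ** G) ** (b ** G ** a ** G)"
    by (simp add: selfdual_commute[OF a(1) b(1) r])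
  also have "\<dots> = (a ** G) ** (b ** G ** b ** G) ** (a ** G)"
    by (simp add: matrix_mul_assoc)
  also have "\<dots> = - (a ** G ** a ** G)"
    using selfdual_square(1)[OF b(1)] b r by (simp add: matrix_mult_simps mat_scaleR_mult matrix_mul_assoc)
  finally show ?thesis
    using selfdual_square(1)[OF a(1) r] a by simp
qed

lemma product_symmetric: "transpose (G ** a ** G ** b ** G) = G ** a ** G ** b ** G"
proof -
  have "transpose a = - a" "transpose b = - b"
    using a b by (auto simp: selfdual_def)
  then have "transpose (G ** a ** G ** b ** G) = G ** (b ** G ** a ** G)"
    by (simp add: matrix_transpose_mul sym matrix_mult_simps matrix_mul_assoc)
  then show ?thesis
    by (simp add: matrix_mul_assoc selfdual_commute[OF a(1) b(1) r, symmetric])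
qed

end

text \<open>Algebraic core of the fact that a metric connection preserves the eigenbundles and their
  unit spheres. Primes are derivatives in one direction and \<open>M\<close> is the connection form
  there; \<open>dual\<close> and \<open>unit\<close> are the differentiated equations of a unit
  eigenvector.\<close>

lemma selfdual_derivative:
  assumes a: "selfdual G r a" "ip G a a = 1" and r: "r \<noteq> 0"
    and a': "transpose a' = - a'" and G': "G' = transpose M ** G + G ** M"
    and dual: "bdual (G' ** a ** G + G ** a' ** G + G ** a ** G') = r' *\<^sub>R a + r *\<^sub>R a'"
    and unit: "a' \<bullet> (G ** a ** G) + a \<bullet> (G' ** a ** G + G ** a' ** G + G ** a ** G') = 0"
  shows "selfdual G r (a' + M ** a + a ** transpose M)" "ip G (a' + M ** a + a ** transpose M) a = 0"
proof -
  define N where "N = G ** a ** G"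
  define w where "w = a' + M ** a + a ** transpose M"
  have skew: "transpose a = - a" and N: "bdual N = r *\<^sub>R a"
    using a by (auto simp: selfdual_def N_def)
  have w: "transpose w = - w"
    by (simp add: w_def transpose_simps matrix_transpose_mul skew a' matrix_mult_simps)
  have exp: "G' ** a ** G + G ** a' ** G + G ** a ** G' = (transpose M ** N + N ** M) + G ** w ** G"
    by (simp add: G' N_def w_def matrix_mult_simps matrix_mul_assoc algebra_simps)
  have "a \<bullet> (transpose M ** N) = (M ** a) \<bullet> N" "a \<bullet> (N ** M) = (a ** transpose M) \<bullet> N"
    "a \<bullet> (G ** w ** G) = w \<bullet> N"
    using ip_sym[of a w] inner_mult_left[of a "transpose M" N] inner_mult_right[of a N M]
    by (simp_all add: N_def ip_def)
  then have "2 * (w \<bullet> N) = a' \<bullet> N + a \<bullet> (G' ** a ** G + G ** a' ** G + G ** a ** G')"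
    unfolding exp by (simp add: w_def inner_add_left inner_add_right)
  then have wN: "w \<bullet> N = 0"
    using unit by (simp add: N_def)
  then show "ip G (a' + M ** a + a ** transpose M) a = 0"
    by (simp add: ip_def N_def w_def)
  have "bdual (transpose M ** N + N ** M) = trace M *\<^sub>R (r *\<^sub>R a) - M ** (r *\<^sub>R a) - (r *\<^sub>R a) ** transpose M"
  proof -
    have "transpose N = - N"
      using skew_congruence[OF skew] by (simp add: N_def)
    from bdual_derivation[OF this, of M] show ?thesis
      by (simp only: N)
  qed
  moreover have "bdual (transpose M ** N + N ** M) + bdual (G ** w ** G) = r' *\<^sub>R a + r *\<^sub>R a'"
    using dual unfolding exp by (simp only: linear_add[OF linear_bdual, of "transpose M ** N + N ** M" "G ** w ** G"])
  ultimately have "bdual (G ** w ** G)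
      = r' *\<^sub>R a + r *\<^sub>R a' - (trace M *\<^sub>R (r *\<^sub>R a) - M ** (r *\<^sub>R a) - (r *\<^sub>R a) ** transpose M)"
    by (metis add_diff_cancel_left')
  \<comment> \<open>Covariantly differentiating the eigenvalue equation leaves an error that is a
    multiple of \<open>a\<close>.\<close>
  then have bw: "bdual (G ** w ** G) = (r' - trace M * r) *\<^sub>R a + r *\<^sub>R w"
    by (simp add: w_def matrix_mult_simps algebra_simps)
  \<comment> \<open>Since \<open>bdual\<close> is self-adjoint and \<open>w\<close> is orthogonal to
    \<open>a\<close>, pairing with \<open>N\<close> isolates the coefficient of \<open>a\<close> and
    shows that it is zero. This determines \<open>r'\<close> without differentiating a square
    root.\<close>
  have "bdual (G ** w ** G) \<bullet> N = 0"
  proof -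
    have "bdual (G ** w ** G) \<bullet> N = (G ** w ** G) \<bullet> (r *\<^sub>R a)"
      using bdual_self_adjoint[OF skew_congruence[OF w] skew_congruence[OF skew]] N by (simp add: N_def)
    also have "\<dots> = r * (w \<bullet> N)"
      using ip_sym[of a w] by (simp add: ip_def N_def inner_commute)
    finally show ?thesis
      using wN by simp
  qed
  then have "(r' - trace M * r) * (a \<bullet> N) = 0"
    using wN bw by (simp add: inner_add_left)
  moreover have "a \<bullet> N = 4"
    using a(2) by (simp add: ip_def N_def)
  ultimately have "bdual (G ** w ** G) = r *\<^sub>R w"
    using bw by simp
  then show "selfdual G r (a' + M ** a + a ** transpose M)"
    using w by (simp add: selfdual_def w_def)
qed

end

section \<open>From Gram matrices back to inner products and changes of basis\<close>

lemma metric_matrix_gram: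
  assumes "is_inner_product B"
  shows "metric_matrix (gram B)"
proof
  show "transpose (gram B) = gram B"
    by (rule gram_sym[OF assms])
  show "X \<bullet> (gram B *v X) > 0" if "X \<noteq> 0" for X
    using inner_product_pos[OF assms that] bilinear_gram[OF inner_product_bilinear[OF assms], of X X] by simp
qed

lemma biv_inner_eq_ip:
  assumes B: "is_inner_product B"
  shows "biv_inner B a b = ip (gram B) a b"
proof -
  have "a $ i $ j * (gram B ** b ** gram B) $ i $ j
      = (\<Sum>k\<in>UNIV. \<Sum>l\<in>UNIV. a $ i $ j * b $ k $ l * B (axis i 1) (axis k 1) * B (axis j 1) (axis l 1))"
    for i j
  proof -
    have "a $ i $ j * (gram B ** b ** gram B) $ i $ j
        = (\<Sum>l\<in>UNIV. \<Sum>k\<in>UNIV. a $ i $ j * b $ k $ l * B (axis i 1) (axis k 1) * B (axis j 1) (axis l 1))"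
      by (simp add: matrix_matrix_mult_def gram_def sum_distrib_left sum_distrib_right
          inner_product_sym[OF B, of "axis j 1"] mult_ac)
    then show ?thesis
      by (subst sum.swap)
  qed
  then show ?thesis
    by (simp add: biv_inner_def ip_def inner_vec_def)
qed

lemma Lambda2_iff:
  assumes B: "is_inner_product B"
  shows "a \<in> Lambda2 s B \<longleftrightarrow> selfdual (gram B) (s * sqrt (det (gram B))) a"
proof -
  have d: "sqrt (det (gram B)) > 0"
    using det_gram_pos[OF B] by simp
  have "hodge B a = s *\<^sub>R a \<longleftrightarrow> bdual (gram B ** a ** gram B) = (s * sqrt (det (gram B))) *\<^sub>R a"
    if "transpose a = - a"
  proof -
    have "(1 / 2) *\<^sub>R (a - transpose a) = a"
      using that by (simp flip: scaleR_2)
    then have "hodge B a = (1 / sqrt (det (gram B))) *\<^sub>R bdual (gram B ** a ** gram B)"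
      by (simp add: hodge_eq[OF B] hodge_matrix_def)
    moreover have "(1 / d) *\<^sub>R b = s *\<^sub>R a \<longleftrightarrow> b = (s * d) *\<^sub>R a" if "d > 0" for d :: real and b
      using that by (auto simp: vector_fraction_eq_iff mult.commute)
    ultimately show ?thesis
      using d by simp
  qed
  then show ?thesis
    by (auto simp: Lambda2_def bivectors_def selfdual_def)
qed

lemma inner_skew_wedge:
  assumes "transpose a = - a"
  shows "a \<bullet> wedge x y = 2 * (x \<bullet> (a *v y))"
  using skew_component[OF assms, of 2 1] skew_component[OF assms, of 3 1] skew_component[OF assms, of 4 1]
    skew_component[OF assms, of 3 2] skew_component[OF assms, of 4 2] skew_component[OF assms, of 4 3]
  by (simp add: inner_vec_def sum_4 wedge_def matrix_vector_mult_def skew_diag[OF assms] algebra_simps)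

text \<open>The sign arises when the skew endomorphism \<open>a ** gram B\<close> is moved from
  \<open>Y\<close> to \<open>X\<close>.\<close>

lemma Kend_eq:
  assumes B: "is_inner_product B" and a: "transpose a = - a"
  shows "Kend B a X = - ((a ** gram B) *v X)"
proof -
  have bil: "bilinear B"
    using B by (simp add: is_inner_product_def)
  have *: "B (- ((a ** gram B) *v X)) Y = 2 * biv_inner B a (wedge X Y)" for Y
  proof -
    have "2 * biv_inner B a (wedge X Y) = (a \<bullet> wedge (gram B *v X) (gram B *v Y)) / 2"
      using wedge_congruence[of "gram B" X Y] by (simp add: biv_inner_eq_ip[OF B] ip_def gram_sym[OF B])
    also have "\<dots> = (gram B *v X) \<bullet> (a *v (gram B *v Y))"
      by (simp add: inner_skew_wedge[OF a])
    also have "\<dots> = X \<bullet> (gram B *v ((a ** gram B) *v Y))"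
      using inner_transpose_mult[of "gram B" X] by (simp add: gram_sym[OF B] flip: matrix_vector_mul_assoc)
    also have "\<dots> = B (- ((a ** gram B) *v X)) Y"
      using metric_matrix.skew_shift[OF metric_matrix_gram[OF B] a, of X Y] by (simp add: bilinear_gram[OF bil])
    finally show ?thesis
      by simp
  qed
  show ?thesis
    unfolding Kend_def
  proof (rule the_equality)
    fix Z assume Z: "\<forall>Y. B Z Y = 2 * biv_inner B a (wedge X Y)"
    define W where "W = Z - (- ((a ** gram B) *v X))"
    have "B W W = 0"
    proof -
      have "B W W = B Z W - B (- ((a ** gram B) *v X)) W"
        by (subst (1) W_def) (rule bilinear_lsub[OF bil])
      then show ?thesis
        using Z * by simp
    qed
    then have "W = 0"
      using B by (metis is_inner_product_def less_irrefl)
    then show "Z = - ((a ** gram B) *v X)"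
      by (simp add: W_def eq_neg_iff_add_eq_0)
  qed (use * in blast)
qed

lemma matrix_cancel:
  fixes J :: "real ^ 'n ^ 'n"
  assumes "det J \<noteq> 0"
  shows "J *v X = J *v Y \<longleftrightarrow> X = Y"
    and "J ** M ** transpose J = J ** N ** transpose J \<longleftrightarrow> M = N"
proof -
  obtain K where K: "K ** J = mat 1" "J ** K = mat 1"
    using assms by (metis invertible_def invertible_det_nz)
  have K': "transpose J ** transpose K = mat 1"
    using arg_cong[OF K(1), of transpose] by (simp add: matrix_transpose_mul transpose_mat)
  show "J *v X = J *v Y \<longleftrightarrow> X = Y"
    by (metis K(1) matrix_vector_mul_assoc matrix_vector_mul_lid)
  have "K ** (J ** M ** transpose J) ** transpose K = M" for M
  proof -
    have "K ** (J ** M ** transpose J) ** transpose K = (K ** J) ** M ** (transpose J ** transpose K)"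
      by (simp only: matrix_mul_assoc)
    then show ?thesis
      by (simp add: K K')
  qed
  then show "J ** M ** transpose J = J ** N ** transpose J \<longleftrightarrow> M = N"
    by metis
qed

text \<open>As \<open>det J\<close> is positive, \<open>sqrt (det G)\<close> is
  \<open>det J * sqrt (det H)\<close>, and this factor \<open>det J\<close> is the one that
  \<open>bdual_congruence\<close> produces. A change of orientation would exchange the two
  eigenbundles.\<close>

lemma selfdual_congruence:
  assumes J: "det J > 0" and H: "transpose H = H" and G: "G = transpose J ** H ** J"
  shows "selfdual G (s * sqrt (det G)) a \<longleftrightarrow> selfdual H (s * sqrt (det H)) (J ** a ** transpose J)"
proof -
  have cancel: "J ** M ** transpose J = J ** N ** transpose J \<longleftrightarrow> M = N" for M N
    using J by (intro matrix_cancel) simp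
  have skew: "transpose a = - a \<longleftrightarrow> transpose (J ** a ** transpose J) = - (J ** a ** transpose J)"
    using cancel[of "transpose a" "- a"] by (simp add: matrix_transpose_mul matrix_mul_assoc matrix_mult_simps)
  define N where "N = H ** (J ** a ** transpose J) ** H"
  have sd: "sqrt (det G) = det J * sqrt (det H)"
    using J by (simp add: G det_mul det_transpose real_sqrt_mult)
  show ?thesis
  proof (cases "transpose a = - a")
    case True
    have "transpose N = - N"
      using True skew H by (simp add: N_def matrix_transpose_mul matrix_mul_assoc matrix_mult_simps)
    from bdual_congruence[OF this, of J]
    have "J ** bdual (G ** a ** G) ** transpose J = det J *\<^sub>R bdual N"
      by (simp add: N_def G matrix_mul_assoc)
    then have "bdual (G ** a ** G) = (s * sqrt (det G)) *\<^sub>R a \<longleftrightarrow>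
        det J *\<^sub>R bdual N = J ** ((s * sqrt (det G)) *\<^sub>R a) ** transpose J"
      using cancel by metis
    also have "\<dots> \<longleftrightarrow> bdual N = (s * sqrt (det H)) *\<^sub>R (J ** a ** transpose J)"
    proof -
      have "J ** ((s * sqrt (det G)) *\<^sub>R a) ** transpose J = det J *\<^sub>R ((s * sqrt (det H)) *\<^sub>R (J ** a ** transpose J))"
        by (simp add: sd matrix_mult_simps mult_ac)
      then show ?thesis
        using J by (simp only: scaleR_cancel_left) simp
    qed
    finally show ?thesis
      using True skew by (simp add: selfdual_def N_def)
  next
    case False
    then show ?thesis
      using skew by (simp add: selfdual_def)
  qed
qed

lemma ip_congruence:
  "ip (transpose J ** H ** J) a b = ip H (J ** a ** transpose J) (J ** b ** transpose J)"
proof -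
  have "a \<bullet> (transpose J ** (H ** J ** b ** transpose J ** H) ** J)
      = (J ** a ** transpose J) \<bullet> (H ** J ** b ** transpose J ** H)"
    by (subst inner_mult_right, subst inner_mult_left) (simp only: transpose_transpose matrix_mul_assoc)
  then show ?thesis
    by (simp add: ip_def matrix_mul_assoc)
qed

section \<open>Tangent planes of the twistor fibres\<close>

context metric_matrix
begin

lemma symmetric_form: "X \<bullet> (G *v Y) = Y \<bullet> (G *v X)"
  using inner_transpose_mult[of G X Y] by (simp add: sym inner_commute)

text \<open>The two products are adjoint to each other with respect to \<open>G\<close>, so they
  have the same quadratic form; they add up to zero because orthogonal bivectors of the same type
  anticommute.\<close>

lemma selfdual_perp_form:
  assumes a: "selfdual G r a" and V: "selfdual G r V" and r: "r \<noteq> 0" and "ip G V a = 0"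
  shows "X \<bullet> (G *v ((V ** G) *v ((a ** G) *v X))) = 0" "X \<bullet> (G *v ((a ** G) *v ((V ** G) *v X))) = 0"
proof -
  have skew: "transpose a = - a" "transpose V = - V"
    using a V by (auto simp: selfdual_def)
  have "X \<bullet> (G *v ((V ** G) *v ((a ** G) *v X))) = X \<bullet> (G *v ((a ** G) *v ((V ** G) *v X)))"
    using skew_shift[OF skew(1), of X "(V ** G) *v X"] skew_shift[OF skew(2), of X "(a ** G) *v X"]
      symmetric_form[of "(V ** G) *v X" "(a ** G) *v X"] by simp
  moreover have "X \<bullet> (G *v ((V ** G) *v ((a ** G) *v X))) + X \<bullet> (G *v ((a ** G) *v ((V ** G) *v X)))
      = X \<bullet> (G *v ((V ** G ** a ** G + a ** G ** V ** G) *v X))"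
    by (simp add: matrix_vector_mul_assoc matrix_mul_assoc matrix_vector_mult_add_rdistrib
        matrix_vector_right_distrib inner_add_right)
  ultimately show "X \<bullet> (G *v ((V ** G) *v ((a ** G) *v X))) = 0" "X \<bullet> (G *v ((a ** G) *v ((V ** G) *v X))) = 0"
    using selfdual_anticommute[OF V a r] assms(4) by (simp_all add: matrix_vector_mult_0_right)
qed

text \<open>Evaluation at a vector \<open>e\<close> is injective by \<open>selfdual_norm\<close>,
  and its values are orthogonal to \<open>e\<close> and to \<open>f\<close>, which span a plane. The
  upper bound suffices: equality comes from the dimension count in
  \<open>range_frame\<close>.\<close>

lemma dim_selfdual_perp:
  assumes a: "selfdual G r a" "ip G a a = 1" and r: "r \<noteq> 0"
  shows "dim {V. selfdual G r V \<and> ip G V a = 0} \<le> 2"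
proof -
  let ?S = "{V. selfdual G r V \<and> ip G V a = 0}"
  define e :: "real ^ 4" where "e = axis 1 1"
  have e: "e \<noteq> 0" "e \<bullet> (G *v e) > 0"
    using pos[of e] by (auto simp: e_def axis_eq_0_iff)
  define f where "f = (a ** G) *v e"
  have f: "f \<bullet> (G *v f) = e \<bullet> (G *v e)"
    unfolding f_def selfdual_norm[OF a(1) r] by (simp add: a(2))
  have skew0: "X \<bullet> (G *v ((V ** G) *v X)) = 0" if "transpose V = - V" for V X
    using skew_shift[OF that, of X X] inner_transpose_mult[of G X "(V ** G) *v X"]
    by (simp add: sym inner_commute)
  have sub: "subspace ?S"
    using subspace_selfdual[of G r] by (auto simp: subspace_def ip_linear)
  define T where "T V = (V ** G) *v e" for V :: "real ^ 4 ^ 4"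
  have lin: "linear T"
    unfolding T_def by (rule linearI)
      (simp_all add: matrix_mult_simps matrix_vector_mult_add_rdistrib scaleR_matrix_vector_assoc)
  have inj: "inj_on T ?S"
  proof (subst linear_inj_on_iff_eq_0[OF lin sub], safe)
    fix V assume V: "selfdual G r V" "T V = 0"
    have "ip G V V * (e \<bullet> (G *v e)) = 0"
      using V(2) unfolding selfdual_norm[OF V(1) r, symmetric] T_def[symmetric] by simp
    then show "V = 0"
      using e selfdual_pos[OF V(1) r] by (metis less_irrefl mult_eq_0_iff)
  qed
  have im: "T ` ?S \<subseteq> {Y \<in> UNIV. \<forall>z \<in> span {G *v e, G *v f}. orthogonal z Y}"
  proof clarsimp
    fix V z assume V: "selfdual G r V" "ip G V a = 0" and z: "z \<in> span {G *v e, G *v f}"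
    have skV: "transpose V = - V"
      using V by (simp add: selfdual_def)
    have "T V \<bullet> (G *v e) = 0"
      using skew0[OF skV, of e] skew_shift[OF skV, of e e] by (simp add: T_def)
    moreover have "T V \<bullet> (G *v f) = 0"
    proof -
      have "T V \<bullet> (G *v f) = - (e \<bullet> (G *v ((V ** G ** a ** G) *v e)))"
        using skew_shift[OF skV, of e f] by (simp add: T_def f_def matrix_vector_mul_assoc matrix_mul_assoc)
      moreover have "T V \<bullet> (G *v f) = - (e \<bullet> (G *v ((a ** G ** V ** G) *v e)))"
      proof -
        have "f \<bullet> (G *v T V) = - (e \<bullet> (G *v ((a ** G) *v T V)))"
          unfolding f_def using a by (intro skew_shift) (simp add: selfdual_def)
        moreover have "f \<bullet> (G *v T V) = T V \<bullet> (G *v f)"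
          using inner_transpose_mult[of G f "T V"] by (simp add: sym inner_commute)
        ultimately show ?thesis
          by (simp add: T_def matrix_vector_mul_assoc matrix_mul_assoc)
      qed
      ultimately have "2 * (T V \<bullet> (G *v f)) = - (e \<bullet> (G *v ((V ** G ** a ** G + a ** G ** V ** G) *v e)))"
        by (simp add: matrix_vector_mult_add_rdistrib matrix_vector_right_distrib inner_add_right)
      then show ?thesis
        by (simp add: selfdual_anticommute[OF V(1) a(1) r] V(2) matrix_vector_mult_0_right)
    qed
    ultimately have "span {G *v e, G *v f} \<subseteq> {z. orthogonal z (T V)}"
      by (intro span_minimal subspaceI) (auto simp: orthogonal_def inner_commute[of _ "T V"] inner_add_right)
    then show "orthogonal z (T V)"
      using z by blast
  qed
  have ef: "e \<bullet> (G *v f) = 0"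
    unfolding f_def using a by (intro skew0) (simp add: selfdual_def)
  have "independent {G *v e, G *v f}" "G *v e \<noteq> G *v f"
  proof -
    have c: "c = 0" if "G *v e = c *\<^sub>R (G *v f)" for c
      using arg_cong[OF that, of "(\<bullet>) e"] e ef by simp
    show "G *v e \<noteq> G *v f"
      using c[of 1] by auto
    have "G *v f \<noteq> 0"
      using f e by auto
    moreover have "G *v e \<notin> span {G *v f}"
    proof
      assume "G *v e \<in> span {G *v f}"
      then obtain k where k: "G *v e = k *\<^sub>R (G *v f)"
        by (auto simp: span_singleton)
      then have "G *v e = 0"
        using c[OF k] by simp
      then show False
        using e by simp
    qed
    ultimately show "independent {G *v e, G *v f}"
      by (simp add: independent_insert)
  qed
  then have "dim (span {G *v e, G *v f}) = 2"
    by (simp add: dim_eq_card_independent)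
  then have "dim {Y \<in> UNIV :: (real ^ 4) set. \<forall>z \<in> span {G *v e, G *v f}. orthogonal z Y} = 2"
    using dim_subspace_orthogonal_to_vectors[of "span {G *v e, G *v f}" UNIV] by simp
  then have "dim (T ` ?S) \<le> 2"
    using dim_subset[OF im] by simp
  moreover have "dim (T ` ?S) = dim ?S"
  proof (rule dim_image_eq[OF lin])
    have "span ?S = ?S"
      using sub by (simp only: span_eq_iff)
    with inj show "inj_on T (span ?S)"
      by (simp only:)
  qed
  ultimately show ?thesis
    by simp
qed

end

section \<open>Almost product structures on open sets\<close>

text \<open>A product rule for an operator field of which only the values on fixed vectors are known
  to be differentiable; expansion in a basis reduces it to finitely many such vectors.\<close>

lemma has_derivative_apply_linear:
  fixes T :: "'a::real_normed_vector \<Rightarrow> 'b::euclidean_space \<Rightarrow> 'c::real_normed_vector"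
  assumes U: "open U" "x \<in> U" and lin: "\<And>y. y \<in> U \<Longrightarrow> linear (T y)"
    and T: "\<And>v. ((\<lambda>y. T y v) has_derivative T' v) (at x)"
    and f: "(f has_derivative f') (at x)"
  shows "((\<lambda>y. T y (f y)) has_derivative (\<lambda>u. T' (f x) u + T x (f' u))) (at x)"
proof -
  have exp: "T y v = (\<Sum>b\<in>Basis. (v \<bullet> b) *\<^sub>R T y b)" if "y \<in> U" for y v
    using linear_sum[OF lin[OF that], of "\<lambda>b. (v \<bullet> b) *\<^sub>R b" Basis]
    by (simp add: euclidean_representation linear_cmul[OF lin[OF that]])
  have d: "((\<lambda>y. \<Sum>b\<in>Basis. (v y \<bullet> b) *\<^sub>R T y b) has_derivative
      (\<lambda>u. \<Sum>b\<in>Basis. (v x \<bullet> b) *\<^sub>R T' b u + (v' u \<bullet> b) *\<^sub>R T x b)) (at x)"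
    if "(v has_derivative v') (at x)" for v v'
    by (intro has_derivative_sum has_derivative_scaleR has_derivative_inner_left that T)
  \<comment> \<open>Linearity in \<open>v\<close> passes from \<open>T\<close> to \<open>T'\<close>
    by uniqueness of derivatives.\<close>
  have T': "T' v u = (\<Sum>b\<in>Basis. (v \<bullet> b) *\<^sub>R T' b u)" for v u
  proof -
    have "((\<lambda>y. T y v) has_derivative (\<lambda>u. \<Sum>b\<in>Basis. (v \<bullet> b) *\<^sub>R T' b u + (0 \<bullet> b) *\<^sub>R T x b)) (at x)"
      by (rule has_derivative_transform_within_open[OF d[OF has_derivative_const] U]) (rule exp[symmetric])
    then have "T' v = (\<lambda>u. \<Sum>b\<in>Basis. (v \<bullet> b) *\<^sub>R T' b u + (0 \<bullet> b) *\<^sub>R T x b)"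
      by (rule has_derivative_unique[OF T])
    from fun_cong[OF this] show ?thesis
      by simp
  qed
  have "((\<lambda>y. T y (f y)) has_derivative
      (\<lambda>u. \<Sum>b\<in>Basis. (f x \<bullet> b) *\<^sub>R T' b u + (f' u \<bullet> b) *\<^sub>R T x b)) (at x)"
    by (rule has_derivative_transform_within_open[OF d[OF f] U]) (rule exp[symmetric])
  moreover have "T x (f' u) = (\<Sum>b\<in>Basis. (f' u \<bullet> b) *\<^sub>R T x b)" for u
    by (rule exp[OF U(2)])
  ultimately show ?thesis
    by (simp add: sum.distrib T'[of "f x"])
qed

lemma christoffel_levi_civita:
  fixes h :: "'e::euclidean_space \<Rightarrow> 'e \<Rightarrow> 'e \<Rightarrow> real"
  assumes "open S" "x \<in> S" "\<And>y. y \<in> S \<Longrightarrow> is_inner_product (h y)"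
    and "\<And>v w. (\<lambda>y. h y v w) differentiable (at x)"
  shows "is_levi_civita h x (christoffel h x)"
  unfolding christoffel_def by (rule theI'[OF levi_civita_ex1[OF assms]])

definition nabla_coord ::
  "('e::euclidean_space \<Rightarrow> 'e \<Rightarrow> 'e \<Rightarrow> real) \<Rightarrow> ('e \<Rightarrow> 'e \<Rightarrow> 'e) \<Rightarrow> 'e \<Rightarrow> 'e \<Rightarrow> 'e \<Rightarrow> 'e" where
  "nabla_coord h Q x u v =
     frechet_derivative (\<lambda>y. Q y v) (at x) u + christoffel h x u (Q x v) - Q x (christoffel h x u v)"

text \<open>The algebraic identities hold on a neighbourhood, so that they can be differentiated at
  \<open>x\<close>.\<close>

locale local_product_structure =
  fixes U :: "'e::euclidean_space set" and h :: "'e \<Rightarrow> 'e \<Rightarrow> 'e \<Rightarrow> real" and Q :: "'e \<Rightarrow> 'e \<Rightarrow> 'e" and x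
  assumes open_U: "open U" and x_U: "x \<in> U"
    and inner_product: "\<And>y. y \<in> U \<Longrightarrow> is_inner_product (h y)"
    and diff_h: "\<And>v w. (\<lambda>y. h y v w) differentiable (at x)"
    and linear_Q: "\<And>y. y \<in> U \<Longrightarrow> linear (Q y)"
    and involution: "\<And>y v. y \<in> U \<Longrightarrow> Q y (Q y v) = v"
    and orthogonal: "\<And>y u v. y \<in> U \<Longrightarrow> h y (Q y u) (Q y v) = h y u v"
    and diff_Q: "\<And>v. (\<lambda>y. Q y v) differentiable (at x)"
begin

abbreviation "\<Gamma> \<equiv> christoffel h x"
abbreviation "nab \<equiv> nabla_coord h Q x"

definition "DQ u v = frechet_derivative (\<lambda>y. Q y v) (at x) u"
definition "Dh u v w = frechet_derivative (\<lambda>y. h y v w) (at x) u"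

lemma bil: "y \<in> U \<Longrightarrow> bilinear (h y)" and sym: "y \<in> U \<Longrightarrow> h y v w = h y w v"
  using inner_product by (auto simp: is_inner_product_def)

lemmas hx = bilinear_ladd[OF bil[OF x_U]] bilinear_radd[OF bil[OF x_U]] bilinear_lmul[OF bil[OF x_U]]
  bilinear_rmul[OF bil[OF x_U]] bilinear_lsub[OF bil[OF x_U]] bilinear_rsub[OF bil[OF x_U]]
  bilinear_lneg[OF bil[OF x_U]] bilinear_rneg[OF bil[OF x_U]] bilinear_lzero[OF bil[OF x_U]]
  bilinear_rzero[OF bil[OF x_U]]

lemma DQ: "((\<lambda>y. Q y v) has_derivative (\<lambda>u. DQ u v)) (at x)"
  using diff_Q[of v] by (simp add: DQ_def frechet_derivative_works)

lemma Dh: "((\<lambda>y. h y v w) has_derivative (\<lambda>u. Dh u v w)) (at x)"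
  using diff_h[of v w] by (simp add: Dh_def frechet_derivative_works)

lemma levi_civita:
  "bilinear \<Gamma>" "\<Gamma> u v = \<Gamma> v u" "Dh u v w = h x (\<Gamma> u v) w + h x v (\<Gamma> u w)"
  using christoffel_levi_civita[OF open_U x_U inner_product diff_h]
  unfolding is_levi_civita_def Dh_def by auto

lemma h_Q: "y \<in> U \<Longrightarrow> h y (Q y v) w = h y v (Q y w)"
  using orthogonal[of y "Q y v" w] involution by simp

lemma DQ_linear: "linear (\<lambda>u. DQ u v)" "linear (DQ u)"
proof -
  show "linear (\<lambda>u. DQ u v)"
    using DQ has_derivative_linear by blast
  have "DQ u (v + w) = DQ u v + DQ u w" for v w
    using has_derivative_unique[OF DQ has_derivative_transform_within_open[OF has_derivative_add[OF DQ DQ] open_U x_U]]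
      linear_add[OF linear_Q] by (metis (no_types, lifting))
  moreover have "DQ u (r *\<^sub>R v) = r *\<^sub>R DQ u v" for r v
    using has_derivative_unique[OF DQ has_derivative_transform_within_open[OF has_derivative_scaleR_right[OF DQ] open_U x_U]]
      linear_cmul[OF linear_Q] by (metis (no_types, lifting))
  ultimately show "linear (DQ u)"
    by (rule linearI)
qed

lemma DQ_anticommutes: "DQ u (Q x v) + Q x (DQ u v) = 0"
proof -
  have "((\<lambda>y. Q y (Q y v)) has_derivative (\<lambda>u. DQ u (Q x v) + Q x (DQ u v))) (at x)"
    by (rule has_derivative_apply_linear[OF open_U x_U linear_Q DQ DQ])
  then have "((\<lambda>y. v) has_derivative (\<lambda>u. DQ u (Q x v) + Q x (DQ u v))) (at x)"
    by (rule has_derivative_transform_within_open[OF _ open_U x_U]) (simp add: involution)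
  from has_derivative_unique[OF this has_derivative_const] show ?thesis
    by (simp add: fun_eq_iff)
qed

lemma nab_DQ: "nab u v = DQ u v + \<Gamma> u (Q x v) - Q x (\<Gamma> u v)"
  by (simp add: nabla_coord_def DQ_def)

lemma nab_bilinear: "bilinear nab"
  unfolding bilinear_def nab_DQ
  by (intro conjI allI; rule linearI)
    (simp_all add: linear_add[OF DQ_linear(1)] linear_add[OF DQ_linear(2)] linear_cmul[OF DQ_linear(1)]
      linear_cmul[OF DQ_linear(2)] linear_add[OF linear_Q[OF x_U]] linear_cmul[OF linear_Q[OF x_U]]
      bilinear_ladd[OF levi_civita(1)] bilinear_radd[OF levi_civita(1)]
      bilinear_lmul[OF levi_civita(1)] bilinear_rmul[OF levi_civita(1)] algebra_simps)

text \<open>Differentiating the involution shows that \<open>DQ u\<close> exchanges the eigenspaces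
  of \<open>Q x\<close>, and the connection terms combine to minus the sum of
  \<open>\<Gamma> u v\<close> and its image under \<open>Q x\<close>.\<close>

lemma nab_plus:
  assumes "Q x v = - v"
  shows "Q x (nab u v) = nab u v"
  using DQ_anticommutes[of u v] assms involution[OF x_U]
  by (simp add: nab_DQ linear_add[OF linear_Q[OF x_U]] linear_diff[OF linear_Q[OF x_U]]
      linear_neg[OF linear_Q[OF x_U]] linear_neg[OF DQ_linear(2)] bilinear_rneg[OF levi_civita(1)])

lemma eigen_orthogonal: "Q x v = - v \<Longrightarrow> Q x w = w \<Longrightarrow> h x v w = 0"
  using orthogonal[OF x_U, of v w] by (simp add: hx)

text \<open>Only the restriction of the metric to the \<open>-1\<close>-eigendistribution, extended by zero,
  contributes to the symmetric part of \<open>(\<nabla>\<^bsub>v\<^esub> Q) v\<close>.\<close>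

lemma nab_diagonal:
  assumes v: "Q x v = - v" and w: "Q x w = w"
    and k: "\<And>y u v. y \<in> U \<Longrightarrow> h y u v - h y (Q y u) v = 2 * k y u v"
    and k': "\<And>u v. ((\<lambda>y. k y u v) has_derivative (\<lambda>w. k' w u v)) (at x)"
  shows "h x (nab v v) w = k' w v v - 2 * k' v v w"
proof -
  have dk: "2 * k' z u t = Dh z u t - (Dh z (Q x u) t + h x (DQ z u) t)" for z u t
  proof -
    have lin: "linear (\<lambda>a. h y a t)" if "y \<in> U" for y t
      using bil[OF that] by (simp add: bilinear_def)
    have "((\<lambda>y. h y (Q y u) t) has_derivative (\<lambda>z. Dh z (Q x u) t + h x (DQ z u) t)) (at x)"
      by (rule has_derivative_apply_linear[OF open_U x_U lin Dh DQ])
    from has_derivative_diff[OF Dh this]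
    have "((\<lambda>y. 2 * k y u t) has_derivative (\<lambda>z. Dh z u t - (Dh z (Q x u) t + h x (DQ z u) t))) (at x)"
      by (rule has_derivative_transform_within_open[OF _ open_U x_U]) (simp add: k)
    from has_derivative_unique[OF this has_derivative_mult_right[OF k']] show ?thesis
      by (simp add: fun_eq_iff)
  qed
  have neg: "Dh z (- v) t = - Dh z v t" for z t
    by (simp add: levi_civita(3) hx bilinear_rneg[OF levi_civita(1)])
  \<comment> \<open>As \<open>DQ w v\<close> is orthogonal to \<open>v\<close>, the derivative of
    \<open>Q\<close> contributes nothing to \<open>k' w v v\<close>.\<close>
  have "Q x (DQ w v) = DQ w v"
    using DQ_anticommutes[of w v] v by (simp add: linear_neg[OF DQ_linear(2)])
  then have 0: "h x (DQ w v) v = 0"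
    using eigen_orthogonal[OF v, of "DQ w v"] sym[OF x_U] by simp
  have "h x (nab v v) w = h x (DQ v v) w - 2 * h x (\<Gamma> v v) w"
    by (simp add: nab_DQ v hx bilinear_rneg[OF levi_civita(1)] h_Q[OF x_U] w)
  moreover have "2 * h x (\<Gamma> v v) w = 2 * Dh v v w - Dh w v v"
    by (simp add: levi_civita(3) levi_civita(2)[of w v] sym[OF x_U, of "\<Gamma> v w" v])
  moreover have "k' w v v = Dh w v v" "2 * k' v v w = 2 * Dh v v w - h x (DQ v v) w"
    using dk[of w v v] dk[of v v w] by (simp_all add: v neg 0)
  ultimately show ?thesis
    by simp
qed

text \<open>For \<open>z\<close> in the -1-eigenspace \<open>nab z z\<close> lies in the other one
  and is orthogonal to all of it, hence is zero; polarisation gives skew-symmetry.\<close>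

lemma nab_skew:
  assumes diag: "\<And>v w. Q x v = - v \<Longrightarrow> Q x w = w \<Longrightarrow> h x (nab v v) w = 0"
    and u: "Q x u = - u" and v: "Q x v = - v"
  shows "nab u v = - nab v u"
proof -
  have 0: "nab z z = 0" if "Q x z = - z" for z
    using diag[OF that nab_plus[OF that]] inner_product[OF x_U] by (metis is_inner_product_def less_irrefl)
  have "nab (u + v) (u + v) = 0"
    using u v by (intro 0) (simp add: linear_add[OF linear_Q[OF x_U]])
  then have "nab u v + nab v u = 0"
    using 0[OF u] 0[OF v] by (simp add: bilinear_ladd[OF nab_bilinear] bilinear_radd[OF nab_bilinear] add.commute)
  then show ?thesis
    by (simp add: eq_neg_iff_add_eq_0)
qed

end

section \<open>The twistor product in coordinates\<close>

lemmas has_derivative_matrix_mult = bounded_bilinear.FDERIV[OF bounded_bilinear_matrix_mult]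
lemmas has_derivative_matrix_vector = bounded_bilinear.FDERIV[OF bounded_bilinear_matrix_vector]
lemmas has_derivative_transpose = bounded_linear.has_derivative[OF bounded_linear_transpose]

lemmas has_derivative_divide_const = bounded_linear.has_derivative[OF bounded_linear_divide]

lemmas matrix_vector_simps =
  bounded_bilinear.add_left[OF bounded_bilinear_matrix_vector]
  bounded_bilinear.add_right[OF bounded_bilinear_matrix_vector]
  bounded_bilinear.diff_left[OF bounded_bilinear_matrix_vector]
  bounded_bilinear.diff_right[OF bounded_bilinear_matrix_vector]
  bounded_bilinear.minus_left[OF bounded_bilinear_matrix_vector]
  bounded_bilinear.minus_right[OF bounded_bilinear_matrix_vector]
  bounded_bilinear.scaleR_left[OF bounded_bilinear_matrix_vector]
  bounded_bilinear.scaleR_right[OF bounded_bilinear_matrix_vector]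
  bounded_bilinear.zero_left[OF bounded_bilinear_matrix_vector]
  bounded_bilinear.zero_right[OF bounded_bilinear_matrix_vector]

text \<open>A metric \<open>G\<close> and a metric connection \<open>\<gamma>\<close>, pulled back along a map \<open>q\<close> to the base with
  differential \<open>L\<close>; \<open>L2\<close> and \<open>\<gamma>2\<close> are derivatives of \<open>L\<close> and \<open>\<gamma>\<close>. The axiom on \<open>\<gamma>2\<close>
  holds because \<open>\<gamma>\<close> is the composition of \<open>L\<close> with a tensor depending on \<open>q\<close> only.\<close>

locale pulled_back_connection =
  fixes U :: "'f::euclidean_space set"
    and L :: "'f \<Rightarrow> 'f \<Rightarrow> real ^ 4" and L2 :: "'f \<Rightarrow> 'f \<Rightarrow> 'f \<Rightarrow> real ^ 4"
    and G :: "'f \<Rightarrow> real ^ 4 ^ 4"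
    and \<gamma> :: "'f \<Rightarrow> 'f \<Rightarrow> real ^ 4 ^ 4" and \<gamma>2 :: "'f \<Rightarrow> 'f \<Rightarrow> 'f \<Rightarrow> real ^ 4 ^ 4"
  assumes open_U: "open U"
    and metric: "\<And>y. y \<in> U \<Longrightarrow> metric_matrix (G y)"
    and linear_L: "\<And>y. y \<in> U \<Longrightarrow> linear (L y)"
    and linear_\<gamma>: "\<And>y. y \<in> U \<Longrightarrow> linear (\<gamma> y)"
    and L_deriv: "\<And>y u. y \<in> U \<Longrightarrow> ((\<lambda>z. L z u) has_derivative (\<lambda>v. L2 y v u)) (at y)"
    and L2_sym: "\<And>y u v. y \<in> U \<Longrightarrow> L2 y u v = L2 y v u"
    and G_deriv: "\<And>y. y \<in> U \<Longrightarrow>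
      (G has_derivative (\<lambda>u. transpose (\<gamma> y u) ** G y + G y ** \<gamma> y u)) (at y)"
    and \<gamma>_deriv: "\<And>y u. y \<in> U \<Longrightarrow> ((\<lambda>z. \<gamma> z u) has_derivative (\<lambda>v. \<gamma>2 y v u)) (at y)"
    and torsion_free: "\<And>y u v. y \<in> U \<Longrightarrow> \<gamma> y u *v L y v = \<gamma> y v *v L y u"
    and \<gamma>_vertical: "\<And>y v. y \<in> U \<Longrightarrow> L y v = 0 \<Longrightarrow> \<gamma> y v = 0"
    and \<gamma>2_vertical: "\<And>y v w. y \<in> U \<Longrightarrow> L y v = 0 \<Longrightarrow> \<gamma>2 y w v = \<gamma>2 y v w"
begin

definition "cov y a a' u = a' u + \<gamma> y u ** a + a ** transpose (\<gamma> y u)"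

text \<open>The metric is parallel: adjointness moves the connection terms in the derivative of
  \<open>G\<close> onto the two bivectors.\<close>

lemma ip_deriv:
  assumes y: "y \<in> U" and a: "(a has_derivative a') (at y)" and b: "(b has_derivative b') (at y)"
  shows "((\<lambda>z. ip (G z) (a z) (b z)) has_derivative
    (\<lambda>u. ip (G y) (cov y (a y) a' u) (b y) + ip (G y) (a y) (cov y (b y) b' u))) (at y)"
proof -
  have "((\<lambda>z. ip (G z) (a z) (b z)) has_derivative (\<lambda>u. (a y \<bullet> (G y ** b y ** (transpose (\<gamma> y u) ** G y + G y ** \<gamma> y u)
      + (G y ** b' u + (transpose (\<gamma> y u) ** G y + G y ** \<gamma> y u) ** b y) ** G y) + a' u \<bullet> (G y ** b y ** G y)) / 4)) (at y)"
    unfolding ip_def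
    by (intro has_derivative_divide_const has_derivative_inner has_derivative_matrix_mult G_deriv[OF y] a b)
  then show ?thesis
  proof (rule has_derivative_eq_rhs)
    show "(\<lambda>u. (a y \<bullet> (G y ** b y ** (transpose (\<gamma> y u) ** G y + G y ** \<gamma> y u)
      + (G y ** b' u + (transpose (\<gamma> y u) ** G y + G y ** \<gamma> y u) ** b y) ** G y) + a' u \<bullet> (G y ** b y ** G y)) / 4)
      = (\<lambda>u. ip (G y) (cov y (a y) a' u) (b y) + ip (G y) (a y) (cov y (b y) b' u))"
    proof
      fix u
      have "a y \<bullet> (transpose (\<gamma> y u) ** (G y ** b y ** G y)) = (\<gamma> y u ** a y) \<bullet> (G y ** b y ** G y)"
        "a y \<bullet> ((G y ** b y ** G y) ** \<gamma> y u) = (a y ** transpose (\<gamma> y u)) \<bullet> (G y ** b y ** G y)"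
        by (subst inner_mult_left inner_mult_right; simp)+
      then show "(a y \<bullet> (G y ** b y ** (transpose (\<gamma> y u) ** G y + G y ** \<gamma> y u)
      + (G y ** b' u + (transpose (\<gamma> y u) ** G y + G y ** \<gamma> y u) ** b y) ** G y) + a' u \<bullet> (G y ** b y ** G y)) / 4
      = ip (G y) (cov y (a y) a' u) (b y) + ip (G y) (a y) (cov y (b y) b' u)"
        by (simp add: ip_def cov_def matrix_mult_simps inner_add_left inner_add_right matrix_mul_assoc field_simps)
    qed
  qed
qed

end

text \<open>In the application \<open>a\<close> is a fibre coordinate of the twistor product, seen
  as a section of the pulled back bundle.\<close>

locale selfdual_section = pulled_back_connection +
  fixes r :: "'a \<Rightarrow> real" and a :: "'a \<Rightarrow> real ^ 4 ^ 4" and a' :: "'a \<Rightarrow> 'a \<Rightarrow> real ^ 4 ^ 4"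
    and a2 :: "'a \<Rightarrow> 'a \<Rightarrow> 'a \<Rightarrow> real ^ 4 ^ 4"
  assumes r_nz: "\<And>y. y \<in> U \<Longrightarrow> r y \<noteq> 0"
    and a_selfdual: "\<And>y. y \<in> U \<Longrightarrow> selfdual (G y) (r y) (a y)"
    and a_unit: "\<And>y. y \<in> U \<Longrightarrow> ip (G y) (a y) (a y) = 1"
    and a_deriv: "\<And>y. y \<in> U \<Longrightarrow> (a has_derivative a' y) (at y)"
    and a'_deriv: "\<And>y u. y \<in> U \<Longrightarrow> ((\<lambda>z. a' z u) has_derivative (\<lambda>v. a2 y v u)) (at y)"
    and a2_sym: "\<And>y u v. y \<in> U \<Longrightarrow> a2 y u v = a2 y v u"
begin

text \<open>The covariant derivative of the section. For the tautological sections of the twistor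
  product it is a vertical component of the tangent vector \<open>u\<close>, written in the fixed
  chart.\<close>

definition "om y u = a' y u + \<gamma> y u ** a y + a y ** transpose (\<gamma> y u)"

definition "om2 y v u = a2 y v u + (\<gamma> y u ** a' y v + \<gamma>2 y v u ** a y)
  + (a y ** transpose (\<gamma>2 y v u) + a' y v ** transpose (\<gamma> y u))"

lemma linear_a': "y \<in> U \<Longrightarrow> linear (a' y)"
  using a_deriv has_derivative_linear by blast

lemma linear_om: "y \<in> U \<Longrightarrow> linear (om y)"
  unfolding om_def using linear_a' linear_\<gamma>
  by (intro linearI) (simp_all add: linear_add linear_cmul matrix_mult_simps transpose_simps algebra_simps)

lemma om_deriv: "y \<in> U \<Longrightarrow> ((\<lambda>z. om z u) has_derivative (\<lambda>v. om2 y v u)) (at y)"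
  unfolding om_def om2_def
  by (intro has_derivative_add has_derivative_matrix_mult has_derivative_transpose a'_deriv a_deriv \<gamma>_deriv)

lemma om_selfdual:
  assumes y: "y \<in> U"
  shows "selfdual (G y) (r y) (om y u)" "ip (G y) (om y u) (a y) = 0"
proof -
  let ?G' = "\<lambda>u. transpose (\<gamma> y u) ** G y + G y ** \<gamma> y u"
  have skew: "transpose (a z) = - a z" and dual: "bdual (G z ** a z ** G z) = r z *\<^sub>R a z" if "z \<in> U" for z
    using a_selfdual[OF that] by (auto simp: selfdual_def)
  have lin: "bounded_linear bdual"
    using linear_bdual by (simp add: linear_conv_bounded_linear)
  have N: "((\<lambda>z. G z ** a z ** G z) has_derivative
      (\<lambda>u. G y ** a y ** ?G' u + (G y ** a' y u + ?G' u ** a y) ** G y)) (at y)" (is "(_ has_derivative ?N') _")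
    by (intro has_derivative_matrix_mult G_deriv[OF y] a_deriv[OF y])
  have N': "?N' u = ?G' u ** a y ** G y + G y ** a' y u ** G y + G y ** a y ** ?G' u" for u
    by (simp add: matrix_mult_simps)
  have dN: "((\<lambda>z. bdual (G z ** a z ** G z)) has_derivative (\<lambda>u. bdual (?N' u))) (at y)"
    by (rule bounded_linear.has_derivative[OF lin N])
  \<comment> \<open>Differentiability of \<open>r\<close> is not among the assumptions and is
    recovered here: a unit section pairs with \<open>G z ** a z ** G z\<close> to 4.\<close>
  have r_eq: "r z = (bdual (G z ** a z ** G z) \<bullet> (G z ** a z ** G z)) / 4" if "z \<in> U" for z
    using a_unit[OF that] unfolding dual[OF that] by (simp add: ip_def)
  have "(\<lambda>z. (bdual (G z ** a z ** G z) \<bullet> (G z ** a z ** G z)) / 4) differentiable (at y)"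
    using has_derivative_divide_const[OF has_derivative_inner[OF dN N]] unfolding differentiable_def by blast
  then have "r differentiable (at y)"
    by (rule differentiable_transform_open[OF _ open_U y]) (simp add: r_eq)
  then obtain r' where r': "(r has_derivative r') (at y)"
    by (auto simp: differentiable_def)
  have "((\<lambda>z. bdual (G z ** a z ** G z)) has_derivative (\<lambda>u. r y *\<^sub>R a' y u + r' u *\<^sub>R a y)) (at y)"
    by (rule has_derivative_transform_within_open[OF has_derivative_scaleR[OF r' a_deriv[OF y]] open_U y])
      (simp add: dual)
  from has_derivative_unique[OF dN this]
  have eq1: "bdual (?N' u) = r' u *\<^sub>R a y + r y *\<^sub>R a' y u"
    by (simp add: fun_eq_iff add.commute)
  have "((\<lambda>z. (a z \<bullet> (G z ** a z ** G z)) / 4) has_derivative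
      (\<lambda>u. (a y \<bullet> ?N' u + a' y u \<bullet> (G y ** a y ** G y)) / 4)) (at y)"
    by (intro has_derivative_divide_const has_derivative_inner N a_deriv[OF y])
  then have "((\<lambda>z. 1) has_derivative (\<lambda>u. (a y \<bullet> ?N' u + a' y u \<bullet> (G y ** a y ** G y)) / 4)) (at y)"
    by (rule has_derivative_transform_within_open[OF _ open_U y]) (use a_unit in \<open>simp add: ip_def\<close>)
  from has_derivative_unique[OF this has_derivative_const]
  have eq2: "a' y u \<bullet> (G y ** a y ** G y) + a y \<bullet> ?N' u = 0"
    by (auto simp: fun_eq_iff add.commute)
  have "((\<lambda>z. - a z) has_derivative (\<lambda>u. transpose (a' y u))) (at y)"
    by (rule has_derivative_transform_within_open[OF has_derivative_transpose[OF a_deriv[OF y]] open_U y])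
      (simp add: skew)
  from has_derivative_unique[OF this has_derivative_minus[OF a_deriv[OF y]]]
  have skew': "transpose (a' y u) = - a' y u"
    by (simp add: fun_eq_iff)
  show "selfdual (G y) (r y) (om y u)" "ip (G y) (om y u) (a y) = 0"
    using metric_matrix.selfdual_derivative[OF metric[OF y] a_selfdual[OF y] a_unit[OF y] r_nz[OF y] skew' refl, of "\<gamma> y u" "r' u"]
      eq1 eq2 unfolding N' om_def by auto
qed

definition "T y u v = ip (G y) (om y u) (om y v)"

definition "T' y w u v = ip (G y) (cov y (om y u) (\<lambda>w. om2 y w u) w) (om y v)
  + ip (G y) (om y u) (cov y (om y v) (\<lambda>w. om2 y w v) w)"

lemma T_deriv: "y \<in> U \<Longrightarrow> ((\<lambda>z. T z u v) has_derivative (\<lambda>w. T' y w u v)) (at y)"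
  unfolding T_def T'_def by (intro ip_deriv om_deriv)

text \<open>This is the contribution of the fibre metric \<open>T\<close> to the expression in
  \<open>nab_diagonal\<close>. The covariant derivatives of \<open>om y v\<close> along
  \<open>w\<close> and of \<open>om y w\<close> along \<open>v\<close> differ by a curvature term,
  which vanishes because \<open>v\<close> is vertical (\<open>\<gamma>2_vertical\<close>).\<close>

lemma T_vertical:
  assumes y: "y \<in> U" and v: "L y v = 0" and w: "om y w = 0"
  shows "T' y w v v - 2 * T' y v v w = 0"
proof -
  have \<gamma>v: "\<gamma> y v = 0"
    by (rule \<gamma>_vertical[OF y v])
  have om_v: "om y v = a' y v"
    by (simp add: om_def \<gamma>v matrix_mult_simps transpose_simps(4)[of 0 0, simplified])
  have "cov y (om y w) (\<lambda>z. om2 y z w) v = om2 y v w"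
    by (simp add: cov_def w matrix_mult_simps)
  moreover have "cov y (om y v) (\<lambda>z. om2 y z v) w = om2 y v w"
    by (simp add: cov_def om2_def om_v \<gamma>v \<gamma>2_vertical[OF y v] a2_sym[OF y, of w v] matrix_mult_simps
        transpose_simps(4)[of 0 0, simplified])
  ultimately show ?thesis
    by (simp add: T'_def w ip_linear metric_matrix.ip_sym[OF metric[OF y], of "om2 y v w"])
qed

end

section \<open>Metric and almost product structure in a chart of the twistor product\<close>

lemma neg_eq_self: "- V = V \<longleftrightarrow> V = 0" for V :: "'a::real_vector"
proof
  assume "- V = V"
  then have "V + V = 0"
    by (metis add.right_inverse)
  then have "2 *\<^sub>R V = 0"
    by (simp add: scaleR_2)
  then show "V = 0"
    by simp
qed simp

text \<open>The signs \<epsilon>1 and \<epsilon>2 are those with which the almost product structure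
  acts on the two vertical summands, so one model covers all four structures. The assumption
  \<open>inj\<close> says that the inverse of the chart is an immersion.\<close>

locale twistor_model = pulled_back_connection U L L2 G \<gamma> \<gamma>2 +
    plus: selfdual_section U L L2 G \<gamma> \<gamma>2 r \<alpha> \<alpha>' \<alpha>2 +
    minus: selfdual_section U L L2 G \<gamma> \<gamma>2 "\<lambda>y. - r y" \<beta> \<beta>' \<beta>2
  for U :: "(real ^ 8) set" and L L2 G \<gamma> \<gamma>2 r \<alpha> \<alpha>' \<alpha>2 \<beta> \<beta>' \<beta>2 +
  fixes t1 t2 \<epsilon>1 \<epsilon>2 :: real
  assumes t_pos: "t1 > 0" "t2 > 0" and \<epsilon>: "\<epsilon>1 = 1 \<or> \<epsilon>1 = - 1" "\<epsilon>2 = 1 \<or> \<epsilon>2 = - 1"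
    and inj: "\<And>y u. y \<in> U \<Longrightarrow> L y u = 0 \<Longrightarrow> \<alpha>' y u = 0 \<Longrightarrow> \<beta>' y u = 0 \<Longrightarrow> u = 0"
begin

text \<open>\<open>S\<close> is the matrix of \<open>K_a K_b\<close>, the signs in
  \<open>Kend_eq\<close> cancelling; \<open>P\<close> is the associated symmetric form, and
  \<open>M\<close> is the base metric restricted to the -1-eigenspace of \<open>S\<close> and
  extended by zero.\<close>

definition "S y = \<alpha> y ** G y ** \<beta> y ** G y"
definition "P y = G y ** \<alpha> y ** G y ** \<beta> y ** G y"
definition "M y = (1/2) *\<^sub>R (G y - P y)"

lemma P_eq: "P y = G y ** S y"
  by (simp add: P_def S_def matrix_mul_assoc)

lemma S_involution: "y \<in> U \<Longrightarrow> S y ** S y = mat 1"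
  and P_symmetric: "y \<in> U \<Longrightarrow> transpose (P y) = P y"
  using metric_matrix.product_involution[OF metric plus.a_selfdual plus.a_unit minus.a_selfdual minus.a_unit plus.r_nz]
    metric_matrix.product_symmetric[OF metric plus.a_selfdual plus.a_unit minus.a_selfdual minus.a_unit plus.r_nz]
  by (auto simp: S_def P_def)

lemma S_S: "y \<in> U \<Longrightarrow> S y *v (S y *v X) = X"
  by (simp add: matrix_vector_mul_assoc S_involution)

lemma M_sym: "y \<in> U \<Longrightarrow> X \<bullet> (M y *v Y) = (M y *v X) \<bullet> Y"
proof -
  assume y: "y \<in> U"
  have "transpose (M y) = M y"
    using P_symmetric[OF y] metric_matrix.sym[OF metric[OF y]] by (simp add: M_def transpose_simps)
  then show ?thesis
    by (metis inner_transpose_mult)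
qed

lemma M_kernel: "S y *v X = X \<Longrightarrow> M y *v X = 0"
  by (simp add: M_def P_eq matrix_vector_simps flip: matrix_vector_mul_assoc)

definition "target y = (UNIV :: (real ^ 4) set) \<times> {V. selfdual (G y) (r y) V \<and> ip (G y) V (\<alpha> y) = 0}
  \<times> {W. selfdual (G y) (- r y) W \<and> ip (G y) W (\<beta> y) = 0}"

definition "frame y u = (L y u, plus.om y u, minus.om y u)"

lemma linear_frame: "y \<in> U \<Longrightarrow> linear (frame y)"
  unfolding frame_def using linear_L plus.linear_om minus.linear_om
  by (intro linearI) (simp_all add: linear_add linear_cmul)

lemma inj_frame: "y \<in> U \<Longrightarrow> frame y u = 0 \<Longrightarrow> u = 0"
  using inj[of y u] \<gamma>_vertical[of y u]
  by (simp add: frame_def plus.om_def minus.om_def matrix_mult_simps zero_prod_def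
      transpose_simps(4)[of 0 0, simplified])

lemma dim_fibres:
  assumes y: "y \<in> U"
  shows "subspace {V. selfdual (G y) (r y) V \<and> ip (G y) V (\<alpha> y) = 0}"
    "subspace {W. selfdual (G y) (- r y) W \<and> ip (G y) W (\<beta> y) = 0}"
    "dim {V. selfdual (G y) (r y) V \<and> ip (G y) V (\<alpha> y) = 0} \<le> 2"
    "dim {W. selfdual (G y) (- r y) W \<and> ip (G y) W (\<beta> y) = 0} \<le> 2"
proof -
  have "subspace {V. selfdual (G y) s V \<and> ip (G y) V c = 0}" for s c
    using subspace_selfdual[of "G y" s] by (auto simp: subspace_def ip_linear)
  then show "subspace {V. selfdual (G y) (r y) V \<and> ip (G y) V (\<alpha> y) = 0}"
    "subspace {W. selfdual (G y) (- r y) W \<and> ip (G y) W (\<beta> y) = 0}"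
    by blast+
qed (rule metric_matrix.dim_selfdual_perp[OF metric[OF y]];
    use y plus.a_selfdual plus.a_unit minus.a_selfdual minus.a_unit plus.r_nz in simp)+

text \<open>Dimension count: an injective map from dimension 8 into a space of dimension at most 4 +
  2 + 2 forces equality everywhere.\<close>

lemma range_frame:
  assumes y: "y \<in> U"
  shows "range (frame y) = target y"
    and "dim {V. selfdual (G y) (r y) V \<and> ip (G y) V (\<alpha> y) = 0} = 2"
    and "dim {W. selfdual (G y) (- r y) W \<and> ip (G y) W (\<beta> y) = 0} = 2"
proof -
  let ?V = "{V. selfdual (G y) (r y) V \<and> ip (G y) V (\<alpha> y) = 0}"
  let ?W = "{W. selfdual (G y) (- r y) W \<and> ip (G y) W (\<beta> y) = 0}"
  note d = dim_fibres[OF y]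
  have sub: "range (frame y) \<subseteq> target y"
    using plus.om_selfdual[OF y] minus.om_selfdual[OF y] by (auto simp: frame_def target_def)
  have "inj (frame y)"
    using linear_injective_0[OF linear_frame[OF y]] inj_frame[OF y] by blast
  then have r: "dim (range (frame y)) = 8"
    using dim_image_eq[OF linear_frame[OF y], of UNIV] by simp
  have s: "subspace (target y)"
    unfolding target_def using d by (intro subspace_Times) auto
  have t: "dim (target y) = 4 + (dim ?V + dim ?W)"
    unfolding target_def
    by (simp add: dim_Times[OF subspace_UNIV subspace_Times[OF d(1,2)]] dim_Times[OF d(1,2)])
  have "dim (range (frame y)) \<le> dim (target y)"
    by (rule dim_subset[OF sub])
  then show "dim ?V = 2" "dim ?W = 2"
    using r t d by linarith+
  then have "dim (target y) \<le> dim (range (frame y))"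
    using r t by simp
  then show "range (frame y) = target y"
    using sub s linear_subspace_image[OF linear_frame[OF y], of UNIV]
    by (intro subspace_dim_equal) auto
qed

lemma frame_surj:
  assumes "y \<in> U" "selfdual (G y) (r y) V" "ip (G y) V (\<alpha> y) = 0"
    "selfdual (G y) (- r y) W" "ip (G y) W (\<beta> y) = 0"
  shows "\<exists>u. L y u = X \<and> plus.om y u = V \<and> minus.om y u = W"
proof -
  have "(X, V, W) \<in> range (frame y)"
    using assms by (simp add: range_frame(1) target_def)
  then show ?thesis
    by (auto simp: frame_def)
qed

lemma frame_inj:
  assumes y: "y \<in> U" and "L y u = L y v" "plus.om y u = plus.om y v" "minus.om y u = minus.om y v"
  shows "u = v"
proof -
  have "frame y (u - v) = 0"
    using assms linear_diff[OF linear_frame[OF y], of u v] by (simp add: frame_def)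
  then show ?thesis
    using inj_frame[OF y] by fastforce
qed

definition "h y u v = L y u \<bullet> (G y *v L y v) + t1 * plus.T y u v + t2 * minus.T y u v"

text \<open>Prescribed through the components with respect to \<open>frame\<close>. Its
  differentiability is obtained later from the explicit form of \<open>h y (Q y u) v\<close>,
  without an inverse of the frame.\<close>

definition "Q y u = (THE v. L y v = S y *v L y u \<and> plus.om y v = \<epsilon>1 *\<^sub>R plus.om y u
  \<and> minus.om y v = \<epsilon>2 *\<^sub>R minus.om y u)"

lemma Q:
  assumes y: "y \<in> U"
  shows "L y (Q y u) = S y *v L y u" "plus.om y (Q y u) = \<epsilon>1 *\<^sub>R plus.om y u"
    "minus.om y (Q y u) = \<epsilon>2 *\<^sub>R minus.om y u"
proof -
  have "selfdual (G y) s (c *\<^sub>R V)" if "selfdual (G y) s V" for s c V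
    using subspace_scale[OF subspace_selfdual] that by blast
  then have "\<exists>v. L y v = S y *v L y u \<and> plus.om y v = \<epsilon>1 *\<^sub>R plus.om y u \<and> minus.om y v = \<epsilon>2 *\<^sub>R minus.om y u"
    using plus.om_selfdual[OF y] minus.om_selfdual[OF y] by (intro frame_surj[OF y]) (auto simp: ip_linear)
  then have "\<exists>!v. L y v = S y *v L y u \<and> plus.om y v = \<epsilon>1 *\<^sub>R plus.om y u \<and> minus.om y v = \<epsilon>2 *\<^sub>R minus.om y u"
    using frame_inj[OF y] by (metis (full_types))
  from theI'[OF this] show "L y (Q y u) = S y *v L y u" "plus.om y (Q y u) = \<epsilon>1 *\<^sub>R plus.om y u"
    "minus.om y (Q y u) = \<epsilon>2 *\<^sub>R minus.om y u"
    unfolding Q_def by auto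
qed

lemma Q_eqI:
  "y \<in> U \<Longrightarrow> L y v = S y *v L y u \<Longrightarrow> plus.om y v = \<epsilon>1 *\<^sub>R plus.om y u \<Longrightarrow> minus.om y v = \<epsilon>2 *\<^sub>R minus.om y u
    \<Longrightarrow> Q y u = v"
  using Q[of y u] by (intro frame_inj) auto

lemmas L_linear = linear_add[OF linear_L] linear_cmul[OF linear_L] linear_neg[OF linear_L]
lemmas om_linear = linear_add[OF plus.linear_om] linear_cmul[OF plus.linear_om] linear_neg[OF plus.linear_om]
  linear_add[OF minus.linear_om] linear_cmul[OF minus.linear_om] linear_neg[OF minus.linear_om]

lemma linear_Q: "y \<in> U \<Longrightarrow> linear (Q y)"
  by (rule linearI; rule Q_eqI)
    (simp_all add: L_linear om_linear Q matrix_vector_simps scaleR_add_right)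

lemma \<epsilon>_square: "\<epsilon>1 * \<epsilon>1 = 1" "\<epsilon>2 * \<epsilon>2 = 1" "\<epsilon>1 * (\<epsilon>1 * c) = c" "\<epsilon>2 * (\<epsilon>2 * c) = c"
  using \<epsilon> by auto

lemma Q_Q: "y \<in> U \<Longrightarrow> Q y (Q y u) = u"
  by (rule Q_eqI) (simp_all add: Q S_S \<epsilon>_square)

lemma bilinear_h: "y \<in> U \<Longrightarrow> bilinear (h y)"
  unfolding bilinear_def h_def plus.T_def minus.T_def
  by (intro conjI allI; rule linearI)
    (simp_all add: L_linear om_linear matrix_vector_simps ip_linear inner_add_left inner_add_right algebra_simps)

lemma ip_nonneg: "y \<in> U \<Longrightarrow> selfdual (G y) s V \<Longrightarrow> s \<noteq> 0 \<Longrightarrow> ip (G y) V V \<ge> 0"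
  using metric_matrix.selfdual_pos[OF metric] by (cases "V = 0") (auto simp: ip_linear intro: less_imp_le)

lemma inner_product_h:
  assumes y: "y \<in> U"
  shows "is_inner_product (h y)"
  unfolding is_inner_product_def
proof (intro conjI allI impI)
  note m = metric[OF y]
  show "bilinear (h y)"
    by (rule bilinear_h[OF y])
  show "h y v w = h y w v" for v w
    using metric_matrix.symmetric_form[OF m] metric_matrix.ip_sym[OF m] by (simp add: h_def plus.T_def minus.T_def)
  show "h y v v > 0" if "v \<noteq> 0" for v
  proof -
    have r: "r y \<noteq> 0" "- r y \<noteq> 0"
      using plus.r_nz[OF y] by auto
    have nn: "L y v \<bullet> (G y *v L y v) \<ge> 0" "t1 * plus.T y v v \<ge> 0" "t2 * minus.T y v v \<ge> 0"
      using metric_matrix.nonneg[OF m] ip_nonneg[OF y plus.om_selfdual(1)[OF y] r(1)] ip_nonneg[OF y minus.om_selfdual(1)[OF y] r(2)] t_pos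
      by (simp_all add: plus.T_def minus.T_def)
    have "frame y v \<noteq> 0"
      using inj_frame[OF y] that by blast
    then consider "L y v \<noteq> 0" | "plus.om y v \<noteq> 0" | "minus.om y v \<noteq> 0"
      by (auto simp: frame_def zero_prod_def)
    then have "L y v \<bullet> (G y *v L y v) > 0 \<or> t1 * plus.T y v v > 0 \<or> t2 * minus.T y v v > 0"
    proof cases
      case 1 then show ?thesis using metric_matrix.pos[OF m] by blast
    next
      case 2 then show ?thesis
        using metric_matrix.selfdual_pos[OF m plus.om_selfdual(1)[OF y] r(1)] t_pos by (simp add: plus.T_def)
    next
      case 3 then show ?thesis
        using metric_matrix.selfdual_pos[OF m minus.om_selfdual(1)[OF y] r(2)] t_pos by (simp add: minus.T_def)
    qed
    then show ?thesis
      using nn by (auto simp: h_def)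
  qed
qed

lemma form_Q:
  assumes y: "y \<in> U"
  shows "(L y (Q y u)) \<bullet> (G y *v L y v) = L y u \<bullet> (P y *v L y v)"
proof -
  have "(L y (Q y u)) \<bullet> (G y *v L y v) = (G y *v (S y *v L y u)) \<bullet> L y v"
    by (metis Q(1)[OF y] metric_matrix.sym[OF metric[OF y]] inner_transpose_mult)
  also have "\<dots> = (P y *v L y u) \<bullet> L y v"
    by (simp add: P_eq matrix_vector_mul_assoc)
  finally show ?thesis
    by (metis P_symmetric[OF y] inner_transpose_mult)
qed

lemma h_Q_left: "y \<in> U \<Longrightarrow>
  h y (Q y u) v = L y u \<bullet> (P y *v L y v) + \<epsilon>1 * t1 * plus.T y u v + \<epsilon>2 * t2 * minus.T y u v"
  unfolding h_def form_Q by (simp add: plus.T_def minus.T_def Q ip_linear)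

lemma h_orthogonal:
  assumes y: "y \<in> U"
  shows "h y (Q y u) (Q y v) = h y u v"
proof -
  have "L y u \<bullet> (P y *v L y (Q y v)) = L y (Q y u) \<bullet> (G y *v L y (Q y v))"
    using form_Q[OF y, of u "Q y v"] by simp
  have "P y *v L y (Q y v) = G y *v L y v"
    by (simp add: Q[OF y] P_eq S_S[OF y] flip: matrix_vector_mul_assoc)
  then show ?thesis
    by (simp add: h_Q_left[OF y]) (simp add: h_def plus.T_def minus.T_def Q[OF y] ip_linear \<epsilon>_square mult_ac)
qed

lemma L_form_deriv:
  assumes y: "y \<in> U" and N: "(N has_derivative N') (at y)"
  shows "((\<lambda>z. L z u \<bullet> (N z *v L z v)) has_derivative
    (\<lambda>w. L y u \<bullet> (N y *v L2 y w v + N' w *v L y v) + L2 y w u \<bullet> (N y *v L y v))) (at y)"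
  by (intro has_derivative_inner has_derivative_matrix_vector L_deriv[OF y] N)

text \<open>The covariant derivative of \<open>P\<close>: the metric is parallel, so only the two
  sections vary.\<close>

definition "E y w = G y ** plus.om y w ** G y ** \<beta> y ** G y + G y ** \<alpha> y ** G y ** minus.om y w ** G y"

lemma P_deriv:
  assumes y: "y \<in> U"
  shows "(P has_derivative (\<lambda>w. transpose (\<gamma> y w) ** P y + P y ** \<gamma> y w + E y w)) (at y)"
proof -
  let ?G' = "\<lambda>w. transpose (\<gamma> y w) ** G y + G y ** \<gamma> y w"
  have "(P has_derivative (\<lambda>w. (G y ** \<alpha> y ** G y ** \<beta> y) ** ?G' w + ((G y ** \<alpha> y ** G y) ** \<beta>' y w
      + ((G y ** \<alpha> y) ** ?G' w + (G y ** \<alpha>' y w + ?G' w ** \<alpha> y) ** G y) ** \<beta> y) ** G y)) (at y)"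
    unfolding P_def
    by (intro has_derivative_matrix_mult G_deriv[OF y] plus.a_deriv[OF y] minus.a_deriv[OF y])
  then show ?thesis
    by (rule has_derivative_eq_rhs)
      (simp add: fun_eq_iff P_def E_def plus.om_def minus.om_def matrix_mult_simps matrix_mul_assoc)
qed

definition "M' y w = transpose (\<gamma> y w) ** M y + M y ** \<gamma> y w - (1/2) *\<^sub>R E y w"

lemma M_deriv:
  assumes y: "y \<in> U"
  shows "(M has_derivative M' y) (at y)"
proof -
  have "(M has_derivative (\<lambda>w. (1/2) *\<^sub>R ((transpose (\<gamma> y w) ** G y + G y ** \<gamma> y w)
      - (transpose (\<gamma> y w) ** P y + P y ** \<gamma> y w + E y w)))) (at y)"
    unfolding M_def by (intro has_derivative_scaleR_right has_derivative_diff G_deriv[OF y] P_deriv[OF y])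
  then show ?thesis
    by (rule has_derivative_eq_rhs)
      (simp add: fun_eq_iff M'_def M_def matrix_mult_simps algebra_simps)
qed

definition "k0' y w u v = L y u \<bullet> (M y *v L2 y w v + M' y w *v L y v) + L2 y w u \<bullet> (M y *v L y v)"

text \<open>The form required by \<open>nab_diagonal\<close>. The factors
  \<open>(1 - \<epsilon>1) / 2\<close> and \<open>(1 - \<epsilon>2) / 2\<close> are 1 or 0 according
  to whether the vertical summand lies in the -1-eigendistribution.\<close>

definition "k y u v = L y u \<bullet> (M y *v L y v) + ((1 - \<epsilon>1) / 2 * t1) * plus.T y u v + ((1 - \<epsilon>2) / 2 * t2) * minus.T y u v"

definition "k' y w u v = k0' y w u v + ((1 - \<epsilon>1) / 2 * t1) * plus.T' y w u v + ((1 - \<epsilon>2) / 2 * t2) * minus.T' y w u v"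

lemma k_deriv: "y \<in> U \<Longrightarrow> ((\<lambda>z. k z u v) has_derivative (\<lambda>w. k' y w u v)) (at y)"
  unfolding k_def k'_def k0'_def
  by (intro has_derivative_add has_derivative_mult_right L_form_deriv M_deriv plus.T_deriv minus.T_deriv)

lemma k_eq: "y \<in> U \<Longrightarrow> h y u v - h y (Q y u) v = 2 * k y u v"
  by (simp add: h_Q_left) (simp add: h_def k_def M_def matrix_vector_simps inner_diff_right field_simps)

lemma product_structure:
  assumes x: "x \<in> U"
  shows "local_product_structure U h Q x"
proof (rule local_product_structure.intro)
  show dh: "(\<lambda>y. h y v w) differentiable (at x)" for v w
    unfolding h_def
    by (intro differentiable_add differentiable_mult differentiable_const differentiableI)
      (rule L_form_deriv[OF x G_deriv[OF x]] plus.T_deriv[OF x] minus.T_deriv[OF x])+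
  show "(\<lambda>y. Q y v) differentiable (at x)" for v
  \<comment> \<open>\<open>Q y v\<close> solves a linear system whose matrix is given by
    \<open>h\<close> and whose right-hand side is differentiable.\<close>
  proof (rule differentiable_represented[OF open_U x inner_product_h dh])
    show "(\<lambda>y. L y v \<bullet> (P y *v L y w) + \<epsilon>1 * t1 * plus.T y v w + \<epsilon>2 * t2 * minus.T y v w) differentiable (at x)" for w
      by (intro differentiable_add differentiable_mult differentiable_const differentiableI)
        (rule L_form_deriv[OF x P_deriv[OF x]] plus.T_deriv[OF x] minus.T_deriv[OF x])+
  qed (auto simp: h_Q_left)
qed (use open_U x in \<open>simp_all add: inner_product_h linear_Q Q_Q h_orthogonal\<close>)

lemma nab_eq:
  assumes "x \<in> U" "Q x v = - v" "Q x w = w"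
  shows "h x (nabla_coord h Q x v v) w = k' x w v v - 2 * k' x v v w"
  by (rule local_product_structure.nab_diagonal[where k = k and k' = "k' x",
        OF product_structure[OF assms(1)] assms(2,3) k_eq k_deriv[OF assms(1)]])

text \<open>Each fibre term either has coefficient zero or \<open>w\<close> has no component in that
  summand, so that \<open>T_vertical\<close> applies. The horizontal terms vanish since
  \<open>L y v\<close> and \<open>M y *v L y w\<close> are zero.\<close>

lemma nab_vertical:
  assumes y: "y \<in> U" and v: "Q y v = - v" "L y v = 0" and w: "Q y w = w"
  shows "h y (nabla_coord h Q y v v) w = 0"
proof -
  have "S y *v L y w = L y w" "\<epsilon>1 *\<^sub>R plus.om y w = plus.om y w" "\<epsilon>2 *\<^sub>R minus.om y w = minus.om y w"
    using Q[OF y, of w] w by auto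
  then have "M y *v L y w = 0" and "\<epsilon>1 = 1 \<or> plus.om y w = 0" and "\<epsilon>2 = 1 \<or> minus.om y w = 0"
    using \<epsilon> by (auto intro: M_kernel simp: neg_eq_self)
  then have "(1 - \<epsilon>1) / 2 * t1 * plus.T' y w v v = 2 * ((1 - \<epsilon>1) / 2 * t1 * plus.T' y v v w)"
    "(1 - \<epsilon>2) / 2 * t2 * minus.T' y w v v = 2 * ((1 - \<epsilon>2) / 2 * t2 * minus.T' y v v w)"
    using plus.T_vertical[OF y v(2), of w] minus.T_vertical[OF y v(2), of w] by auto
  moreover have "k0' y w v v = 0" "k0' y v v w = 0"
    using v(2) \<open>M y *v L y w = 0\<close> by (simp_all add: k0'_def matrix_vector_simps)
  moreover have "p + c + d - 2 * (q + c' + d') = 0" if "c = 2 * c'" "d = 2 * d'" "p = 0" "q = 0" for c c' d d' p q :: real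
    using that by simp
  ultimately show ?thesis
    unfolding nab_eq[OF y v(1) w] k'_def by blast
qed

text \<open>Here \<open>v\<close> is horizontal while \<open>w\<close> may have vertical components,
  so besides the torsion-free cancellation the variation \<open>E y w\<close> of the horizontal
  structure has to be dealt with.\<close>

lemma nab_horizontal:
  assumes y: "y \<in> U" and "\<epsilon>1 = 1" "\<epsilon>2 = 1" and v: "Q y v = - v" and w: "Q y w = w"
  shows "h y (nabla_coord h Q y v v) w = 0"
proof -
  have "S y *v L y w = L y w"
    using Q(1)[OF y, of w] w by simp
  then have Mw: "M y *v L y w = 0"
    by (rule M_kernel)
  have Sv: "S y *v L y v = - L y v" and om_v: "plus.om y v = 0" "minus.om y v = 0"
    using Q[OF y, of v] v assms(2,3) y by (simp_all add: L_linear om_linear neg_eq_self)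
  have Ev: "E y v = 0"
    by (simp add: E_def om_v matrix_mult_simps)
  have Ew: "L y v \<bullet> (E y w *v L y v) = 0"
  proof -
    let ?X = "L y v" and ?a = "\<alpha> y" and ?b = "\<beta> y" and ?V = "plus.om y w" and ?W = "minus.om y w"
    note m = metric[OF y] and r = plus.r_nz[OF y] and a = plus.a_selfdual[OF y] and b = minus.a_selfdual[OF y]
    note V = plus.om_selfdual[OF y, of w] and W = minus.om_selfdual[OF y, of w]
    note skew_shift = metric_matrix.skew_shift[OF m]
    have aa: "(?a ** G y) *v ((?a ** G y) *v Y) = - Y" for Y
    proof -
      have "(?a ** G y) *v ((?a ** G y) *v Y) = (?a ** G y ** ?a ** G y) *v Y"
        by (simp only: matrix_vector_mul_assoc matrix_mul_assoc)
      also have "\<dots> = (- 1) *\<^sub>R Y"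
        unfolding metric_matrix.selfdual_square(1)[OF m a r] plus.a_unit[OF y]
        by (rule metric_matrix.scaleR_mat_vector[OF m])
      finally show ?thesis
        by (simp only: scaleR_minus1_left)
    qed
    \<comment> \<open>On the -1-eigenspace of \<open>S\<close> the two complex structures coincide.
      Each half of \<open>E y w\<close> then pairs a bivector with the unit section of its own type,
      as \<open>selfdual_perp_form\<close> requires.\<close>
    have ba: "(?b ** G y) *v ?X = (?a ** G y) *v ?X"
    proof -
      have "(?a ** G y) *v ((?b ** G y) *v ?X) = - ?X"
        unfolding Sv[symmetric] S_def by (simp only: matrix_vector_mul_assoc matrix_mul_assoc)
      then have "- ((?b ** G y) *v ?X) = - ((?a ** G y) *v ?X)"
        using aa[of "(?b ** G y) *v ?X"] by (simp only: matrix_vector_simps)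
      then show ?thesis
        by (simp only: neg_equal_iff_equal)
    qed
    have "?X \<bullet> ((G y ** ?V ** G y ** ?b ** G y) *v ?X) = ?X \<bullet> (G y *v ((?V ** G y) *v ((?b ** G y) *v ?X)))"
      by (simp only: matrix_vector_mul_assoc matrix_mul_assoc)
    also have "\<dots> = 0"
      unfolding ba by (rule metric_matrix.selfdual_perp_form(1)[OF m a V(1) r V(2)])
    finally have 1: "?X \<bullet> ((G y ** ?V ** G y ** ?b ** G y) *v ?X) = 0" .
    have "?X \<bullet> ((G y ** ?a ** G y ** ?W ** G y) *v ?X) = ?X \<bullet> (G y *v ((?a ** G y) *v ((?W ** G y) *v ?X)))"
      by (simp only: matrix_vector_mul_assoc matrix_mul_assoc)
    also have "\<dots> = - (((?a ** G y) *v ?X) \<bullet> (G y *v ((?W ** G y) *v ?X)))"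
      by (simp only: skew_shift[OF selfdual_skew[OF a]] minus_minus)
    also have "\<dots> = ?X \<bullet> (G y *v ((?b ** G y) *v ((?W ** G y) *v ?X)))"
      by (simp only: ba[symmetric] skew_shift[OF selfdual_skew[OF b]] minus_minus)
    also have "\<dots> = 0"
      by (rule metric_matrix.selfdual_perp_form(2)[OF m b W(1) _ W(2)]) (simp add: r)
    finally show ?thesis
      by (simp only: E_def matrix_vector_mult_add_rdistrib inner_add_right 1 add_0)
  qed
  have t: "X \<bullet> ((transpose A ** M y) *v Y) = (A *v X) \<bullet> (M y *v Y)" for X Y and A :: "real ^ 4 ^ 4"
    using inner_matrix_mult_left[of X "transpose A" "M y" Y] by (simp only: transpose_transpose)
  have "L y v \<bullet> (M' y w *v L y v) = 2 * (L y v \<bullet> (M y *v (\<gamma> y w *v L y v)))"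
    using Ew M_sym[OF y, of "\<gamma> y w *v L y v" "L y v"]
    by (simp add: M'_def matrix_vector_simps inner_add_right inner_diff_right t inner_commute flip: matrix_vector_mul_assoc[of "M y"])
  moreover have "L y v \<bullet> (M' y v *v L y w) = L y v \<bullet> (M y *v (\<gamma> y v *v L y w))"
    by (simp add: M'_def Ev matrix_vector_simps inner_add_right t Mw flip: matrix_vector_mul_assoc[of "M y"])
  moreover have "\<gamma> y v *v L y w = \<gamma> y w *v L y v"
    by (rule torsion_free[OF y])
  moreover have "L2 y w v \<bullet> (M y *v L y v) = L y v \<bullet> (M y *v L2 y v w)"
    using M_sym[OF y, of "L2 y w v" "L y v"] L2_sym[OF y, of w v] by (simp add: inner_commute)
  \<comment> \<open>The second derivatives \<open>L2\<close> cancel by symmetry and the connection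
    terms by torsion-freeness.\<close>
  ultimately have "k0' y w v v - 2 * k0' y v v w = 0"
    using L2_sym[OF y, of w v] by (simp add: k0'_def Mw inner_add_right)
  then show ?thesis
    unfolding nab_eq[OF y v w] k'_def using assms(2,3) by simp
qed

text \<open>The tangent planes of both fibres have dimension 2, and one of them lies in the
  -1-eigenspace.\<close>

lemma vertical_exists:
  assumes y: "y \<in> U" and "\<epsilon>1 = - 1 \<or> \<epsilon>2 = - 1"
  shows "\<exists>v. v \<noteq> 0 \<and> Q y v = - v \<and> L y v = 0"
proof -
  have ex: "\<exists>V. V \<noteq> 0 \<and> V \<in> A" if "dim A = 2" for A :: "(real ^ 4 ^ 4) set"
    using that by (metis dim_eq_0 subsetI insert_iff zero_neq_numeral)
  have 0: "selfdual (G y) s 0" for s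
    using subspace_0[OF subspace_selfdual] by blast
  show ?thesis
  proof (cases "\<epsilon>1 = - 1")
    case True
    obtain V where V: "V \<noteq> 0" "selfdual (G y) (r y) V" "ip (G y) V (\<alpha> y) = 0"
      using ex[OF range_frame(2)[OF y]] by blast
    obtain v where v: "L y v = 0" "plus.om y v = V" "minus.om y v = 0"
      using frame_surj[OF y V(2,3) 0, of 0] by (auto simp: ip_linear)
    have "Q y v = - v"
      using y v True by (intro Q_eqI) (simp_all add: L_linear om_linear matrix_vector_simps)
    moreover have "v \<noteq> 0"
      using v V linear_0[OF plus.linear_om[OF y]] by auto
    ultimately show ?thesis
      using v by blast
  next
    case False
    then have e: "\<epsilon>2 = - 1"
      using assms(2) by simp
    obtain V where V: "V \<noteq> 0" "selfdual (G y) (- r y) V" "ip (G y) V (\<beta> y) = 0"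
      using ex[OF range_frame(3)[OF y]] by blast
    obtain v where v: "L y v = 0" "plus.om y v = 0" "minus.om y v = V"
      using frame_surj[OF y 0 _ V(2,3), of 0] by (auto simp: ip_linear)
    have "Q y v = - v"
      using y v e by (intro Q_eqI) (simp_all add: L_linear om_linear matrix_vector_simps)
    moreover have "v \<noteq> 0"
      using v V linear_0[OF minus.linear_om[OF y]] by auto
    ultimately show ?thesis
      using v by blast
  qed
qed

end

section \<open>Coordinate changes on the base\<close>

lemma cinv_cmap: "inj_on (cmap c) (cdom c) \<Longrightarrow> p \<in> cdom c \<Longrightarrow> cinv c (cmap c p) = p"
  by (simp add: cinv_def)

lemma smooth_on_Ck: "smooth_on S f \<Longrightarrow> Ck_on k S f"
  by (simp add: smooth_on_def)

lemma smooth_on_has_derivative: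
  "smooth_on S f \<Longrightarrow> y \<in> S \<Longrightarrow> (f has_derivative frechet_derivative f (at y)) (at y)"
  by (rule Ck_on_SucD(1)[OF smooth_on_Ck])

lemma smooth_on_frechet_derivative:
  "smooth_on S f \<Longrightarrow> smooth_on S (\<lambda>y. frechet_derivative f (at y) v)"
  unfolding smooth_on_def using Ck_on_SucD(2) by blast

lemma matrix_works_real: "linear f \<Longrightarrow> matrix f *v v = f v" for f :: "real ^ 'n \<Rightarrow> real ^ 'm"
  by (metis matrix_vector_mul)

lemma has_derivative_matrixI:
  fixes M :: "'a::real_normed_vector \<Rightarrow> real ^ 'n ^ 'm"
  assumes "\<And>i j. ((\<lambda>z. M z $ i $ j) has_derivative (\<lambda>u. M' u $ i $ j)) (at y)"
  shows "(M has_derivative M') (at y)"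
  by (subst has_derivative_componentwise_within) (use assms in \<open>auto simp: Basis_vec_def inner_axis\<close>)

lemma differentiable_matrixI:
  fixes M :: "'a::real_normed_vector \<Rightarrow> real ^ 'n ^ 'm"
  assumes "\<And>i j. (\<lambda>z. M z $ i $ j) differentiable (at y)"
  shows "M differentiable (at y)"
  by (subst differentiable_componentwise_within) (use assms in \<open>auto simp: Basis_vec_def inner_axis\<close>)

lemma differentiable_vec_nth:
  fixes f :: "'a::real_normed_vector \<Rightarrow> real ^ 'n"
  shows "f differentiable (at y) \<Longrightarrow> (\<lambda>z. f z $ i) differentiable (at y)"
  unfolding differentiable_def using bounded_linear.has_derivative[OF bounded_linear_vec_nth] by blast

locale oriented_riemannian =
  fixes A :: "('m, real ^ 4) chart set" and g :: "'m \<Rightarrow> real ^ 4 \<Rightarrow> real ^ 4 \<Rightarrow> real"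
  assumes atlas: "smooth_atlas A" and oriented: "oriented_atlas A" and metric_g: "riemannian_metric A g"
begin

text \<open>The target chart comes first, so that the chain rule reads like a composition.\<close>

definition "transit d c = cmap d \<circ> cinv c"
definition "overlap d c = cmap c ` (cdom c \<inter> cdom d)"
definition "dtrans d c y = frechet_derivative (transit d c) (at y)"
definition "ddtrans d c y u v = frechet_derivative (\<lambda>z. dtrans d c z v) (at y) u"

lemma chart_inj: "c \<in> A \<Longrightarrow> inj_on (cmap c) (cdom c)"
  and overlap_open: "c \<in> A \<Longrightarrow> d \<in> A \<Longrightarrow> open (overlap d c)"
  and transit_smooth: "c \<in> A \<Longrightarrow> d \<in> A \<Longrightarrow> smooth_on (overlap d c) (transit d c)"
  and image_open: "c \<in> A \<Longrightarrow> open (cmap c ` cdom c)"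
  using atlas by (auto simp: smooth_atlas_def overlap_def transit_def)

lemma chart_at: "p \<in> points A \<Longrightarrow> chart_at A p \<in> A" "p \<in> points A \<Longrightarrow> p \<in> cdom (chart_at A p)"
  using someI_ex[of "\<lambda>c. c \<in> A \<and> p \<in> cdom c"] unfolding chart_at_def points_def by blast+

lemma pointsI: "c \<in> A \<Longrightarrow> p \<in> cdom c \<Longrightarrow> p \<in> points A"
  by (auto simp: points_def)

lemma transit_cmap: "c \<in> A \<Longrightarrow> p \<in> cdom c \<Longrightarrow> transit d c (cmap c p) = cmap d p"
  by (simp add: transit_def cinv_cmap chart_inj)

lemma overlapI: "p \<in> cdom c \<Longrightarrow> p \<in> cdom d \<Longrightarrow> cmap c p \<in> overlap d c"
  by (auto simp: overlap_def)

lemma overlap_Int: "c \<in> A \<Longrightarrow> y \<in> overlap d c \<Longrightarrow> y \<in> overlap e c \<Longrightarrow>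
    \<exists>p. p \<in> cdom c \<and> p \<in> cdom d \<and> p \<in> cdom e \<and> y = cmap c p"
  using chart_inj[of c] by (auto simp: overlap_def inj_on_def)

lemma transit_deriv: "c \<in> A \<Longrightarrow> d \<in> A \<Longrightarrow> y \<in> overlap d c \<Longrightarrow> (transit d c has_derivative dtrans d c y) (at y)"
  unfolding dtrans_def by (rule smooth_on_has_derivative[OF transit_smooth])

lemma dtrans_linear: "c \<in> A \<Longrightarrow> d \<in> A \<Longrightarrow> y \<in> overlap d c \<Longrightarrow> linear (dtrans d c y)"
  using transit_deriv has_derivative_linear by blast

lemma dtrans_deriv: "c \<in> A \<Longrightarrow> d \<in> A \<Longrightarrow> y \<in> overlap d c \<Longrightarrow>
    ((\<lambda>z. dtrans d c z v) has_derivative (\<lambda>u. ddtrans d c y u v)) (at y)"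
  unfolding ddtrans_def unfolding dtrans_def
  by (rule smooth_on_has_derivative[OF smooth_on_frechet_derivative[OF transit_smooth]])

lemma ddtrans_sym: "c \<in> A \<Longrightarrow> d \<in> A \<Longrightarrow> y \<in> overlap d c \<Longrightarrow> ddtrans d c y u v = ddtrans d c y v u"
  unfolding ddtrans_def dtrans_def
  by (rule mixed_derivatives_commute[OF overlap_open _ smooth_on_Ck[OF transit_smooth]])

lemma dtrans_chain:
  assumes "c \<in> A" "d \<in> A" "e \<in> A" "p \<in> cdom c" "p \<in> cdom d" "p \<in> cdom e"
  shows "dtrans e c (cmap c p) v = dtrans e d (cmap d p) (dtrans d c (cmap c p) v)"
proof -
  let ?y = "cmap c p"
  have "(transit e d has_derivative dtrans e d (cmap d p)) (at (transit d c ?y))"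
    using assms by (simp add: transit_cmap transit_deriv overlapI)
  from has_derivative_compose[OF transit_deriv[OF assms(1,2) overlapI[OF assms(4,5)]] this]
  have "((\<lambda>z. transit e d (transit d c z)) has_derivative (\<lambda>v. dtrans e d (cmap d p) (dtrans d c ?y v))) (at ?y)" .
  then have "(transit e c has_derivative (\<lambda>v. dtrans e d (cmap d p) (dtrans d c ?y v))) (at ?y)"
  proof (rule has_derivative_transform_within_open)
    show "open (overlap d c \<inter> overlap e c)"
      using assms by (intro open_Int overlap_open)
    show "?y \<in> overlap d c \<inter> overlap e c"
      using assms by (auto intro: overlapI)
    show "transit e d (transit d c z) = transit e c z" if "z \<in> overlap d c \<inter> overlap e c" for z
      using overlap_Int[OF assms(1), of z d e] that assms by (auto simp: transit_cmap)
  qed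
  from has_derivative_unique[OF transit_deriv[OF assms(1,3) overlapI[OF assms(4,6)]] this]
  show ?thesis
    by (simp add: fun_eq_iff)
qed

lemma dtrans_id:
  assumes "c \<in> A" "p \<in> cdom c"
  shows "dtrans c c (cmap c p) v = v"
proof -
  have "((\<lambda>z. z) has_derivative (\<lambda>v. v)) (at (cmap c p))"
    by (rule has_derivative_ident)
  then have "(transit c c has_derivative (\<lambda>v. v)) (at (cmap c p))"
    by (rule has_derivative_transform_within_open[OF _ overlap_open[OF assms(1,1)]])
      (use assms in \<open>auto simp: overlap_def transit_cmap\<close>)
  from has_derivative_unique[OF transit_deriv[OF assms(1,1) overlapI[OF assms(2,2)]] this]
  show ?thesis
    by (simp add: fun_eq_iff)
qed

lemma dtrans_inverse:
  "c \<in> A \<Longrightarrow> d \<in> A \<Longrightarrow> p \<in> cdom c \<Longrightarrow> p \<in> cdom d \<Longrightarrow> dtrans c d (cmap d p) (dtrans d c (cmap c p) v) = v"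
  using dtrans_chain[of c d c p v] dtrans_id[of c p v] by simp

definition "Jac d c y = matrix (dtrans d c y)"

lemma Jac_works: "c \<in> A \<Longrightarrow> d \<in> A \<Longrightarrow> y \<in> overlap d c \<Longrightarrow> Jac d c y *v v = dtrans d c y v"
  unfolding Jac_def by (rule matrix_works_real[OF dtrans_linear])

lemma Jac_chain:
  assumes "c \<in> A" "d \<in> A" "e \<in> A" "p \<in> cdom c" "p \<in> cdom d" "p \<in> cdom e"
  shows "Jac e c (cmap c p) = Jac e d (cmap d p) ** Jac d c (cmap c p)"
  unfolding matrix_eq using assms
  by (simp add: Jac_works overlapI dtrans_chain[of c d e p] flip: matrix_vector_mul_assoc)

lemma Jac_id: "c \<in> A \<Longrightarrow> p \<in> cdom c \<Longrightarrow> Jac c c (cmap c p) = mat 1"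
  unfolding matrix_eq by (simp add: Jac_works overlapI dtrans_id)

lemma Jac_det: "c \<in> A \<Longrightarrow> d \<in> A \<Longrightarrow> y \<in> overlap d c \<Longrightarrow> det (Jac d c y) > 0"
  using oriented unfolding oriented_atlas_def Jac_def dtrans_def transit_def overlap_def by blast

lemma jacobian_at_eq: "jacobian_at A c p = Jac c (chart_at A p) (cmap (chart_at A p) p)"
  by (simp add: jacobian_at_def Jac_def dtrans_def transit_def)

lemma tframe_eq: "tframe (chart_at A) c p = dtrans (chart_at A p) c (cmap c p)"
  by (simp add: tframe_def dtrans_def transit_def)

definition "gloc c = local_form (tframe (chart_at A)) g c"

lemma gloc_cmap:
  "c \<in> A \<Longrightarrow> p \<in> cdom c \<Longrightarrow>
    gloc c (cmap c p) u v = g p (dtrans (chart_at A p) c (cmap c p) u) (dtrans (chart_at A p) c (cmap c p) v)"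
  by (simp add: gloc_def local_form_def tframe_eq cinv_cmap chart_inj)

lemma gloc_transform:
  assumes "c \<in> A" "d \<in> A" "p \<in> cdom c" "p \<in> cdom d"
  shows "gloc c (cmap c p) u v = gloc d (cmap d p) (dtrans d c (cmap c p) u) (dtrans d c (cmap c p) v)"
  using assms chart_at[OF pointsI[of c p]]
  by (simp add: gloc_cmap dtrans_chain[of c d "chart_at A p" p])

lemma gloc_chart_at: "p \<in> points A \<Longrightarrow> gloc (chart_at A p) (cmap (chart_at A p) p) = g p"
  by (simp add: fun_eq_iff gloc_cmap chart_at dtrans_id)

lemma gloc_smooth: "c \<in> A \<Longrightarrow> smooth_on (cmap c ` cdom c) (\<lambda>y. gloc c y u v)"
  using metric_g by (simp add: riemannian_metric_def gloc_def)

lemma inner_product_g: "p \<in> points A \<Longrightarrow> is_inner_product (g p)"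
  using metric_g by (simp add: riemannian_metric_def)

lemma inner_product_gloc:
  assumes c: "c \<in> A" and "y \<in> cmap c ` cdom c"
  shows "is_inner_product (gloc c y)"
proof -
  obtain p where p: "p \<in> cdom c" "y = cmap c p"
    using assms by blast
  let ?d = "chart_at A p"
  have P: "p \<in> points A"
    using c p by (auto intro: pointsI)
  note d = chart_at[OF P]
  have lin: "linear (dtrans ?d c y)"
    using c d p by (auto intro: dtrans_linear overlapI)
  have nz: "dtrans ?d c y u \<noteq> 0" if "u \<noteq> 0" for u
    using dtrans_inverse[of c ?d p u] c d p that linear_0[OF dtrans_linear[of ?d c "cmap ?d p"]]
    by (auto simp: overlapI)
  have eq: "gloc c y = (\<lambda>u v. g p (dtrans ?d c y u) (dtrans ?d c y v))"
    using c p by (simp add: fun_eq_iff gloc_cmap)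
  have "bilinear (gloc c y)"
    using inner_product_bilinear[OF inner_product_g[OF P]]
    unfolding eq bilinear_def using linear_compose[OF lin, unfolded comp_def] by blast
  then show ?thesis
    using inner_product_g[OF P] nz unfolding eq is_inner_product_def by blast
qed

definition "Gl c y = gram (gloc c y)"

lemma gloc_Gl: "c \<in> A \<Longrightarrow> y \<in> cmap c ` cdom c \<Longrightarrow> gloc c y u v = u \<bullet> (Gl c y *v v)"
  unfolding Gl_def by (rule bilinear_gram[OF inner_product_bilinear[OF inner_product_gloc]])

lemma Gl_metric: "c \<in> A \<Longrightarrow> y \<in> cmap c ` cdom c \<Longrightarrow> metric_matrix (Gl c y)"
  unfolding Gl_def by (rule metric_matrix_gram[OF inner_product_gloc])

lemma Gl_transform:
  assumes "c \<in> A" "d \<in> A" "p \<in> cdom c" "p \<in> cdom d"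
  shows "Gl c (cmap c p) = transpose (Jac d c (cmap c p)) ** Gl d (cmap d p) ** Jac d c (cmap c p)"
proof (rule matrix_eqI_inner)
  fix u v
  have "u \<bullet> (Gl c (cmap c p) *v v) = gloc d (cmap d p) (Jac d c (cmap c p) *v u) (Jac d c (cmap c p) *v v)"
    using assms gloc_transform[OF assms] by (simp add: Jac_works overlapI flip: gloc_Gl)
  also have "\<dots> = (Jac d c (cmap c p) *v u) \<bullet> (Gl d (cmap d p) *v (Jac d c (cmap c p) *v v))"
    using assms by (simp add: gloc_Gl)
  also have "\<dots> = u \<bullet> ((transpose (Jac d c (cmap c p)) ** Gl d (cmap d p) ** Jac d c (cmap c p)) *v v)"
    using inner_transpose_mult[of "transpose (Jac d c (cmap c p))"]
    by (simp only: transpose_transpose) (simp add: matrix_vector_mul_assoc matrix_mul_assoc)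
  finally show "u \<bullet> (Gl c (cmap c p) *v v)
    = u \<bullet> ((transpose (Jac d c (cmap c p)) ** Gl d (cmap d p) ** Jac d c (cmap c p)) *v v)" .
qed

section \<open>Christoffel symbols of the base and their transformation law\<close>

definition "Chr c y = christoffel (gloc c) y"

lemma gloc_diff: "c \<in> A \<Longrightarrow> y \<in> cmap c ` cdom c \<Longrightarrow> (\<lambda>z. gloc c z u v) differentiable (at y)"
  using smooth_on_has_derivative[OF gloc_smooth] differentiable_def by blast

lemma Chr_levi_civita: "c \<in> A \<Longrightarrow> y \<in> cmap c ` cdom c \<Longrightarrow> is_levi_civita (gloc c) y (Chr c y)"
  unfolding Chr_def by (rule christoffel_levi_civita[OF image_open _ inner_product_gloc gloc_diff])

lemma Chr:
  assumes "c \<in> A" "y \<in> cmap c ` cdom c"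
  shows "bilinear (Chr c y)" "Chr c y u v = Chr c y v u"
    "frechet_derivative (\<lambda>z. gloc c z v w) (at y) u = gloc c y (Chr c y u v) w + gloc c y v (Chr c y u w)"
  using Chr_levi_civita[OF assms] by (auto simp: is_levi_civita_def)

text \<open>The symbols are given only by a description; the Koszul formula makes them solutions of
  a linear system with differentiable data, whence \<open>Chr_diff\<close>.\<close>

lemma Chr_koszul:
  assumes c: "c \<in> A" and y: "y \<in> cmap c ` cdom c"
  shows "gloc c y (Chr c y u v) w = (frechet_derivative (\<lambda>z. gloc c z v w) (at y) u
    + frechet_derivative (\<lambda>z. gloc c z u w) (at y) v - frechet_derivative (\<lambda>z. gloc c z u v) (at y) w) / 2"
proof -
  note s = inner_product_sym[OF inner_product_gloc[OF c y]]
  show ?thesis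
    unfolding Chr(3)[OF c y]
    by (simp add: Chr(2)[OF c y, of v u] Chr(2)[OF c y, of w u] Chr(2)[OF c y, of w v]
        s[of "Chr c y u w" v] s[of "Chr c y v w" u])
qed

lemma Chr_diff:
  assumes c: "c \<in> A" and y: "y \<in> cmap c ` cdom c"
  shows "(\<lambda>z. Chr c z u v) differentiable (at y)"
proof (rule differentiable_represented[OF image_open[OF c] y inner_product_gloc[OF c] gloc_diff[OF c y] Chr_koszul[OF c]])
  have "(\<lambda>z. frechet_derivative (\<lambda>z. gloc c z a b) (at z) w) differentiable (at y)" for a b w
    using smooth_on_has_derivative[OF smooth_on_frechet_derivative[OF gloc_smooth[OF c]] y] differentiable_def by blast
  then show "(\<lambda>z. (frechet_derivative (\<lambda>z. gloc c z v w) (at z) u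
    + frechet_derivative (\<lambda>z. gloc c z u w) (at z) v - frechet_derivative (\<lambda>z. gloc c z u v) (at z) w) / 2) differentiable (at y)" for w
    using c y image_open[OF c] by (intro differentiable_divide differentiable_add differentiable_diff differentiable_const) auto
qed

definition "Gam c y u = matrix (Chr c y u)"

lemma Gam_works: "c \<in> A \<Longrightarrow> y \<in> cmap c ` cdom c \<Longrightarrow> Gam c y u *v v = Chr c y u v"
  unfolding Gam_def using Chr(1) by (intro matrix_works_real) (simp add: bilinear_def)

lemma Gam_linear: "c \<in> A \<Longrightarrow> y \<in> cmap c ` cdom c \<Longrightarrow> linear (Gam c y)"
  by (intro linearI)
    (simp_all add: matrix_eq Gam_works matrix_vector_simps bilinear_ladd[OF Chr(1)] bilinear_lmul[OF Chr(1)])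

lemma Gam_diff:
  assumes c: "c \<in> A" and y: "y \<in> cmap c ` cdom c"
  shows "(\<lambda>z. Gam c z u) differentiable (at y)"
proof -
  have "(\<lambda>z. Chr c z u (axis j 1) $ i) differentiable (at y)" for i j
    by (intro differentiable_vec_nth Chr_diff[OF c y])
  then show ?thesis
    by (intro differentiable_matrixI) (simp add: Gam_def matrix_def)
qed

lemma Gl_deriv:
  assumes c: "c \<in> A" and y: "y \<in> cmap c ` cdom c"
  shows "(Gl c has_derivative (\<lambda>u. transpose (Gam c y u) ** Gl c y + Gl c y ** Gam c y u)) (at y)"
proof -
  have e: "gloc c y a b = a \<bullet> (Gl c y *v b)" for a b
    by (rule gloc_Gl[OF c y])
  have d: "((\<lambda>z. gloc c z (axis i 1) (axis j 1)) has_derivative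
      (\<lambda>u. (transpose (Gam c y u) ** Gl c y + Gl c y ** Gam c y u) $ i $ j)) (at y)" for i j
  proof (rule has_derivative_eq_rhs[OF smooth_on_has_derivative[OF gloc_smooth[OF c] y]], rule ext)
    fix u
    show "frechet_derivative (\<lambda>z. gloc c z (axis i 1) (axis j 1)) (at y) u
        = (transpose (Gam c y u) ** Gl c y + Gl c y ** Gam c y u) $ i $ j"
      unfolding Chr(3)[OF c y] matrix_entry[symmetric] e
      using inner_matrix_mult_left[of "axis i 1" "transpose (Gam c y u)" "Gl c y" "axis j 1"]
      by (simp add: Gam_works[OF c y, symmetric] matrix_vector_simps inner_add_right matrix_vector_mul_assoc)
  qed
  have "((\<lambda>z. Gl c z $ i $ j) has_derivative
      (\<lambda>u. (transpose (Gam c y u) ** Gl c y + Gl c y ** Gam c y u) $ i $ j)) (at y)" for i j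
    using d[of i j] by (simp add: Gl_def gram_def)
  then show ?thesis
    by (rule has_derivative_matrixI)
qed

text \<open>The symbols of \<open>d\<close>, pulled back and corrected by the second derivative of
  the coordinate change, satisfy the conditions that characterise those of \<open>c\<close>.\<close>

lemma Chr_transform:
  assumes c: "c \<in> A" "p \<in> cdom c" and d: "d \<in> A" "p \<in> cdom d"
  shows "dtrans d c (cmap c p) (Chr c (cmap c p) u v)
    = Chr d (cmap d p) (dtrans d c (cmap c p) u) (dtrans d c (cmap c p) v) + ddtrans d c (cmap c p) u v"
proof -
  define y where "y = cmap c p"
  define z where "z = cmap d p"
  define J where "J = dtrans d c y"
  define K where "K = dtrans c d z"
  define H where "H = ddtrans d c y"
  have y: "y \<in> cmap c ` cdom c" "y \<in> overlap d c" and z: "z \<in> cmap d ` cdom d" "z \<in> overlap c d"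
    using c d by (auto simp: y_def z_def intro: overlapI)
  have JK: "J (K w) = w" "K (J w) = w" for w
    using dtrans_inverse[of d c p w] dtrans_inverse[of c d p w] c d by (simp_all add: J_def K_def y_def z_def)
  have linJ: "linear J" and linK: "linear K"
    using dtrans_linear[OF c(1) d(1) y(2)] dtrans_linear[OF d(1) c(1) z(2)] by (auto simp: J_def K_def)
  have lin_H: "linear (\<lambda>u. H u v)" "H u v = H v u" for u v
    using dtrans_deriv[OF c(1) d(1) y(2), of v] has_derivative_linear ddtrans_sym[OF c(1) d(1) y(2)]
    by (auto simp: H_def)
  have lin_H2: "linear (H u)" for u
    using lin_H(1)[of u] lin_H(2)[of u] by (simp add: linear_iff)
  note C = Chr[OF d(1) z(1)]
  note Cl = bilinear_ladd[OF C(1)] bilinear_radd[OF C(1)] bilinear_lmul[OF C(1)] bilinear_rmul[OF C(1)]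
  \<comment> \<open>The claimed law solved for the symbols of \<open>c\<close>, with
    \<open>K\<close> the inverse of \<open>J\<close>.\<close>
  define \<Gamma> where "\<Gamma> u v = K (Chr d z (J u) (J v) + H u v)" for u v
  have "is_levi_civita (gloc c) y \<Gamma>"
    unfolding is_levi_civita_def
  proof (intro conjI allI)
    show "bilinear \<Gamma>"
      unfolding bilinear_def \<Gamma>_def
      by (intro conjI allI; rule linearI)
        (simp_all add: Cl linear_add[OF linJ] linear_cmul[OF linJ] linear_add[OF linK] linear_cmul[OF linK]
          linear_add[OF lin_H(1)] linear_cmul[OF lin_H(1)] linear_add[OF lin_H2] linear_cmul[OF lin_H2] algebra_simps)
    show "\<Gamma> u v = \<Gamma> v u" for u v
      by (simp add: \<Gamma>_def C(2)[of "J u"] lin_H(2)[of u])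
    fix u v w
    have gc: "gloc c y a b = J a \<bullet> (Gl d z *v J b)" for a b
      using gloc_transform[OF c(1) d(1) c(2) d(2), of a b] gloc_Gl[OF d(1) z(1)] by (simp add: J_def y_def z_def)
    have zt: "transit d c y = z"
      by (simp add: y_def z_def transit_cmap c)
    have G: "((\<lambda>x. Gl d (transit d c x)) has_derivative
        (\<lambda>u. transpose (Gam d z (J u)) ** Gl d z + Gl d z ** Gam d z (J u))) (at y)"
      unfolding J_def
      by (rule has_derivative_compose[OF transit_deriv[OF c(1) d(1) y(2)]]) (simp add: zt Gl_deriv[OF d(1) z(1)])
    have "((\<lambda>x. dtrans d c x v \<bullet> (Gl d (transit d c x) *v dtrans d c x w)) has_derivative
      (\<lambda>u. J v \<bullet> (Gl d z *v H u w + (transpose (Gam d z (J u)) ** Gl d z + Gl d z ** Gam d z (J u)) *v J w)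
        + H u v \<bullet> (Gl d z *v J w))) (at y)"
      using has_derivative_inner[OF dtrans_deriv[OF c(1) d(1) y(2), of v]
          has_derivative_matrix_vector[OF G dtrans_deriv[OF c(1) d(1) y(2), of w]]]
      by (simp add: zt J_def H_def)
    then have "((\<lambda>x. gloc c x v w) has_derivative
      (\<lambda>u. J v \<bullet> (Gl d z *v H u w + (transpose (Gam d z (J u)) ** Gl d z + Gl d z ** Gam d z (J u)) *v J w)
        + H u v \<bullet> (Gl d z *v J w))) (at y)"
    proof (rule has_derivative_transform_within_open[OF _ overlap_open[OF c(1) d(1)] y(2)])
      fix x assume "x \<in> overlap d c"
      then obtain p' where p': "x = cmap c p'" "p' \<in> cdom c" "p' \<in> cdom d"
        by (auto simp: overlap_def)
      then show "dtrans d c x v \<bullet> (Gl d (transit d c x) *v dtrans d c x w) = gloc c x v w"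
        using gloc_transform[OF c(1) d(1) p'(2,3), of v w] c d by (simp add: transit_cmap gloc_Gl)
    qed
    then have "frechet_derivative (\<lambda>x. gloc c x v w) (at y) u
      = J v \<bullet> (Gl d z *v H u w + (transpose (Gam d z (J u)) ** Gl d z + Gl d z ** Gam d z (J u)) *v J w)
        + H u v \<bullet> (Gl d z *v J w)"
      by (rule fun_cong[OF frechet_derivative_at[symmetric]])
    also have "\<dots> = (Chr d z (J u) (J v) + H u v) \<bullet> (Gl d z *v J w) + J v \<bullet> (Gl d z *v (Chr d z (J u) (J w) + H u w))"
      using inner_matrix_mult_left[of "J v" "transpose (Gam d z (J u))" "Gl d z" "J w"]
      by (simp add: matrix_vector_simps inner_add_left inner_add_right Gam_works[OF d(1) z(1), symmetric] matrix_vector_mul_assoc)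
    also have "\<dots> = gloc c y (\<Gamma> u v) w + gloc c y v (\<Gamma> u w)"
      by (simp add: gc \<Gamma>_def JK)
    finally show "frechet_derivative (\<lambda>x. gloc c x v w) (at y) u = gloc c y (\<Gamma> u v) w + gloc c y v (\<Gamma> u w)" .
  qed
  moreover have "\<exists>!\<Gamma>. is_levi_civita (gloc c) y \<Gamma>"
    by (rule levi_civita_ex1[OF image_open[OF c(1)] y(1) inner_product_gloc[OF c(1)] gloc_diff[OF c(1) y(1)]])
  ultimately have "Chr c y = \<Gamma>"
    using Chr_levi_civita[OF c(1) y(1)] by blast
  then have "J (Chr c y u v) = Chr d z (J u) (J v) + H u v"
    by (simp add: \<Gamma>_def JK)
  then show ?thesis
    by (simp add: J_def H_def y_def z_def)
qed

end

section \<open>Charts of the twistor product\<close>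

locale twistor_chart = oriented_riemannian A g
  for A :: "('m, real ^ 4) chart set" and g +
  fixes C :: "('m bundle_point, real ^ 8) chart" and b0 :: "('m, real ^ 4) chart"
  assumes C: "C \<in> twistor_atlas A g" and b0: "b0 \<in> A"
begin

text \<open>The inverse of the chart \<open>C\<close>, read in the bundle chart over
  \<open>d\<close>: a map between Euclidean spaces, which can be differentiated.\<close>

definition "psi d = cmap (bundle_chart A d) \<circ> cinv C"
definition "bdom d = cmap C ` (cdom C \<inter> cdom (bundle_chart A d))"
definition "mm x = fst (cinv C x)"
definition "aa x = fst (snd (cinv C x))"
definition "bb x = snd (snd (cinv C x))"

lemma C_chart:
  "cdom C \<subseteq> twistor_product A g" "inj_on (cmap C) (cdom C)"
  "d \<in> A \<Longrightarrow> open (bdom d)" "d \<in> A \<Longrightarrow> smooth_on (bdom d) (psi d)"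
  "d \<in> A \<Longrightarrow> x \<in> bdom d \<Longrightarrow> inj (frechet_derivative (psi d) (at x))"
  using C by (auto simp: twistor_atlas_def submanifold_atlas_def bdom_def psi_def)

lemma bdom_iff: "x \<in> bdom d \<longleftrightarrow> (\<exists>\<kappa>. \<kappa> \<in> cdom C \<and> fst \<kappa> \<in> cdom d \<and> x = cmap C \<kappa>)"
  unfolding bdom_def bundle_chart_def by force

lemma bdom_point:
  assumes "x \<in> bdom d"
  shows "cinv C x \<in> cdom C" "cmap C (cinv C x) = x" "mm x \<in> cdom d" "cinv C x = (mm x, aa x, bb x)"
    "cinv C x \<in> twistor_product A g"
  using assms C_chart(1,2) by (auto simp: bdom_iff mm_def aa_def bb_def cinv_cmap)

text \<open>The Jacobian from \<open>chart_at A (mm x)\<close> to \<open>d\<close>. It may jump with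
  \<open>x\<close> and enters only pointwise; derivatives are taken of \<open>Jac\<close> between
  two fixed charts.\<close>

definition "JJ d x = jacobian_at A d (mm x)"

lemma psi_eq:
  "x \<in> bdom d \<Longrightarrow> psi d x = (cmap d (mm x), JJ d x ** aa x ** transpose (JJ d x), JJ d x ** bb x ** transpose (JJ d x))"
  using bdom_point(4)[of x d] by (simp add: psi_def bundle_chart_def JJ_def Let_def)

context
  fixes x d
  assumes x: "x \<in> bdom d" and d: "d \<in> A"
begin

lemma points_mm: "mm x \<in> points A"
  using bdom_point(3)[OF x] d by (rule pointsI[rotated])

lemma JJ_det: "det (JJ d x) > 0"
  unfolding JJ_def jacobian_at_eq
  by (intro Jac_det chart_at[OF points_mm] d overlapI bdom_point(3)[OF x])

lemma gram_JJ: "gram (g (mm x)) = transpose (JJ d x) ** Gl d (cmap d (mm x)) ** JJ d x"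
  using Gl_transform[OF chart_at(1)[OF points_mm] d chart_at(2)[OF points_mm] bdom_point(3)[OF x]]
  by (simp add: JJ_def jacobian_at_eq Gl_def gloc_chart_at[OF points_mm])

lemma Lambda2_JJ: "a \<in> Lambda2 s (g (mm x)) \<longleftrightarrow>
    selfdual (Gl d (cmap d (mm x))) (s * sqrt (det (Gl d (cmap d (mm x))))) (JJ d x ** a ** transpose (JJ d x))"
  unfolding Lambda2_iff[OF inner_product_g[OF points_mm]]
  by (rule selfdual_congruence[OF JJ_det _ gram_JJ])
    (rule metric_matrix.sym[OF Gl_metric[OF d imageI[OF bdom_point(3)[OF x]]]])

lemma biv_inner_JJ: "biv_inner (g (mm x)) a b
    = ip (Gl d (cmap d (mm x))) (JJ d x ** a ** transpose (JJ d x)) (JJ d x ** b ** transpose (JJ d x))"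
  by (simp add: biv_inner_eq_ip[OF inner_product_g[OF points_mm]] gram_JJ ip_congruence)

lemma fibres: "aa x \<in> Lambda2 1 (g (mm x))" "biv_inner (g (mm x)) (aa x) (aa x) = 1"
  "bb x \<in> Lambda2 (- 1) (g (mm x))" "biv_inner (g (mm x)) (bb x) (bb x) = 1"
  using bdom_point(4,5)[OF x] by (auto simp: twistor_product_def twistor_fibre_def)

end

lemma base_diff: "d \<in> A \<Longrightarrow> x \<in> bdom d \<Longrightarrow> (psi d has_derivative frechet_derivative (psi d) (at x)) (at x)"
  by (rule smooth_on_has_derivative[OF C_chart(4)])

definition "D x u = frechet_derivative (psi b0) (at x) u"
definition "D2 x v u = frechet_derivative (\<lambda>z. D z u) (at x) v"
definition "L x u = fst (D x u)"
definition "L2 x v u = fst (D2 x v u)"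
definition "\<alpha> x = fst (snd (psi b0 x))"
definition "\<beta> x = snd (snd (psi b0 x))"
definition "\<alpha>' x u = fst (snd (D x u))"
definition "\<beta>' x u = snd (snd (D x u))"
definition "\<alpha>2 x v u = fst (snd (D2 x v u))"
definition "\<beta>2 x v u = snd (snd (D2 x v u))"
definition "q x = fst (psi b0 x)"
definition "G x = Gl b0 (q x)"
definition "r x = sqrt (det (G x))"
definition "\<gamma> x u = Gam b0 (q x) (L x u)"
definition "\<gamma>2 x v u = frechet_derivative (\<lambda>z. Gam b0 z (L x u)) (at (q x)) (L x v) + Gam b0 (q x) (L2 x v u)"

abbreviation "U \<equiv> bdom b0"

lemma psi_deriv: "x \<in> U \<Longrightarrow> (psi b0 has_derivative D x) (at x)"
  unfolding D_def by (rule base_diff[OF b0])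

lemma D_deriv: "x \<in> U \<Longrightarrow> ((\<lambda>z. D z u) has_derivative (\<lambda>v. D2 x v u)) (at x)"
  unfolding D2_def unfolding D_def
  by (rule smooth_on_has_derivative[OF smooth_on_frechet_derivative[OF C_chart(4)[OF b0]]])

lemma D2_sym: "x \<in> U \<Longrightarrow> D2 x u v = D2 x v u"
  unfolding D2_def D_def
  by (rule mixed_derivatives_commute[OF C_chart(3)[OF b0] _ smooth_on_Ck[OF C_chart(4)[OF b0]]])

lemma linear_D: "x \<in> U \<Longrightarrow> linear (D x)"
  using psi_deriv has_derivative_linear by blast

lemma q_deriv: "x \<in> U \<Longrightarrow> (q has_derivative L x) (at x)"
  unfolding q_def L_def by (intro has_derivative_fst psi_deriv)

lemma q_eq: "x \<in> U \<Longrightarrow> q x = cmap b0 (mm x)"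
  by (simp add: q_def psi_eq)

lemma q_image: "x \<in> U \<Longrightarrow> q x \<in> cmap b0 ` cdom b0"
  using bdom_point(3)[of x b0] by (simp add: q_eq)

lemma linear_L: "x \<in> U \<Longrightarrow> linear (L x)"
  using q_deriv has_derivative_linear by blast

lemma \<alpha>_eq: "x \<in> U \<Longrightarrow> \<alpha> x = JJ b0 x ** aa x ** transpose (JJ b0 x)"
  and \<beta>_eq: "x \<in> U \<Longrightarrow> \<beta> x = JJ b0 x ** bb x ** transpose (JJ b0 x)"
  by (simp_all add: \<alpha>_def \<beta>_def psi_eq)

lemma connection: "pulled_back_connection U L L2 G \<gamma> \<gamma>2"
proof (rule pulled_back_connection.intro)
  show "open U"
    by (rule C_chart(3)[OF b0])
  fix y assume y: "y \<in> U"
  note qy = q_image[OF y] and lin = linear_L[OF y]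
  note GL = Gam_linear[OF b0 qy]
  show "metric_matrix (G y)"
    unfolding G_def by (rule Gl_metric[OF b0 qy])
  show "linear (L y)"
    by (rule lin)
  show "linear (\<gamma> y)"
    unfolding \<gamma>_def using linear_compose[OF lin GL] by (simp add: comp_def)
  show Ld: "((\<lambda>z. L z u) has_derivative (\<lambda>v. L2 y v u)) (at y)" for u
    unfolding L_def L2_def by (intro has_derivative_fst D_deriv y)
  show "L2 y u v = L2 y v u" for u v
    unfolding L2_def D2_sym[OF y, of u v] ..
  show "(G has_derivative (\<lambda>u. transpose (\<gamma> y u) ** G y + G y ** \<gamma> y u)) (at y)"
    unfolding G_def \<gamma>_def
    by (rule has_derivative_compose[OF q_deriv[OF y]]) (rule Gl_deriv[OF b0 qy])
  show "((\<lambda>z. \<gamma> z u) has_derivative (\<lambda>v. \<gamma>2 y v u)) (at y)" for u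
    unfolding \<gamma>_def \<gamma>2_def
  proof (rule has_derivative_apply_linear[OF C_chart(3)[OF b0] y _ _ Ld])
    show "linear (Gam b0 (q z))" if "z \<in> U" for z
      by (rule Gam_linear[OF b0 q_image[OF that]])
    show "((\<lambda>z. Gam b0 (q z) w) has_derivative (\<lambda>v. frechet_derivative (\<lambda>z. Gam b0 z w) (at (q y)) (L y v))) (at y)" for w
      by (rule has_derivative_compose[OF q_deriv[OF y]])
        (use Gam_diff[OF b0 qy] in \<open>simp add: frechet_derivative_works\<close>)
  qed
  show "\<gamma> y u *v L y v = \<gamma> y v *v L y u" for u v
    unfolding \<gamma>_def Gam_works[OF b0 qy] by (rule Chr(2)[OF b0 qy])
  show "\<gamma> y v = 0" if "L y v = 0" for v
    by (simp add: \<gamma>_def that linear_0[OF GL])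
  \<comment> \<open>With \<open>L y v = 0\<close> the term that differentiates \<open>Gam b0\<close>
    vanishes in both orders, once because its argument is 0 and once because the direction is 0. The
    remaining term is symmetric.\<close>
  show "\<gamma>2 y w v = \<gamma>2 y v w" if v: "L y v = 0" for v w
  proof -
    have "(\<lambda>z. Gam b0 z 0) differentiable (at (q y))" "((\<lambda>z. Gam b0 z w) has_derivative
        frechet_derivative (\<lambda>z. Gam b0 z w) (at (q y))) (at (q y))" for w
      using Gam_diff[OF b0 qy] by (simp_all add: frechet_derivative_works)
    then have "linear (frechet_derivative (\<lambda>z. Gam b0 z w) (at (q y)))" for w
      using has_derivative_linear by blast
    then have 1: "frechet_derivative (\<lambda>z. Gam b0 z w) (at (q y)) 0 = 0" for w
      by (rule linear_0)
    have "frechet_derivative (\<lambda>z. Gam b0 z 0) (at (q y)) = frechet_derivative (\<lambda>z. 0) (at (q y))"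
      by (rule frechet_derivative_cong_open[OF image_open[OF b0] qy]) (rule linear_0[OF Gam_linear[OF b0]])
    then have 2: "frechet_derivative (\<lambda>z. Gam b0 z 0) (at (q y)) w = 0" for w
      by simp
    show ?thesis
      by (simp add: \<gamma>2_def v 1 2) (simp add: L2_def D2_sym[OF y, of v])
  qed
qed

lemma section_facts:
  assumes y: "y \<in> U"
  shows "r y > 0" "selfdual (G y) (r y) (\<alpha> y)" "selfdual (G y) (- r y) (\<beta> y)"
    "ip (G y) (\<alpha> y) (\<alpha> y) = 1" "ip (G y) (\<beta> y) (\<beta> y) = 1"
proof -
  show "r y > 0"
    unfolding r_def G_def Gl_def using det_gram_pos[OF inner_product_gloc[OF b0 q_image[OF y]]] by simp
  note f = fibres[OF y b0]
  show "selfdual (G y) (r y) (\<alpha> y)" "selfdual (G y) (- r y) (\<beta> y)"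
    using f(1,3) by (simp_all add: Lambda2_JJ[OF y b0] G_def r_def q_eq[OF y] \<alpha>_eq[OF y] \<beta>_eq[OF y])
  show "ip (G y) (\<alpha> y) (\<alpha> y) = 1" "ip (G y) (\<beta> y) (\<beta> y) = 1"
    using f(2,4) by (simp_all add: biv_inner_JJ[OF y b0] G_def q_eq[OF y] \<alpha>_eq[OF y] \<beta>_eq[OF y])
qed

lemma model:
  assumes "t1 > 0" "t2 > 0" "\<epsilon>1 = 1 \<or> \<epsilon>1 = - 1" "\<epsilon>2 = 1 \<or> \<epsilon>2 = - 1"
  shows "twistor_model U L L2 G \<gamma> \<gamma>2 r \<alpha> \<alpha>' \<alpha>2 \<beta> \<beta>' \<beta>2 t1 t2 \<epsilon>1 \<epsilon>2"
proof -
  have a: "(\<alpha> has_derivative \<alpha>' y) (at y)" "(\<beta> has_derivative \<beta>' y) (at y)"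
    "((\<lambda>z. \<alpha>' z u) has_derivative (\<lambda>v. \<alpha>2 y v u)) (at y)"
    "((\<lambda>z. \<beta>' z u) has_derivative (\<lambda>v. \<beta>2 y v u)) (at y)"
    "\<alpha>2 y u v = \<alpha>2 y v u" "\<beta>2 y u v = \<beta>2 y v u" if y: "y \<in> U" for y u v
    unfolding \<alpha>_def \<beta>_def \<alpha>'_def \<beta>'_def \<alpha>2_def \<beta>2_def D2_sym[OF y, of u v]
    by (intro has_derivative_fst has_derivative_snd psi_deriv D_deriv y refl)+
  have nz: "r y \<noteq> 0" "- r y \<noteq> 0" if "y \<in> U" for y
    using section_facts(1)[OF that] by auto
  have plus: "selfdual_section U L L2 G \<gamma> \<gamma>2 r \<alpha> \<alpha>' \<alpha>2"
    by (rule selfdual_section.intro[OF connection], rule selfdual_section_axioms.intro)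
      (use section_facts a nz in \<open>auto simp only:\<close>)
  have minus: "selfdual_section U L L2 G \<gamma> \<gamma>2 (\<lambda>y. - r y) \<beta> \<beta>' \<beta>2"
    by (rule selfdual_section.intro[OF connection], rule selfdual_section_axioms.intro)
      (use section_facts a nz in \<open>auto simp only:\<close>)
  show ?thesis
  proof (intro twistor_model.intro plus minus connection twistor_model_axioms.intro assms)
    fix y u assume y: "y \<in> U" and "L y u = 0" "\<alpha>' y u = 0" "\<beta>' y u = 0"
    then have "D y u = D y 0"
      by (simp add: L_def \<alpha>'_def \<beta>'_def prod_eq_iff linear_0[OF linear_D[OF y]])
    then show "u = 0"
      using C_chart(5)[OF b0 y] by (simp add: D_def inj_def)
  qed
qed

section \<open>Frames attached to the points and the fixed bundle chart\<close>

abbreviation "frame x \<equiv> twistor_frame A C (cinv C x)"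

lemma frame_eq: "x \<in> U \<Longrightarrow> frame x = frechet_derivative (psi (chart_at A (mm x))) (at x)"
  using bdom_point(2)[of x b0] by (simp add: twistor_frame_def tframe_def psi_def mm_def)

lemma frame_point: "x \<in> U \<Longrightarrow> x \<in> bdom (chart_at A (mm x))"
  unfolding bdom_iff[of x "chart_at A (mm x)"]
  using bdom_point(1,2)[of x b0] chart_at(2)[OF points_mm[OF _ b0], of x] unfolding mm_def by metis

definition "om s s' x u = s' x u + \<gamma> x u ** s x + s x ** transpose (\<gamma> x u)"

text \<open>The comparison of the two descriptions of a tangent vector: in the fixed bundle chart \<open>psi b0\<close>
  and in the bundle chart that the definitions attach to the point.\<close>

lemma frame_components:
  assumes x: "x \<in> U"
  shows "L x u = JJ b0 x *v fst (frame x u)"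
    "om \<alpha> \<alpha>' x u = JJ b0 x ** fst (vpart A g (cinv C x) (frame x u)) ** transpose (JJ b0 x)"
    "om \<beta> \<beta>' x u = JJ b0 x ** snd (vpart A g (cinv C x) (frame x u)) ** transpose (JJ b0 x)"
proof -
  define m where "m = mm x"
  define c where "c = chart_at A m"
  have c: "c \<in> A" "m \<in> cdom c"
    using chart_at[OF points_mm[OF x b0]] by (simp_all add: c_def m_def)
  have mb: "m \<in> cdom b0"
    using bdom_point(3)[OF x] by (simp add: m_def)
  have xc: "x \<in> bdom c"
    using frame_point[OF x] by (simp add: c_def m_def)
  define y where "y = cmap c m"
  define J where "J = JJ b0 x"
  have J: "J = Jac b0 c y"
    by (simp add: J_def JJ_def jacobian_at_eq c_def y_def m_def)
  have yo: "y \<in> overlap b0 c"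
    using c mb by (simp add: y_def overlapI)
  \<comment> \<open>At \<open>x\<close> itself \<open>c\<close> is the chart attached to the point;
    at neighbouring points another one may be attached.\<close>
  have JJc: "JJ c x = mat 1"
    using Jac_id[OF c] by (simp add: JJ_def jacobian_at_eq c_def m_def)
  have pc: "psi c x = (y, aa x, bb x)"
    using psi_eq[OF xc] by (simp add: JJc y_def m_def transpose_mat)
  obtain X a b where F: "frame x u = (X, a, b)"
    by (metis prod_cases3)
  define F1 where "F1 = (\<lambda>u. fst (frame x u))"
  define F2 where "F2 = (\<lambda>u. fst (snd (frame x u)))"
  define F3 where "F3 = (\<lambda>u. snd (snd (frame x u)))"
  have dpc: "(psi c has_derivative frame x) (at x)"
    using base_diff[OF c(1) xc] frame_eq[OF x] by (simp add: c_def m_def)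
  have d1: "((\<lambda>z. fst (psi c z)) has_derivative F1) (at x)"
    and d2: "((\<lambda>z. fst (snd (psi c z))) has_derivative F2) (at x)"
    and d3: "((\<lambda>z. snd (snd (psi c z))) has_derivative F3) (at x)"
    unfolding F1_def F2_def F3_def by (intro has_derivative_fst has_derivative_snd dpc)+
  define H where "H = (\<lambda>v. matrix (ddtrans b0 c y v))"
  have ddlin: "linear (ddtrans b0 c y v)" for v
  proof -
    have "linear (\<lambda>u. ddtrans b0 c y u v)"
      using dtrans_deriv[OF c(1) b0 yo] has_derivative_linear by blast
    then show ?thesis
      using ddtrans_sym[OF c(1) b0 yo] by (simp add: linear_iff)
  qed
  have "(Jac b0 c has_derivative H) (at y)"
  proof (rule has_derivative_matrixI)
    show "((\<lambda>z. Jac b0 c z $ i $ j) has_derivative (\<lambda>v. H v $ i $ j)) (at y)" for i j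
      using bounded_linear.has_derivative[OF bounded_linear_vec_nth dtrans_deriv[OF c(1) b0 yo]]
      by (simp add: Jac_def H_def matrix_def)
  qed
  then have dJ: "((\<lambda>z. Jac b0 c (fst (psi c z))) has_derivative (\<lambda>v. H (F1 v))) (at x)"
    by (intro has_derivative_compose[OF d1]) (simp add: pc)
  have open_W: "open (bdom c \<inter> U)" "x \<in> bdom c \<inter> U"
    using C_chart(3)[OF c(1)] C_chart(3)[OF b0] x xc by auto
  \<comment> \<open>The chart attached to \<open>z\<close> drops out by the chain rule, leaving a
    relation between the fixed charts \<open>b0\<close> and \<open>c\<close> that can be
    differentiated.\<close>
  have W: "psi b0 z = (transit b0 c (fst (psi c z)),
      Jac b0 c (fst (psi c z)) ** fst (snd (psi c z)) ** transpose (Jac b0 c (fst (psi c z))),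
      Jac b0 c (fst (psi c z)) ** snd (snd (psi c z)) ** transpose (Jac b0 c (fst (psi c z))))"
    if z: "z \<in> bdom c \<inter> U" for z
  proof -
    have zc: "z \<in> bdom c" "z \<in> U" and m: "mm z \<in> cdom c" "mm z \<in> cdom b0"
      using z bdom_point(3) by auto
    note e = chart_at[OF points_mm[OF zc(2) b0]]
    have "JJ b0 z = Jac b0 c (cmap c (mm z)) ** JJ c z"
      unfolding JJ_def jacobian_at_eq by (rule Jac_chain[OF e(1) c(1) b0 e(2) m])
    then show ?thesis
      using c m by (simp add: psi_eq[OF zc(1)] psi_eq[OF zc(2)] transit_cmap matrix_transpose_mul matrix_mul_assoc)
  qed
  have "((\<lambda>z. transit b0 c (fst (psi c z))) has_derivative (\<lambda>u. J *v F1 u)) (at x)"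
    by (rule has_derivative_eq_rhs, rule has_derivative_compose[OF d1], simp add: pc, rule transit_deriv[OF c(1) b0 yo])
      (simp add: J Jac_works[OF c(1) b0 yo])
  then have "(q has_derivative (\<lambda>u. J *v F1 u)) (at x)"
    by (rule has_derivative_transform_within_open[OF _ open_W]) (simp add: q_def W)
  from has_derivative_unique[OF q_deriv[OF x] this]
  have L: "L x u = J *v X"
    by (simp add: F1_def F)
  then show "L x u = JJ b0 x *v fst (frame x u)"
    by (simp add: J_def F)
  have "((\<lambda>z. Jac b0 c (fst (psi c z)) ** fst (snd (psi c z)) ** transpose (Jac b0 c (fst (psi c z)))) has_derivative
      (\<lambda>u. J ** aa x ** transpose (H (F1 u)) + (J ** F2 u + H (F1 u) ** aa x) ** transpose J)) (at x)"
    using has_derivative_matrix_mult[OF has_derivative_matrix_mult[OF dJ d2] has_derivative_transpose[OF dJ]]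
    by (simp add: pc J)
  then have "(\<alpha> has_derivative (\<lambda>u. J ** aa x ** transpose (H (F1 u)) + (J ** F2 u + H (F1 u) ** aa x) ** transpose J)) (at x)"
    by (rule has_derivative_transform_within_open[OF _ open_W]) (simp add: \<alpha>_def W)
  moreover have "(\<alpha> has_derivative \<alpha>' x) (at x)"
    unfolding \<alpha>_def \<alpha>'_def by (intro has_derivative_fst has_derivative_snd psi_deriv x)
  ultimately have "\<alpha>' x = (\<lambda>u. J ** aa x ** transpose (H (F1 u)) + (J ** F2 u + H (F1 u) ** aa x) ** transpose J)"
    by (intro has_derivative_unique)
  then have A': "\<alpha>' x u = J ** aa x ** transpose (H X) + (J ** a + H X ** aa x) ** transpose J"
    by (simp add: F1_def F2_def F)
  have "((\<lambda>z. Jac b0 c (fst (psi c z)) ** snd (snd (psi c z)) ** transpose (Jac b0 c (fst (psi c z)))) has_derivative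
      (\<lambda>u. J ** bb x ** transpose (H (F1 u)) + (J ** F3 u + H (F1 u) ** bb x) ** transpose J)) (at x)"
    using has_derivative_matrix_mult[OF has_derivative_matrix_mult[OF dJ d3] has_derivative_transpose[OF dJ]]
    by (simp add: pc J)
  then have "(\<beta> has_derivative (\<lambda>u. J ** bb x ** transpose (H (F1 u)) + (J ** F3 u + H (F1 u) ** bb x) ** transpose J)) (at x)"
    by (rule has_derivative_transform_within_open[OF _ open_W]) (simp add: \<beta>_def W)
  moreover have "(\<beta> has_derivative \<beta>' x) (at x)"
    unfolding \<beta>_def \<beta>'_def by (intro has_derivative_snd psi_deriv x)
  ultimately have "\<beta>' x = (\<lambda>u. J ** bb x ** transpose (H (F1 u)) + (J ** F3 u + H (F1 u) ** bb x) ** transpose J)"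
    by (intro has_derivative_unique)
  then have B': "\<beta>' x u = J ** bb x ** transpose (H X) + (J ** b + H X ** bb x) ** transpose J"
    by (simp add: F1_def F3_def F)
  have yc: "y \<in> cmap c ` cdom c"
    using c by (simp add: y_def)
  \<comment> \<open>The transformation law in matrix form; it turns the derivative
    \<open>H X\<close> of the Jacobian into a difference of connection forms.\<close>
  have HX: "J ** Gam c y X = \<gamma> x u ** J + H X"
    unfolding matrix_eq
  proof
    fix v
    show "(J ** Gam c y X) *v v = (\<gamma> x u ** J + H X) *v v"
      using Chr_transform[OF c b0 mb, of X v]
      by (simp add: matrix_vector_simps \<gamma>_def L q_eq[OF x] H_def matrix_works_real[OF ddlin] Gam_works[OF c(1) yc]
          Gam_works[OF b0 imageI[OF mb]] J Jac_works[OF c(1) b0 yo] flip: matrix_vector_mul_assoc m_def y_def)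
  qed
  have v: "vpart A g (cinv C x) (frame x u)
    = (a + (Gam c y X ** aa x + aa x ** transpose (Gam c y X)), b + (Gam c y X ** bb x + bb x ** transpose (Gam c y X)))"
    unfolding F unfolding bdom_point(4)[OF x]
    by (simp add: vpart_def hlift_def tensor_gamma_def base_gamma_def Let_def Gam_def Chr_def gloc_def c_def y_def m_def)
  have main: "(J ** s ** transpose (H X) + (J ** s' + H X ** s) ** transpose J) + \<gamma> x u ** (J ** s ** transpose J)
      + (J ** s ** transpose J) ** transpose (\<gamma> x u)
    = J ** (s' + (Gam c y X ** s + s ** transpose (Gam c y X))) ** transpose J" for s s'
  proof -
    have "J ** (s' + (Gam c y X ** s + s ** transpose (Gam c y X))) ** transpose J
      = J ** s' ** transpose J + (J ** Gam c y X) ** s ** transpose J + J ** s ** transpose (J ** Gam c y X)"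
      by (simp add: matrix_mult_simps matrix_transpose_mul matrix_mul_assoc)
    also have "\<dots> = (J ** s ** transpose (H X) + (J ** s' + H X ** s) ** transpose J) + \<gamma> x u ** (J ** s ** transpose J)
      + (J ** s ** transpose J) ** transpose (\<gamma> x u)"
      unfolding HX by (simp add: matrix_mult_simps matrix_transpose_mul matrix_mul_assoc transpose_simps)
    finally show ?thesis
      by simp
  qed
  show "om \<alpha> \<alpha>' x u = JJ b0 x ** fst (vpart A g (cinv C x) (frame x u)) ** transpose (JJ b0 x)"
    unfolding om_def A' \<alpha>_eq[OF x] J_def[symmetric] v main by simp
  show "om \<beta> \<beta>' x u = JJ b0 x ** snd (vpart A g (cinv C x) (frame x u)) ** transpose (JJ b0 x)"
    unfolding om_def B' \<beta>_eq[OF x] J_def[symmetric] v main by simp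
qed

end

section \<open>The properties \<open>D\<^sub>1\<close> and \<open>D\<^sub>3\<close>\<close>

lemma christoffel_cong_open:
  assumes "open S" "x \<in> S" "\<And>y u v. y \<in> S \<Longrightarrow> h y u v = k y u v"
  shows "christoffel h x = christoffel k x"
proof -
  have "is_levi_civita h x = is_levi_civita k x"
    unfolding is_levi_civita_def fun_eq_iff
    using frechet_derivative_cong_open[OF assms(1,2), of "\<lambda>y. h y _ _" "\<lambda>y. k y _ _"] assms by simp
  then show ?thesis
    by (simp add: christoffel_def)
qed

text \<open>The linear bijection \<open>F\<close> carries both properties to the coordinate space.
  From \<open>D1\<close> to \<open>D3\<close>, skew-symmetry makes \<open>nab\<close> vanish on the
  diagonal, so \<open>alpha\<close> is zero and both sides of \<open>D3\<close> vanish.\<close>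

lemma (in local_product_structure) D3_iff_D1_at:
  fixes F :: "'e::euclidean_space \<Rightarrow> 'v::euclidean_space"
  assumes F: "linear F" "inj F" "range F = T p"
    and G: "\<And>u v. G p (F u) (F v) = h x u v"
    and P: "\<And>u. P p (F u) = F (Q x u)"
    and nab: "\<And>u v. nabla_endo Fr G P c p (F u) (F v) = F (nabla_coord h Q x u v)"
    and diag: "(\<forall>v w. Q x v = - v \<longrightarrow> Q x w = w \<longrightarrow> h x (nabla_coord h Q x v v) w = 0) \<or>
      (\<exists>v. v \<noteq> 0 \<and> Q x v = - v \<and> (\<forall>w. Q x w = w \<longrightarrow> h x (nabla_coord h Q x v v) w = 0))"
    and D: "D = minus_eigen T P"
  shows "(\<forall>X\<in>D p. \<forall>Y\<in>D p. \<forall>Z\<in>orth_compl T G D p.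
        G p (nabla_endo Fr G P c p X Y) Z + G p (nabla_endo Fr G P c p Y X) Z
          = 2 / real (dim (D p)) * G p X Y * alpha Fr G P D c p Z)
    \<longleftrightarrow> (\<forall>X\<in>D p. \<forall>Y\<in>D p. nabla_endo Fr G P c p X Y = - nabla_endo Fr G P c p Y X)"
    (is "?D3 \<longleftrightarrow> ?D1")
proof -
  have Fn: "F u = - F v \<longleftrightarrow> u = - v" for u v
    using F(2) by (simp add: inj_eq flip: linear_neg[OF F(1)])
  define N where "N = {u. Q x u = - u}"
  have Dp: "D p = F ` N"
  proof (intro equalityI subsetI)
    fix X assume "X \<in> D p"
    then have X: "X \<in> range F" "P p X = - X"
      by (simp_all add: D minus_eigen_def F(3))
    then obtain u where "X = F u"
      by blast
    with X(2) show "X \<in> F ` N"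
      by (auto simp: P Fn N_def)
  next
    fix X assume "X \<in> F ` N"
    then obtain u where "X = F u" "Q x u = - u"
      by (auto simp: N_def)
    moreover have "F u \<in> T p" for u
      using F(3) by blast
    ultimately show "X \<in> D p"
      by (simp add: D minus_eigen_def P linear_neg[OF F(1)])
  qed
  have orth: "F w \<in> orth_compl T G D p" if "Q x w = w" for w
    using that F(3) eigen_orthogonal by (auto simp: orth_compl_def Dp N_def G)
  have orth': "\<exists>z. Z = F z" if "Z \<in> orth_compl T G D p" for Z
    using that F(3) by (auto simp: orth_compl_def)
  have hpos: "h x v v > 0" if "v \<noteq> 0" for v
    using inner_product[OF x_U] that by (simp add: is_inner_product_def)
  show ?thesis
  proof
    assume D1: ?D1
    have skew: "nab u v = - nab v u" if "u \<in> N" "v \<in> N" for u v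
    proof -
      have "nabla_endo Fr G P c p (F u) (F v) = - nabla_endo Fr G P c p (F v) (F u)"
        using D1 that unfolding Dp by blast
      then show ?thesis
        by (simp only: nab Fn)
    qed
    have "nab u u + nab u u = 0" if "u \<in> N" for u
      using skew[OF that that] by (metis add.right_inverse)
    then have zero: "nab u u = 0" if "u \<in> N" for u
      using that by (simp flip: scaleR_2)
    have sub: "subspace N"
      using linear_Q[OF x_U] by (auto simp: N_def subspace_def linear_add linear_cmul linear_0)
    obtain E where E: "is_onb (h x) N E"
      using onb_exists[OF bil[OF x_U] sym[OF x_U] hpos sub] by blast
    have "is_onb (G p) (D p) (F ` E)"
      unfolding is_onb_def Dp
    proof (intro conjI)
      show "finite (F ` E)" "F ` E \<subseteq> F ` N" "span (F ` E) = F ` N"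
        using E linear_span_image[OF F(1), of E] by (auto simp: is_onb_def)
      show "\<forall>e\<in>F ` E. \<forall>f\<in>F ` E. G p e f = (if e = f then 1 else 0)"
        using E by (simp add: is_onb_def G inj_eq[OF F(2)])
    qed
    \<comment> \<open>Only because some orthonormal basis exists does the choice in
      \<open>alpha\<close> return one; otherwise its vectors would not be known to lie in
      \<open>D p\<close>.\<close>
    then have onb: "is_onb (G p) (D p) (SOME E. is_onb (G p) (D p) E)"
      by (rule someI)
    have "alpha Fr G P D c p (F z) = 0" for z
      unfolding alpha_def
    proof (rule sum.neutral, rule ballI)
      fix e assume "e \<in> (SOME E. is_onb (G p) (D p) E)"
      moreover have "(SOME E. is_onb (G p) (D p) E) \<subseteq> F ` N"
        using onb unfolding is_onb_def Dp by (elim conjE)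
      ultimately obtain u where "u \<in> N" "e = F u"
        by blast
      then show "G p (nabla_endo Fr G P c p e e) (F z) = 0"
        by (simp add: nab zero G hx)
    qed
    moreover have "h x (nab u v) z + h x (nab v u) z = 0" if "u \<in> N" "v \<in> N" for u v z
      using skew[OF that] by (simp add: hx)
    ultimately have "G p (nabla_endo Fr G P c p (F u) (F v)) Z + G p (nabla_endo Fr G P c p (F v) (F u)) Z
        = 2 / real (dim (D p)) * G p (F u) (F v) * alpha Fr G P D c p Z"
      if "u \<in> N" "v \<in> N" "Z \<in> orth_compl T G D p" for u v Z
      using that(1,2) orth'[OF that(3)] by (auto simp only: nab G mult_zero_right)
    then show ?D3
      unfolding Dp by blast
  next
    assume D3: ?D3
    have D3': "2 * h x (nab u u) w = 2 / real (dim (D p)) * h x u u * alpha Fr G P D c p (F w)"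
      if "u \<in> N" "Q x w = w" for u w
    proof -
      have "F u \<in> D p" "F w \<in> orth_compl T G D p"
        using that orth by (auto simp: Dp)
      with D3 have "G p (nabla_endo Fr G P c p (F u) (F u)) (F w) + G p (nabla_endo Fr G P c p (F u) (F u)) (F w)
          = 2 / real (dim (D p)) * G p (F u) (F u) * alpha Fr G P D c p (F w)"
        by blast
      then show ?thesis
        by (simp add: nab G)
    qed
    have "h x (nab u u) w = 0" if u: "Q x u = - u" and w: "Q x w = w" for u w
      using diag
    proof
      assume "\<exists>v. v \<noteq> 0 \<and> Q x v = - v \<and> (\<forall>w. Q x w = w \<longrightarrow> h x (nab v v) w = 0)"
      then obtain v where v: "v \<noteq> 0" "v \<in> N" "\<And>w. Q x w = w \<Longrightarrow> h x (nab v v) w = 0"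
        by (auto simp: N_def)
      have "F v \<noteq> 0"
        using v(1) F(2) linear_0[OF F(1)] by (metis injD)
      \<comment> \<open>Otherwise \<open>2 / real (dim (D p))\<close> would be 0, division by zero
        being 0, and the equation would say nothing on \<open>alpha\<close>.\<close>
      then have "dim (D p) \<noteq> 0"
        using v(2) by (auto simp: Dp)
      moreover have "2 / real (dim (D p)) * h x v v * alpha Fr G P D c p (F w) = 0"
        using D3'[OF v(2) w] v(3)[OF w] by simp
      ultimately have "alpha Fr G P D c p (F w) = 0"
        using hpos[OF v(1)] by simp
      then show ?thesis
        using D3'[of u w] u w by (simp add: N_def)
    qed (use u w in blast)
    then have "nab u v = - nab v u" if "u \<in> N" "v \<in> N" for u v
      using that by (intro nab_skew) (simp_all add: N_def)
    then show ?D1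
      unfolding Dp ball_simps by (simp only: nab Fn) blast
  qed
qed

section \<open>Transfer from the coordinate model to the twistor product\<close>

lemma fst_hlift: "fst (hlift A g \<kappa> X) = X"
  by (simp add: hlift_def split: prod.split)

lemma tangent_split: "\<xi> = hlift A g \<kappa> (fst \<xi>) + (0, vpart A g \<kappa> \<xi>)"
  by (simp add: vpart_def prod_eq_iff fst_hlift)

lemma vpart_hlift: "vpart A g \<kappa> (hlift A g \<kappa> X + (0, V)) = V"
  by (simp add: vpart_def fst_hlift)

lemma tangent_eqI: "fst \<xi> = fst \<eta> \<Longrightarrow> vpart A g \<kappa> \<xi> = vpart A g \<kappa> \<eta> \<Longrightarrow> \<xi> = \<eta>"
  using tangent_split[of \<xi> A g \<kappa>] tangent_split[of \<eta> A g \<kappa>] by simp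

context twistor_chart
begin

context
  fixes t1 t2 \<epsilon>1 \<epsilon>2 :: real and \<nu> :: nat
  assumes t: "t1 > 0" "t2 > 0" and \<epsilon>: "\<epsilon>1 = 1 \<or> \<epsilon>1 = - 1" "\<epsilon>2 = 1 \<or> \<epsilon>2 = - 1"
    and \<nu>: "\<And>V W. vert_K \<nu> (V, W) = (\<epsilon>1 *\<^sub>R V, \<epsilon>2 *\<^sub>R W)"
begin

interpretation tm: twistor_model U L L2 G \<gamma> \<gamma>2 r \<alpha> \<alpha>' \<alpha>2 \<beta> \<beta>' \<beta>2 t1 t2 \<epsilon>1 \<epsilon>2
  by (rule model[OF t \<epsilon>])

context
  fixes x assumes x: "x \<in> U"
begin

lemma JJ_nz: "det (JJ b0 x) \<noteq> 0"
  using JJ_det[OF x b0] by simp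

lemma components:
  "L x u = JJ b0 x *v fst (frame x u)"
  "tm.plus.om x u = JJ b0 x ** fst (vpart A g (cinv C x) (frame x u)) ** transpose (JJ b0 x)"
  "tm.minus.om x u = JJ b0 x ** snd (vpart A g (cinv C x) (frame x u)) ** transpose (JJ b0 x)"
  using frame_components[OF x, of u] by (simp_all add: tm.plus.om_def tm.minus.om_def om_def)

lemma GJ: "gram (g (mm x)) = transpose (JJ b0 x) ** G x ** JJ b0 x"
  using gram_JJ[OF x b0] by (simp add: G_def q_eq[OF x])

lemma frame_linear: "linear (frame x)"
  using base_diff[OF chart_at(1)[OF points_mm[OF x b0]] frame_point[OF x]] has_derivative_linear
  by (auto simp: frame_eq[OF x])

lemma frame_inj: "inj (frame x)"
  using C_chart(5)[OF chart_at(1)[OF points_mm[OF x b0]] frame_point[OF x]] by (simp add: frame_eq[OF x])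

lemma vert_space_iff: "(V, W) \<in> vert_space g (cinv C x) \<longleftrightarrow>
    selfdual (G x) (r x) (JJ b0 x ** V ** transpose (JJ b0 x)) \<and> ip (G x) (JJ b0 x ** V ** transpose (JJ b0 x)) (\<alpha> x) = 0 \<and>
    selfdual (G x) (- r x) (JJ b0 x ** W ** transpose (JJ b0 x)) \<and> ip (G x) (JJ b0 x ** W ** transpose (JJ b0 x)) (\<beta> x) = 0"
  unfolding bdom_point(4)[OF x]
  by (auto simp: vert_space_def Lambda2_JJ[OF x b0] biv_inner_JJ[OF x b0] G_def r_def q_eq[OF x] \<alpha>_eq[OF x] \<beta>_eq[OF x])

lemma frame_eqI:
  assumes "L x u = JJ b0 x *v X" "tm.plus.om x u = JJ b0 x ** V ** transpose (JJ b0 x)"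
    "tm.minus.om x u = JJ b0 x ** W ** transpose (JJ b0 x)"
  shows "frame x u = hlift A g (cinv C x) X + (0, V, W)"
proof (rule tangent_eqI[of _ _ A g "cinv C x"])
  show "fst (frame x u) = fst (hlift A g (cinv C x) X + (0, V, W))"
    using assms(1) by (simp add: components matrix_cancel[OF JJ_nz] fst_hlift)
  show "vpart A g (cinv C x) (frame x u) = vpart A g (cinv C x) (hlift A g (cinv C x) X + (0, V, W))"
    using assms(2,3) by (simp add: components matrix_cancel[OF JJ_nz] vpart_hlift prod_eq_iff)
qed

text \<open>The nontrivial inclusion rests on the dimension count in the model, through
  \<open>tm.frame_surj\<close>.\<close>

lemma range_frame: "range (frame x) = twistor_tangent A g (cinv C x)"
proof (intro equalityI subsetI)
  fix \<xi> assume "\<xi> \<in> range (frame x)"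
  then obtain u where u: "\<xi> = frame x u"
    by blast
  have "vpart A g (cinv C x) \<xi> \<in> vert_space g (cinv C x)"
    using tm.plus.om_selfdual[OF x, of u] tm.minus.om_selfdual[OF x, of u]
    by (cases "vpart A g (cinv C x) \<xi>") (simp add: vert_space_iff components flip: u)
  then show "\<xi> \<in> twistor_tangent A g (cinv C x)"
    using tangent_split[of \<xi> A g "cinv C x"] unfolding twistor_tangent_def by blast
next
  fix \<xi> assume "\<xi> \<in> twistor_tangent A g (cinv C x)"
  then obtain X V W where \<xi>: "\<xi> = hlift A g (cinv C x) X + (0, V, W)" "(V, W) \<in> vert_space g (cinv C x)"
    unfolding twistor_tangent_def by (auto simp: split_paired_all)
  obtain u where "L x u = JJ b0 x *v X" "tm.plus.om x u = JJ b0 x ** V ** transpose (JJ b0 x)"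
    "tm.minus.om x u = JJ b0 x ** W ** transpose (JJ b0 x)"
    using tm.frame_surj[OF x] \<xi>(2) unfolding vert_space_iff by blast
  from frame_eqI[OF this] show "\<xi> \<in> range (frame x)"
    using \<xi>(1) by (metis rangeI)
qed

lemma Gmetric_frame: "Gmetric A g t1 t2 (cinv C x) (frame x u) (frame x v) = tm.h x u v"
proof -
  have fst: "fst (cinv C x) = mm x"
    by (simp add: mm_def)
  have "g (mm x) X Y = (JJ b0 x *v X) \<bullet> (G x *v (JJ b0 x *v Y))" for X Y
    unfolding bilinear_gram[OF inner_product_bilinear[OF inner_product_g[OF points_mm[OF x b0]]]] GJ
    using inner_transpose_mult[of "transpose (JJ b0 x)"]
    by (simp only: transpose_transpose) (simp add: matrix_vector_mul_assoc matrix_mul_assoc)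
  then show ?thesis
    unfolding Gmetric_def fst biv_inner_JJ[OF x b0] tm.h_def tm.plus.T_def tm.minus.T_def components
    by (simp add: G_def q_eq[OF x])
qed

lemma almost_product_frame: "almost_product A g \<nu> (cinv C x) (frame x u) = frame x (tm.Q x u)"
proof -
  obtain V W where VW: "vpart A g (cinv C x) (frame x u) = (V, W)"
    by fastforce
  define X where "X = fst (frame x u)"
  note ip = inner_product_g[OF points_mm[OF x b0]]
  have skew: "transpose (aa x) = - aa x" "transpose (bb x) = - bb x"
    using fibres[OF x b0] by (auto simp: Lambda2_def bivectors_def)
  have "frame x (tm.Q x u) = hlift A g (cinv C x) (Kend (g (mm x)) (aa x) (Kend (g (mm x)) (bb x) X)) + (0, \<epsilon>1 *\<^sub>R V, \<epsilon>2 *\<^sub>R W)"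
  proof (rule frame_eqI)
    show "L x (tm.Q x u) = JJ b0 x *v Kend (g (mm x)) (aa x) (Kend (g (mm x)) (bb x) X)"
      unfolding tm.Q(1)[OF x] tm.S_def Kend_eq[OF ip skew(1)] Kend_eq[OF ip skew(2)]
      by (simp add: components \<alpha>_eq[OF x] \<beta>_eq[OF x] GJ matrix_vector_simps X_def matrix_vector_mul_assoc matrix_mul_assoc)
    show "tm.plus.om x (tm.Q x u) = JJ b0 x ** (\<epsilon>1 *\<^sub>R V) ** transpose (JJ b0 x)"
      "tm.minus.om x (tm.Q x u) = JJ b0 x ** (\<epsilon>2 *\<^sub>R W) ** transpose (JJ b0 x)"
      unfolding tm.Q(2,3)[OF x] by (simp_all add: components VW matrix_mult_simps)
  qed
  moreover have "almost_product A g \<nu> (cinv C x) \<xi> = hlift A g (cinv C x) (Kend (g (mm x)) (aa x) (Kend (g (mm x)) (bb x) (fst \<xi>)))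
      + (0, vert_K \<nu> (vpart A g (cinv C x) \<xi>))" for \<xi>
    unfolding bdom_point(4)[OF x] by (simp add: almost_product_def)
  ultimately show ?thesis
    by (simp add: VW \<nu> X_def)
qed

end

text \<open>The local expressions of metric and structure agree with those of the model on the whole
  open set \<open>U\<close>, so their derivatives and Christoffel symbols agree too.\<close>

lemma nabla_endo_frame:
  assumes x: "x \<in> U"
  shows "nabla_endo (twistor_frame A) (Gmetric A g t1 t2) (almost_product A g \<nu>) C (cinv C x) (frame x u) (frame x v)
    = frame x (nabla_coord tm.h tm.Q x u v)"
proof -
  have h: "local_form (twistor_frame A) (Gmetric A g t1 t2) C y u v = tm.h y u v" if "y \<in> U" for y u v
    using Gmetric_frame[OF that] by (simp add: local_form_def)
  have Q: "local_endo (twistor_frame A) (almost_product A g \<nu>) C y u = tm.Q y u" if "y \<in> U" for y u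
    using almost_product_frame[OF that] frame_inj[OF that] by (simp add: local_endo_def)
  have "christoffel (local_form (twistor_frame A) (Gmetric A g t1 t2) C) x = christoffel tm.h x"
    by (rule christoffel_cong_open[OF C_chart(3)[OF b0] x h])
  moreover have "frechet_derivative (\<lambda>y. local_endo (twistor_frame A) (almost_product A g \<nu>) C y v) (at x)
      = frechet_derivative (\<lambda>y. tm.Q y v) (at x)"
    by (rule frechet_derivative_cong_open[OF C_chart(3)[OF b0] x Q])
  ultimately show ?thesis
    using frame_inj[OF x] by (simp add: nabla_endo_def Let_def bdom_point(2)[OF x] nabla_coord_def Q[OF x])
qed

lemma D3_iff_D1_point:
  assumes x: "x \<in> U" and "\<epsilon>1 = 1 \<and> \<epsilon>2 = 1 \<or> \<epsilon>1 = - 1 \<or> \<epsilon>2 = - 1"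
  defines "\<kappa> \<equiv> cinv C x"
  shows "(\<forall>X\<in>D_perp A g \<nu> \<kappa>. \<forall>Y\<in>D_perp A g \<nu> \<kappa>. \<forall>Z\<in>orth_compl (twistor_tangent A g) (Gmetric A g t1 t2) (D_perp A g \<nu>) \<kappa>.
        Gmetric A g t1 t2 \<kappa> (nabla_endo (twistor_frame A) (Gmetric A g t1 t2) (almost_product A g \<nu>) C \<kappa> X Y) Z
        + Gmetric A g t1 t2 \<kappa> (nabla_endo (twistor_frame A) (Gmetric A g t1 t2) (almost_product A g \<nu>) C \<kappa> Y X) Z
          = 2 / real (dim (D_perp A g \<nu> \<kappa>)) * Gmetric A g t1 t2 \<kappa> X Y
            * alpha (twistor_frame A) (Gmetric A g t1 t2) (almost_product A g \<nu>) (D_perp A g \<nu>) C \<kappa> Z)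
    \<longleftrightarrow> (\<forall>X\<in>D_perp A g \<nu> \<kappa>. \<forall>Y\<in>D_perp A g \<nu> \<kappa>.
        nabla_endo (twistor_frame A) (Gmetric A g t1 t2) (almost_product A g \<nu>) C \<kappa> X Y
        = - nabla_endo (twistor_frame A) (Gmetric A g t1 t2) (almost_product A g \<nu>) C \<kappa> Y X)"
  unfolding \<kappa>_def
proof (rule local_product_structure.D3_iff_D1_at[where F = "frame x" and p = "cinv C x" and T = "twistor_tangent A g"
      and G = "Gmetric A g t1 t2" and P = "almost_product A g \<nu>", OF tm.product_structure[OF x] frame_linear[OF x] frame_inj[OF x] range_frame[OF x]
      Gmetric_frame[OF x] almost_product_frame[OF x] nabla_endo_frame[OF x]])
  show "(\<forall>v w. tm.Q x v = - v \<longrightarrow> tm.Q x w = w \<longrightarrow> tm.h x (nabla_coord tm.h tm.Q x v v) w = 0) \<or>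
      (\<exists>v. v \<noteq> 0 \<and> tm.Q x v = - v \<and> (\<forall>w. tm.Q x w = w \<longrightarrow> tm.h x (nabla_coord tm.h tm.Q x v v) w = 0))"
    using assms(2)
  proof
    assume "\<epsilon>1 = 1 \<and> \<epsilon>2 = 1"
    then show ?thesis
      using tm.nab_horizontal[OF x] by blast
  next
    assume "\<epsilon>1 = - 1 \<or> \<epsilon>2 = - 1"
    then show ?thesis
      using tm.vertical_exists[OF x] tm.nab_vertical[OF x] by blast
  qed
qed (simp add: D_perp_def)

end

end

lemma twistor_chart_exists:
  assumes A: "oriented_riemannian A g" and C: "C \<in> twistor_atlas A g" and \<kappa>: "\<kappa> \<in> cdom C"
  shows "\<exists>b x. twistor_chart A g C b \<and> x \<in> twistor_chart.bdom A C b \<and> cinv C x = \<kappa>"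
proof -
  have "\<kappa> \<in> twistor_product A g" and inj: "inj_on (cmap C) (cdom C)"
    using C \<kappa> by (auto simp: twistor_atlas_def submanifold_atlas_def)
  then obtain b where b: "b \<in> A" "fst \<kappa> \<in> cdom b"
    by (auto simp: twistor_product_def points_def)
  have chart: "twistor_chart A g C b"
    by (rule twistor_chart.intro[OF A twistor_chart_axioms.intro[OF C b(1)]])
  have "cmap C \<kappa> \<in> twistor_chart.bdom A C b"
    unfolding twistor_chart.bdom_iff[OF chart] using b(2) \<kappa> by (intro exI[of _ \<kappa>] conjI refl)
  with chart cinv_cmap[OF inj \<kappa>] show ?thesis
    by blast
qed

theorem proposition9:
  fixes A :: "('m, real ^ 4) chart set"
    and g :: "'m \<Rightarrow> real ^ 4 \<Rightarrow> real ^ 4 \<Rightarrow> real"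
    and t1 t2 :: real
    and \<nu> :: nat
  assumes "smooth_manifold A"
    and "oriented_atlas A"
    and "riemannian_metric A g"
    and "t1 > 0" and "t2 > 0"
    and "\<nu> \<in> {1, 2, 3, 4}"
  shows "property_D3 (twistor_atlas A g) (twistor_frame A) (twistor_tangent A g)
           (Gmetric A g t1 t2) (almost_product A g \<nu>) (D_perp A g \<nu>)
     \<longleftrightarrow> property_D1 (twistor_atlas A g) (twistor_frame A)
           (Gmetric A g t1 t2) (almost_product A g \<nu>) (D_perp A g \<nu>)"
proof -
  have A: "oriented_riemannian A g"
    using assms(1-3) by (intro oriented_riemannian.intro) (simp_all add: smooth_manifold_def)
  \<comment> \<open>The signs are read off from the four cases of \<open>vert_K\<close>; both are 1
    exactly when the distribution is horizontal.\<close>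
  define \<epsilon>1 \<epsilon>2 :: real where "\<epsilon>1 = (if \<nu> = 3 \<or> \<nu> = 4 then - 1 else 1)" and "\<epsilon>2 = (if \<nu> = 2 \<or> \<nu> = 3 then - 1 else 1)"
  have \<epsilon>: "\<epsilon>1 = 1 \<or> \<epsilon>1 = - 1" "\<epsilon>2 = 1 \<or> \<epsilon>2 = - 1" "\<epsilon>1 = 1 \<and> \<epsilon>2 = 1 \<or> \<epsilon>1 = - 1 \<or> \<epsilon>2 = - 1"
    by (auto simp: \<epsilon>1_def \<epsilon>2_def)
  have \<nu>: "vert_K \<nu> (V, W) = (\<epsilon>1 *\<^sub>R V, \<epsilon>2 *\<^sub>R W)" for V W
    using assms(6) by (auto simp: vert_K_def \<epsilon>1_def \<epsilon>2_def)
  show ?thesis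
    unfolding property_D3_def property_D1_def
  proof (rule ball_cong[OF refl], rule ball_cong[OF refl], goal_cases)
    case (1 C \<kappa>)
    from twistor_chart_exists[OF A this] obtain b x where "twistor_chart A g C b"
      and x: "x \<in> twistor_chart.bdom A C b" "cinv C x = \<kappa>"
      by blast
    from twistor_chart.D3_iff_D1_point[OF this(1) assms(4,5) \<epsilon>(1,2) \<nu> x(1) \<epsilon>(3)] show ?case
      unfolding x(2) .
  qed
qed

end
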